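(* Suppose that the system $\dot x=y+X(x,y,\delta),\ \dot y=Y(x,y,\delta)$ satisfies, for all $\delta\in D$ and a fixed integer $n\ge 2$, $g(x,\delta)=x^{2n-1}(a_{2n-1}(\delta)+O(x))$ with $a_{2n-1}(\delta)>0$, and $f(x,\delta)=\sum_{j\ge n-1}b_j(\delta)x^j$ with $b_{n-1}^2(\delta)-4n a_{2n-1}(\delta)<0$. Let $v_j(\delta)$ be the coefficients of the expansion $\bar P(x_0,\delta)-x_0=\sum_{j\ge1}v_j(\delta)x_0^j$. Then for any integer $k\ge1$ the coefficients $v_1,v_2,\dots,v_{kn}$ depend only on the terms of degree at most $(k+2)n-2$ (in $(x,y)$) of the expansions of the functions $X$ and $Y$ at the origin.
   Context: The planar system is $\dot x=y+X(x,y,\delta),\ \dot y=Y(x,y,\delta)$, where $\delta=(\delta_1,\dots,\delta_m)\in D\subset\mathbb{R}^m$, $D$ is compact, $X,Y$ are real analytic, and $X,Y=O(|x,y|^2)$ for $(x,y)$ near the origin and $\delta\in D$. Let $y=F(x,\delta)$ be the solution of $y+X(x,y,\delta)=0$ with $F(0,\delta)=0$, and define $$g(x,\delta)=-Y(x,F(x,\delta),\delta),\qquad f(x,\delta)=-\left[\frac{\partial X}{\partial x}(x,F(x,\delta),\delta)+\frac{\partial Y}{\partial y}(x,F(x,\delta),\delta)\right].$$ Under the assumptions in the claim the origin is a center or a focus for all $\delta\in D$. Poincaré return map: for $\delta\in D$ and $x_0\ne0$ with $|x_0|$ small, let $(x(t,x_0,\delta),y(t,x_0,\delta))$ be the solution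 of the system with initial condition $(x_0,F(x_0,\delta))$, and let $\tau>0$ be the least positive number with $y(\tau,x_0,\delta)=F(x(\tau,x_0,\delta),\delta)$ and $x_0\,x(\tau,x_0,\delta)>0$. Put $P(x_0,\delta)=x(\tau,x_0,\delta)$ and $P(0,\delta)=0$. The function $\bar P(x_0,\delta)$ is the unique function analytic in $x_0$ at $x_0=0$ that coincides with $P(x_0,\delta)$ for small $x_0>0$. "Depend only on the terms of degree at most $N$" means: two systems of the form $\dot x=y+X(x,y,\delta),\ \dot y=Y(x,y,\delta)$, with $X,Y$ real analytic, $X,Y=O(|x,y|^2)$, and with the associated functions $g$ and $f$ satisfying $g(x,\delta)=x^{2n-1}(a_{2n-1}(\delta)+O(x))$, $a_{2n-1}(\delta)>0$, $f(x,\delta)=\sum_{j\ge n-1}b_j(\delta)x^j$, $b_{n-1}^2(\delta)-4n a_{2n-1}(\delta)<0$ for all $\delta\in D$ (with the same $n$), whose $X$ and $Y$ have the same Taylor terms of degree at most $N$ at the origin have the same coefficients $v_1,\dots,v_{kn}$. *)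

theory Defs
  imports "HOL-Analysis.Analysis" "HOL-Library.Landau_Symbols"
begin

(* Multi-indices are the extensional functions from Basis to nat; has_sum is unconditional
   (hence, over the reals, absolute) summation. *)
definition real_analytic_at :: "('a::euclidean_space \<Rightarrow> real) \<Rightarrow> 'a \<Rightarrow> bool" where
  "real_analytic_at h p \<longleftrightarrow>
     (\<exists>c. \<exists>r>0. \<forall>z\<in>ball p r.
        ((\<lambda>\<alpha>. c \<alpha> * (\<Prod>b\<in>Basis. ((z - p) \<bullet> b) ^ \<alpha> b)) has_sum h z)
          (Basis \<rightarrow>\<^sub>E (UNIV :: nat set)))"

(* As for analytic_on, this asks for analyticity on a neighbourhood of every point of S. *)
definition real_analytic_on :: "('a::euclidean_space \<Rightarrow> real) \<Rightarrow> 'a set \<Rightarrow> bool" where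
  "real_analytic_on h S \<longleftrightarrow> (\<forall>p\<in>S. real_analytic_at h p)"

(* Right-hand sides of x' = y + X(x,y,d), y' = Y(x,y,d): X and Y are real analytic, jointly in
   (x,y,d), near {(0,0)} x D, and O(|x,y|^2) for (x,y) near the origin, uniformly in d : D.
   Values of X and Y away from {(0,0)} x D are irrelevant. *)
definition higher_order_term ::
    "(real^'m) set \<Rightarrow> (real \<Rightarrow> real \<Rightarrow> real^'m \<Rightarrow> real) \<Rightarrow> bool" where
  "higher_order_term D X \<longleftrightarrow>
     real_analytic_on (\<lambda>(x, y, \<delta>). X x y \<delta>) {(0, 0, \<delta>) |\<delta>. \<delta> \<in> D} \<and>
     (\<lambda>((x, y), \<delta>). X x y \<delta>) \<in> O[nhds (0, 0) \<times>\<^sub>F principal D](\<lambda>((x, y), \<delta>). (norm (x, y))\<^sup>2)"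

(* F(.,d) is determined as a germ at 0: continuity at 0 selects the branch of the solution set
   of y + X(x,y,d) = 0 given by the implicit function theorem. *)
definition implicit_solution ::
    "(real^'m) set \<Rightarrow> (real \<Rightarrow> real \<Rightarrow> real^'m \<Rightarrow> real) \<Rightarrow> (real \<Rightarrow> real^'m \<Rightarrow> real) \<Rightarrow> bool" where
  "implicit_solution D X F \<longleftrightarrow>
     (\<forall>\<delta>\<in>D. F 0 \<delta> = 0 \<and> isCont (\<lambda>x. F x \<delta>) 0 \<and>
            (\<forall>\<^sub>F x in nhds 0. F x \<delta> + X x (F x \<delta>) \<delta> = 0))"

definition g_fun ::
    "(real \<Rightarrow> real \<Rightarrow> real^'m \<Rightarrow> real) \<Rightarrow> (real \<Rightarrow> real^'m \<Rightarrow> real) \<Rightarrow> real \<Rightarrow> real^'m \<Rightarrow> real" where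
  "g_fun Y F x \<delta> = - Y x (F x \<delta>) \<delta>"

definition f_fun ::
    "(real \<Rightarrow> real \<Rightarrow> real^'m \<Rightarrow> real) \<Rightarrow> (real \<Rightarrow> real \<Rightarrow> real^'m \<Rightarrow> real) \<Rightarrow>
     (real \<Rightarrow> real^'m \<Rightarrow> real) \<Rightarrow> real \<Rightarrow> real^'m \<Rightarrow> real" where
  "f_fun X Y F x \<delta> =
     - (deriv (\<lambda>u. X u (F x \<delta>) \<delta>) x + deriv (\<lambda>u. Y x u \<delta>) (F x \<delta>))"

definition center_focus_condition ::
    "(real^'m) set \<Rightarrow> nat \<Rightarrow> (real \<Rightarrow> real \<Rightarrow> real^'m \<Rightarrow> real) \<Rightarrow>
     (real \<Rightarrow> real \<Rightarrow> real^'m \<Rightarrow> real) \<Rightarrow> (real \<Rightarrow> real^'m \<Rightarrow> real) \<Rightarrow> bool" where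
  "center_focus_condition D n X Y F \<longleftrightarrow>
     (\<exists>(a :: real^'m \<Rightarrow> real) (b :: nat \<Rightarrow> real^'m \<Rightarrow> real). \<forall>\<delta>\<in>D.
        (\<exists>R. R \<in> O[nhds 0](\<lambda>x. x) \<and>
             (\<forall>\<^sub>F x in nhds 0. g_fun Y F x \<delta> = x ^ (2 * n - 1) * (a \<delta> + R x))) \<and>
        a \<delta> > 0 \<and>
        (\<lambda>x. f_fun X Y F x \<delta>) has_fps_expansion Abs_fps (\<lambda>j. if j \<ge> n - 1 then b j \<delta> else 0) \<and>
        (b (n - 1) \<delta>)\<^sup>2 - 4 * real n * a \<delta> < 0)"

definition nilpotent_system ::
    "(real^'m) set \<Rightarrow> nat \<Rightarrow> (real \<Rightarrow> real \<Rightarrow> real^'m \<Rightarrow> real) \<Rightarrow>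
     (real \<Rightarrow> real \<Rightarrow> real^'m \<Rightarrow> real) \<Rightarrow> (real \<Rightarrow> real^'m \<Rightarrow> real) \<Rightarrow> bool" where
  "nilpotent_system D n X Y F \<longleftrightarrow>
     higher_order_term D X \<and> higher_order_term D Y \<and>
     implicit_solution D X F \<and> center_focus_condition D n X Y F"

definition solution_on ::
    "(real \<Rightarrow> real \<Rightarrow> real^'m \<Rightarrow> real) \<Rightarrow> (real \<Rightarrow> real \<Rightarrow> real^'m \<Rightarrow> real) \<Rightarrow> real^'m \<Rightarrow>
     real \<Rightarrow> (real \<Rightarrow> real) \<Rightarrow> (real \<Rightarrow> real) \<Rightarrow> bool" where
  "solution_on X Y \<delta> T x y \<longleftrightarrow>
     (\<forall>t\<in>{0..T}.
        (x has_real_derivative (y t + X (x t) (y t) \<delta>)) (at t within {0..T}) \<and>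
        (y has_real_derivative Y (x t) (y t) \<delta>) (at t within {0..T}))"

(* The graph of the partial function P(.,d): P(x0,d) is defined and equal to x1. *)
definition return_map ::
    "(real \<Rightarrow> real \<Rightarrow> real^'m \<Rightarrow> real) \<Rightarrow> (real \<Rightarrow> real \<Rightarrow> real^'m \<Rightarrow> real) \<Rightarrow>
     (real \<Rightarrow> real^'m \<Rightarrow> real) \<Rightarrow> real^'m \<Rightarrow> real \<Rightarrow> real \<Rightarrow> bool" where
  "return_map X Y F \<delta> x0 x1 \<longleftrightarrow>
     (if x0 = 0 then x1 = 0
      else \<exists>x y \<tau>. \<tau> > 0 \<and> solution_on X Y \<delta> \<tau> x y \<and> x 0 = x0 \<and> y 0 = F x0 \<delta> \<and>
             y \<tau> = F (x \<tau>) \<delta> \<and> x0 * x \<tau> > 0 \<and>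
             (\<forall>s\<in>{0<..<\<tau>}. \<not> (y s = F (x s) \<delta> \<and> x0 * x s > 0)) \<and>
             x1 = x \<tau>)"

(* Pbar is analytic at 0 and coincides with P for small x0 > 0 only (not, in general, for
   x0 < 0); its germ at 0, and hence v j d for j >= 1, is unique. *)
definition return_coefficients ::
    "(real^'m) set \<Rightarrow> (real \<Rightarrow> real \<Rightarrow> real^'m \<Rightarrow> real) \<Rightarrow> (real \<Rightarrow> real \<Rightarrow> real^'m \<Rightarrow> real) \<Rightarrow>
     (real \<Rightarrow> real^'m \<Rightarrow> real) \<Rightarrow> (nat \<Rightarrow> real^'m \<Rightarrow> real) \<Rightarrow> bool" where
  "return_coefficients D X Y F v \<longleftrightarrow>
     (\<exists>Pbar. \<forall>\<delta>\<in>D.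
        (\<forall>\<^sub>F x0 in at_right 0. return_map X Y F \<delta> x0 (Pbar x0 \<delta>)) \<and>
        (\<lambda>x0. Pbar x0 \<delta> - x0) has_fps_expansion Abs_fps (\<lambda>j. if j \<ge> 1 then v j \<delta> else 0))"

definition taylor_coeff ::
    "(real \<Rightarrow> real \<Rightarrow> real^'m \<Rightarrow> real) \<Rightarrow> nat \<Rightarrow> nat \<Rightarrow> real^'m \<Rightarrow> real" where
  "taylor_coeff X i j \<delta> =
     (deriv ^^ i) (\<lambda>x. (deriv ^^ j) (\<lambda>y. X x y \<delta>) 0) 0 / (fact i * fact j)"

definition same_taylor_terms ::
    "(real^'m) set \<Rightarrow> nat \<Rightarrow> (real \<Rightarrow> real \<Rightarrow> real^'m \<Rightarrow> real) \<Rightarrow>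
     (real \<Rightarrow> real \<Rightarrow> real^'m \<Rightarrow> real) \<Rightarrow> bool" where
  "same_taylor_terms D N X X' \<longleftrightarrow>
     (\<forall>\<delta>\<in>D. \<forall>i j. i + j \<le> N \<longrightarrow> taylor_coeff X i j \<delta> = taylor_coeff X' i j \<delta>)"

end

theory Submission
  imports Defs "HOL-Complex_Analysis.Complex_Analysis"
begin

text \<open>
The parameter \<open>\<delta>\<close> is fixed throughout, so the statement compares two analytic planar systems
whose Taylor terms agree up to degree \<open>N = (k + 2) * n - 2\<close>. It suffices to show that the first
returns to the curve \<open>y = F x\<close> of the two orbits through a point with small abscissa \<open>x0 > 0\<close>
differ by \<open>O(x0 ^ (k * n + 1))\<close>; the coefficients of a power series that is
\<open>O(x0 ^ (k * n + 1))\<close> vanish up to index \<open>k * n\<close> (\<open>fps_coefficients_vanish_of_bound\<close>).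

Straightening. With \<open>w = y - F x\<close> the system becomes \<open>x' = U x w\<close>, \<open>w' = V x w\<close>, where
\<open>U x w = w * (1 + o(1))\<close> and \<open>V x w = - g x - f x * w + O(w\<^sup>2)\<close> with the functions \<open>g\<close> and \<open>f\<close>
of the statement. The orders of \<open>g\<close> and \<open>f\<close> suggest giving \<open>x\<close> the weight \<open>1\<close> and \<open>w\<close> the
weight \<open>n\<close>: put \<open>x = r * c\<close> and \<open>w = r ^ n * s\<close>, where \<open>c ^ (2 * n) + s\<^sup>2 = 1\<close>. Then
\<open>u = U / r ^ n\<close> and \<open>v = V / r ^ (2 * n - 1)\<close> have limits as \<open>r\<close> tends to \<open>0\<close>. The
quasi-homogeneous angular velocity \<open>n * s * u - c * v\<close> tends to
\<open>n * s\<^sup>2 + b * c ^ n * s + a * c ^ (2 * n)\<close>, a quadratic form in \<open>c ^ n\<close> and \<open>s\<close> that is positive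
definite because \<open>b\<^sup>2 < 4 * n * a\<close> (\<open>rotation_exists\<close>).

A common clock. Measure time by \<open>\<psi>\<close> with \<open>\<psi>' = (n * w * x' - x * w') / r ^ (n + 1) > 0\<close>. With
respect to \<open>\<psi>\<close> the angular part satisfies \<open>dc/d\<psi> = s / n\<close>, \<open>ds/d\<psi> = - c ^ (2 * n - 1)\<close>, whatever
the system is: up to scaling and orientation, \<open>c\<close> and \<open>s\<close> are Lyapunov's generalized
trigonometric functions of \<open>\<psi>\<close>. So both systems return for the same value of \<open>\<psi>\<close>, which is at
most \<open>4 * pi * n\<close>, and differ only in the radial equation \<open>dr/d\<psi> = r * A r c s\<close>. There \<open>A\<close> is a quotient of linear expressions in \<open>u\<close>
and \<open>v\<close>. Agreement of the Taylor terms up to degree \<open>N\<close> makes \<open>U\<close> and \<open>V\<close> agree up to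
\<open>O(r ^ (N + 1))\<close>, and \<open>N + 1 = k * n + (2 * n - 1)\<close>, so \<open>u\<close> and \<open>v\<close> agree up to
\<open>O(r ^ (k * n))\<close>. Gronwall's inequality over the bounded range of \<open>\<psi>\<close> yields the claim
(\<open>first_returns_close\<close>).

Uniformity. The estimates on \<open>u\<close> and \<open>v\<close>, including the Lipschitz condition in \<open>r\<close>, must be
uniform in \<open>(c, s)\<close>. They come from complexification: for fixed \<open>(c, s)\<close> the function
\<open>z \<mapsto> V (z * c) (z ^ n * s)\<close> extends to a holomorphic bounded function on a disc, with radius and
bound independent of \<open>(c, s)\<close>; it is \<open>O(t ^ (2 * n - 1))\<close> on the positive reals, hence divisible by
\<open>z ^ (2 * n - 1)\<close>, and Cauchy's estimates bound the quotient and its derivative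
(\<open>scaled_quotient_estimates\<close>). So only limits along single curves
\<open>t \<mapsto> (t * c, t ^ n * s)\<close> have to be computed. For this
\<open>F\<close> has to be continued to a holomorphic function, which is done by iterating
\<open>G \<mapsto> - X z (G z)\<close> (\<open>complex_implicit_function\<close>).

Finally, the orbit that defines the return map must be shown to stay near the origin until it
returns. To leave, \<open>r\<close> has to grow from \<open>x0\<close> to a fixed size; since \<open>ln r\<close> is Lipschitz in \<open>\<psi>\<close>,
this takes more than the span \<open>4 * pi * n\<close> when \<open>x0\<close> is small, and by then the orbit has
returned (\<open>small_return_is_first_return\<close>).
\<close>

section \<open>Growth estimates and change of parameter\<close>

lemma nondecreasing_if_derivative_nonneg:
  fixes f f' :: "real \<Rightarrow> real"
  assumes deriv: "\<And>t. t \<in> {0..T} \<Longrightarrow> (f has_real_derivative f' t) (at t within {0..T})"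
    and nonneg: "\<And>t. t \<in> {0..T} \<Longrightarrow> f' t \<ge> 0"
    and st: "0 \<le> s" "s \<le> t" "t \<le> T"
  shows "f s \<le> f t"
proof (rule DERIV_nonneg_imp_increasing_open[OF st(2)])
  show "\<exists>y. (f has_real_derivative y) (at u) \<and> 0 \<le> y" if "s < u" "u < t" for u
  proof -
    have "at u within {0..T} = at u"
      using that st by (intro at_within_Icc_at) auto
    with deriv[of u] nonneg[of u] that st show ?thesis by auto
  qed
  show "continuous_on {s..t} f"
    by (rule continuous_on_subset[OF DERIV_continuous_on[OF deriv]]) (use st in auto)
qed

lemma increasing_if_derivative_pos:
  fixes f f' :: "real \<Rightarrow> real"
  assumes deriv: "\<And>t. t \<in> {0..T} \<Longrightarrow> (f has_real_derivative f' t) (at t within {0..T})"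
    and pos: "\<And>t. t \<in> {0..T} \<Longrightarrow> f' t > 0"
    and st: "0 \<le> s" "s < t" "t \<le> T"
  shows "f s < f t"
proof (rule DERIV_pos_imp_increasing_open[OF st(2)])
  show "\<exists>y. (f has_real_derivative y) (at u) \<and> 0 < y" if "s < u" "u < t" for u
  proof -
    have "at u within {0..T} = at u"
      using that st by (intro at_within_Icc_at) auto
    with deriv[of u] pos[of u] that st show ?thesis by auto
  qed
  show "continuous_on {s..t} f"
    by (rule continuous_on_subset[OF DERIV_continuous_on[OF deriv]]) (use st in auto)
qed

text \<open>
The case of a negative \<open>K\<close> with \<open>b = 0\<close> is included because, applied to \<open>- E\<close>, it turns into the
lower bound that keeps an orbit away from the origin.
\<close>

lemma gronwall_affine:
  fixes E E' :: "real \<Rightarrow> real"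
  assumes deriv: "\<And>t. t \<in> {0..T} \<Longrightarrow> (E has_real_derivative E' t) (at t within {0..T})"
    and growth: "\<And>t. t \<in> {0..T} \<Longrightarrow> E' t \<le> K * E t + b"
    and b: "b \<ge> 0" "K \<ge> 0 \<or> b = 0" and t: "t \<in> {0..T}"
  shows "E t \<le> (E 0 + b * t) * exp (K * t)"
proof -
  define G where "G = (\<lambda>t. b * t - E t * exp (- K * t))"
  define G' where "G' = (\<lambda>t. b - (E' t - K * E t) * exp (- K * t))"
  have G: "(G has_real_derivative G' t) (at t within {0..T})" if "t \<in> {0..T}" for t
    unfolding G_def G'_def
    by (rule derivative_eq_intros deriv[OF that] refl | simp add: algebra_simps)+
  have G': "G' t \<ge> 0" if "t \<in> {0..T}" for t
  proof -
    have "(E' t - K * E t) * exp (- K * t) \<le> b * exp (- K * t)"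
      using growth[OF that] by (intro mult_right_mono) auto
    also have "\<dots> \<le> b"
    proof (cases "b = 0")
      case False
      then have "K * t \<ge> 0" using b that by auto
      then show ?thesis using b by (intro mult_left_le) auto
    qed auto
    finally show ?thesis unfolding G'_def by simp
  qed
  have "G 0 \<le> G t"
    by (rule nondecreasing_if_derivative_nonneg[of T G G'])
       (use G G' t in auto)
  then have "E t * exp (- K * t) \<le> E 0 + b * t"
    unfolding G_def by simp
  then have "(E t * exp (- K * t)) * exp (K * t) \<le> (E 0 + b * t) * exp (K * t)"
    by (intro mult_right_mono) auto
  then show ?thesis by (simp add: mult.assoc flip: exp_add)
qed

text \<open>
Since \<open>\<bar>f\<bar>\<close> need not be differentiable, the affine inequality is applied to \<open>f\<^sup>2\<close>; the mixed term
\<open>2 * b * \<bar>f\<bar>\<close> is absorbed by \<open>f\<^sup>2 + b\<^sup>2\<close>.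
\<close>

lemma abs_gronwall:
  fixes f f' :: "real \<Rightarrow> real"
  assumes deriv: "\<And>t. t \<in> {0..T} \<Longrightarrow> (f has_real_derivative f' t) (at t within {0..T})"
    and growth: "\<And>t. t \<in> {0..T} \<Longrightarrow> \<bar>f' t\<bar> \<le> L * \<bar>f t\<bar> + b"
    and init: "f 0 = 0" and Lb: "L \<ge> 0" "b \<ge> 0" and t: "t \<in> {0..T}"
  shows "\<bar>f t\<bar> \<le> b * sqrt (t * exp ((2 * L + 1) * t))"
proof -
  have "(f t)\<^sup>2 \<le> ((f 0)\<^sup>2 + b\<^sup>2 * t) * exp ((2 * L + 1) * t)"
  proof (rule gronwall_affine[where E' = "\<lambda>t. 2 * f t * f' t" and T = T])
    fix t assume t: "t \<in> {0..T}"
    show "((\<lambda>t. (f t)\<^sup>2) has_real_derivative 2 * f t * f' t) (at t within {0..T})"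
      by (rule derivative_eq_intros deriv[OF t] refl | simp)+
    have "f t * f' t \<le> \<bar>f t\<bar> * \<bar>f' t\<bar>" by (metis abs_ge_self abs_mult)
    also have "\<dots> \<le> \<bar>f t\<bar> * (L * \<bar>f t\<bar> + b)"
      using growth[OF t] by (intro mult_left_mono) auto
    finally have "2 * f t * f' t \<le> 2 * L * \<bar>f t\<bar>\<^sup>2 + 2 * \<bar>f t\<bar> * b"
      by (simp add: algebra_simps power2_eq_square)
    also have "2 * \<bar>f t\<bar> * b \<le> \<bar>f t\<bar>\<^sup>2 + b\<^sup>2" by (rule sum_squares_bound)
    finally show "2 * f t * f' t \<le> (2 * L + 1) * (f t)\<^sup>2 + b\<^sup>2" by (simp add: algebra_simps)
  qed (use Lb t in auto)
  also have "\<dots> = (b * sqrt (t * exp ((2 * L + 1) * t)))\<^sup>2"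
    using t init by (simp add: power_mult_distrib)
  finally show ?thesis
    using Lb t by (simp add: abs_le_square_iff[symmetric] abs_mult)
qed

text \<open>
Used to pass from physical time to the angular time \<open>\<psi>\<close>. One-sided derivatives at the end points
are included, so that the Gronwall lemmas apply on closed intervals.
\<close>

lemma inverse_reparametrization:
  fixes \<psi> \<theta> :: "real \<Rightarrow> real"
  assumes T: "T > 0" and init: "\<psi> 0 = 0"
    and deriv: "\<And>t. t \<in> {0..T} \<Longrightarrow> (\<psi> has_real_derivative \<theta> t) (at t within {0..T})"
    and pos: "\<And>t. t \<in> {0..T} \<Longrightarrow> \<theta> t > 0"
  obtains h where "\<psi> T > 0" "h 0 = 0" "h (\<psi> T) = T"
    "\<And>q. q \<in> {0..\<psi> T} \<Longrightarrow> h q \<in> {0..T}"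
    "\<And>q. q \<in> {0<..<\<psi> T} \<Longrightarrow> h q \<in> {0<..<T}"
    "\<And>q. q \<in> {0..\<psi> T} \<Longrightarrow> (h has_real_derivative inverse (\<theta> (h q))) (at q within {0..\<psi> T})"
proof -
  have less: "\<psi> s < \<psi> t" if "0 \<le> s" "s < t" "t \<le> T" for s t
    by (rule increasing_if_derivative_pos[of T \<psi> \<theta>]) (use deriv pos that in auto)
  have inj: "inj_on \<psi> {0..T}"
    by (rule linorder_inj_onI) (use less in \<open>auto simp: less_imp_neq\<close>)
  have cont: "continuous_on {0..T} \<psi>"
    by (rule DERIV_continuous_on[OF deriv])
  define h where "h = the_inv_into {0..T} \<psi>"
  have h\<psi>: "h (\<psi> t) = t" if "t \<in> {0..T}" for t
    unfolding h_def by (rule the_inv_into_f_f[OF inj that])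
  have image: "\<psi> ` {0..T} = {0..\<psi> T}"
  proof
    show "\<psi> ` {0..T} \<subseteq> {0..\<psi> T}"
      using less[of 0] less[of _ T] init T
      by (force simp: le_less)
    show "{0..\<psi> T} \<subseteq> \<psi> ` {0..T}"
    proof
      fix q assume "q \<in> {0..\<psi> T}"
      then obtain t where "0 \<le> t" "t \<le> T" "\<psi> t = q"
        using IVT'[of \<psi> 0 q T] cont init T by auto
      then show "q \<in> \<psi> ` {0..T}" by auto
    qed
  qed
  have hin: "h q \<in> {0..T}" and \<psi>h: "\<psi> (h q) = q" if "q \<in> {0..\<psi> T}" for q
    using that unfolding image[symmetric] by (auto simp: h\<psi>)
  have conth: "continuous_on (\<psi> ` {0..T}) h"
    by (rule continuous_on_inv[OF cont]) (auto simp: h\<psi>)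
  have "(h has_real_derivative inverse (\<theta> (h q))) (at q within {0..\<psi> T})"
    if q: "q \<in> {0..\<psi> T}" for q
  proof -
    have "(h has_derivative (*) (inverse (\<theta> (h q)))) (at (\<psi> (h q)) within \<psi> ` {0..T})"
    proof (rule has_derivative_inverse_within[where f' = "(*) (\<theta> (h q))"])
      show "(\<psi> has_derivative (*) (\<theta> (h q))) (at (h q) within {0..T})"
        using deriv[OF hin[OF q]] by (simp add: has_field_derivative_def)
      show "continuous (at (\<psi> (h q)) within \<psi> ` {0..T}) h"
        using conth hin[OF q] by (auto simp: continuous_on_eq_continuous_within)
      show "(*) (inverse (\<theta> (h q))) \<circ> (*) (\<theta> (h q)) = id"
        using pos[OF hin[OF q]] by (auto simp: fun_eq_iff)
    qed (use hin[OF q] h\<psi> in \<open>auto intro!: bounded_linear.linear bounded_linear_mult_right\<close>)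
    then show ?thesis
      using \<psi>h[OF q] by (simp add: has_field_derivative_def image)
  qed
  moreover have "h q \<in> {0<..<T}" if "q \<in> {0<..<\<psi> T}" for q
    using hin[of q] \<psi>h[of q] that init by (auto simp: less_le)
  ultimately show ?thesis
    using that[of h] less[of 0 T] T init h\<psi>[of 0] h\<psi>[of T] hin by auto
qed

section \<open>The universal angular motion\<close>

text \<open>
For \<open>n = 1\<close> these are \<open>cos\<close> and \<open>- sin\<close>; in general \<open>C\<close> and \<open>S\<close> are, up to scaling and
orientation, Lyapunov's generalized trigonometric functions \<open>Cs\<close> and \<open>Sn\<close>. The curve is a predicate on
functions over an interval, so that orbits of the systems below can supply it and no existence
theorem for differential equations is needed.
\<close>

definition lyapunov_curve :: "nat \<Rightarrow> real \<Rightarrow> (real \<Rightarrow> real) \<Rightarrow> (real \<Rightarrow> real) \<Rightarrow> bool" where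
  "lyapunov_curve n T C S \<longleftrightarrow> C 0 = 1 \<and> S 0 = 0 \<and>
     (\<forall>q\<in>{0..T}. (C has_real_derivative S q / n) (at q within {0..T}) \<and>
                  (S has_real_derivative - (C q ^ (2 * n - 1))) (at q within {0..T}))"

lemma lyapunov_curve_invariant:
  assumes "lyapunov_curve n T C S" and n: "n \<ge> 1" and q: "q \<in> {0..T}"
  shows "C q ^ (2 * n) + (S q)\<^sup>2 = 1"
proof -
  define E where "E = (\<lambda>q. C q ^ (2 * n) + (S q)\<^sup>2)"
  have init: "C 0 = 1" "S 0 = 0"
    and C: "q \<in> {0..T} \<Longrightarrow> (C has_real_derivative S q / n) (at q within {0..T})"
    and S: "q \<in> {0..T} \<Longrightarrow> (S has_real_derivative - (C q ^ (2 * n - 1))) (at q within {0..T})" for q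
    using assms(1) by (auto simp: lyapunov_curve_def)
  have E: "(E has_real_derivative 0) (at q within {0..T})" if "q \<in> {0..T}" for q
    unfolding E_def
    by (rule derivative_eq_intros C[OF that] S[OF that] refl | use n in \<open>simp add: field_simps\<close>)+
  have "E 0 \<le> E q"
    by (rule nondecreasing_if_derivative_nonneg[of T E "\<lambda>_. 0"]) (use E q in auto)
  moreover have "- E 0 \<le> - E q"
    by (rule nondecreasing_if_derivative_nonneg[of T "\<lambda>q. - E q" "\<lambda>_. 0"])
       (use DERIV_minus[OF E] q in auto)
  ultimately show ?thesis using n by (simp add: E_def init)
qed

lemma unit_curve_bounds:
  fixes c s :: real
  assumes "c ^ (2 * n) + s\<^sup>2 = 1" and n: "n \<ge> 1"
  shows "\<bar>c\<bar> \<le> 1" "\<bar>s\<bar> \<le> 1"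
proof -
  have "\<bar>c\<bar> ^ (2 * n) \<le> 1"
    using assms(1) by (simp add: power_mult)
       (metis add.commute add_increasing2 dual_order.refl zero_le_power2 power_mult)
  then show "\<bar>c\<bar> \<le> 1"
    using n one_less_power[of "\<bar>c\<bar>" "2 * n"] by (fastforce simp: not_le[symmetric])
  have "s\<^sup>2 \<le> 1" using assms(1) zero_le_power2[of "c ^ n"] by (simp add: power_mult[symmetric] mult.commute)
  then show "\<bar>s\<bar> \<le> 1" by (simp add: abs_square_le_1)
qed

lemma abs_power_diff_le:
  fixes a b :: real
  assumes "\<bar>a\<bar> \<le> 1" "\<bar>b\<bar> \<le> 1"
  shows "\<bar>a ^ m - b ^ m\<bar> \<le> m * \<bar>a - b\<bar>"
  using norm_power_diff[of a b m] assms by simp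

text \<open>
The squared distance of two solutions satisfies a linear differential inequality, because
\<open>c ^ (2 * n - 1)\<close> is Lipschitz for \<open>\<bar>c\<bar> \<le> 1\<close>.
\<close>

lemma lyapunov_curve_unique:
  assumes 1: "lyapunov_curve n T C S" and 2: "lyapunov_curve n T C' S'"
    and n: "n \<ge> 1" and q: "q \<in> {0..T}"
  shows "C q = C' q" "S q = S' q"
proof -
  define E where "E = (\<lambda>q. (C q - C' q)\<^sup>2 + (S q - S' q)\<^sup>2)"
  define E' where "E' = (\<lambda>q. 2 * (C q - C' q) * (S q / n - S' q / n)
                        + 2 * (S q - S' q) * (C' q ^ (2 * n - 1) - C q ^ (2 * n - 1)))"
  have "E q \<le> (E 0 + 0 * q) * exp (2 * n * q)"
  proof (rule gronwall_affine[where E' = E' and T = T])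
    fix q assume q: "q \<in> {0..T}"
    show "(E has_real_derivative E' q) (at q within {0..T})"
      using 1 2 q unfolding lyapunov_curve_def E_def E'_def
      by (auto intro!: derivative_eq_intros simp: algebra_simps add_divide_distrib diff_divide_distrib)
    have b: "\<bar>C q\<bar> \<le> 1" "\<bar>C' q\<bar> \<le> 1"
      using lyapunov_curve_invariant[OF 1 n q] lyapunov_curve_invariant[OF 2 n q]
        unit_curve_bounds n by blast+
    define x y where "x = C q - C' q" and "y = S q - S' q"
    have "2 * x * (S q / n - S' q / n) \<le> 2 * \<bar>x\<bar> * \<bar>y\<bar>"
    proof -
      have "x * (S q / n - S' q / n) \<le> \<bar>x * (y / n)\<bar>"
        by (metis abs_ge_self diff_divide_distrib y_def)
      also have "\<dots> = \<bar>x\<bar> * (\<bar>y\<bar> / n)" by (simp add: abs_mult)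
      also have "\<dots> \<le> \<bar>x\<bar> * \<bar>y\<bar>"
        using n by (intro mult_left_mono) (auto simp: divide_le_eq mult_le_cancel_left1)
      finally show ?thesis by simp
    qed
    moreover have "2 * y * (C' q ^ (2 * n - 1) - C q ^ (2 * n - 1)) \<le> 2 * (\<bar>y\<bar> * ((2 * n - 1) * \<bar>x\<bar>))"
    proof -
      have "y * (C' q ^ (2 * n - 1) - C q ^ (2 * n - 1))
            \<le> \<bar>y\<bar> * \<bar>C' q ^ (2 * n - 1) - C q ^ (2 * n - 1)\<bar>"
        by (metis abs_ge_self abs_mult)
      also have "\<dots> \<le> \<bar>y\<bar> * ((2 * n - 1) * \<bar>x\<bar>)"
        using abs_power_diff_le[OF b(2,1), of "2 * n - 1"] n
        by (intro mult_left_mono) (auto simp: x_def abs_minus_commute of_nat_diff)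
      finally show ?thesis by simp
    qed
    ultimately have "E' q \<le> 2 * \<bar>x\<bar> * \<bar>y\<bar> + 2 * (\<bar>y\<bar> * ((2 * n - 1) * \<bar>x\<bar>))"
      unfolding E'_def x_def y_def by linarith
    also have "\<dots> = 2 * n * (2 * \<bar>x\<bar> * \<bar>y\<bar>)"
      using n by (simp add: algebra_simps of_nat_diff)
    also have "\<dots> \<le> 2 * n * (x\<^sup>2 + y\<^sup>2)"
      using sum_squares_bound[of "\<bar>x\<bar>" "\<bar>y\<bar>"] by (intro mult_left_mono) auto
    finally show "E' q \<le> 2 * n * E q + 0" by (simp add: E_def x_def y_def)
  qed (use q in auto)
  moreover have "E 0 = 0" using 1 2 by (simp add: E_def lyapunov_curve_def)
  ultimately have "E q \<le> 0" by simp
  then show "C q = C' q" "S q = S' q"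
    unfolding E_def by (smt (verit) zero_le_power2 power2_eq_iff_nonneg zero_eq_power2)+
qed

text \<open>
The polar angle of \<open>(C, S)\<close> decreases at rate \<open>(C ^ (2 * n) + S\<^sup>2 / n) / (C\<^sup>2 + S\<^sup>2)\<close>. The numerator is
at least \<open>1 / n\<close> and the denominator at most \<open>2\<close>, so a full turn takes at most \<open>4 * pi * n\<close>.
The angle \<open>\<theta>\<close> is defined as the integral of this rate; to see that it is the polar angle one
rotates the curve back by \<open>\<theta>\<close> and checks that the second coordinate \<open>p\<close> solves a homogeneous
linear equation with zero initial value.
\<close>

lemma lyapunov_curve_returns:
  assumes curve: "lyapunov_curve n T C S" and n: "n \<ge> 1" and T: "T \<ge> 4 * pi * n"
  shows "\<exists>q. 0 < q \<and> q \<le> 4 * pi * n \<and> S q = 0 \<and> C q > 0"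
proof -
  have init: "C 0 = 1" "S 0 = 0"
    and C: "q \<in> {0..T} \<Longrightarrow> (C has_real_derivative S q / n) (at q within {0..T})"
    and S: "q \<in> {0..T} \<Longrightarrow> (S has_real_derivative - (C q ^ (2 * n - 1))) (at q within {0..T})" for q
    using curve by (auto simp: lyapunov_curve_def)
  have contC: "continuous_on {0..T} C" and contS: "continuous_on {0..T} S"
    by (rule DERIV_continuous_on, erule C, rule DERIV_continuous_on, erule S)
  define m where "m = (\<lambda>q. (C q)\<^sup>2 + (S q)\<^sup>2)"
  define \<omega> where "\<omega> = (\<lambda>q. (C q ^ (2 * n) + (S q)\<^sup>2 / n) / m q)"
  define \<alpha> where "\<alpha> = (\<lambda>q. (C q * S q / n - S q * C q ^ (2 * n - 1)) / m q)"
  define \<theta> where "\<theta> = (\<lambda>q. integral {0..q} \<omega>)"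
  have b: "\<bar>C q\<bar> \<le> 1" "\<bar>S q\<bar> \<le> 1" and inv: "C q ^ (2 * n) + (S q)\<^sup>2 = 1" if "q \<in> {0..T}" for q
    using lyapunov_curve_invariant[OF curve n that] unit_curve_bounds n by blast+
  have m: "m q > 0" "m q \<le> 2" if "q \<in> {0..T}" for q
  proof -
    show "m q > 0"
      using inv[OF that] n unfolding m_def
      by (smt (verit) power_eq_0_iff zero_power zero_le_power2 zero_less_numeral mult_pos_pos less_le_trans
          zero_less_one nat_0_less_mult_iff power_zero_numeral)
    have "(C q)\<^sup>2 \<le> 1" "(S q)\<^sup>2 \<le> 1" using b[OF that] by (auto simp: abs_square_le_1)
    then show "m q \<le> 2" by (simp add: m_def)
  qed
  have contm: "continuous_on {0..T} m" unfolding m_def by (intro continuous_intros contC contS)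
  have cont\<omega>: "continuous_on {0..T} \<omega>" unfolding \<omega>_def
    by (intro continuous_intros contC contS contm) (use n m in force)+
  have \<omega>: "\<omega> q \<ge> 1 / (2 * n)" if "q \<in> {0..T}" for q
  proof -
    have "C q ^ (2 * n) / n \<le> C q ^ (2 * n)"
      using n by (simp add: divide_le_eq mult_le_cancel_left1 power_mult)
    then have "1 / n \<le> C q ^ (2 * n) + (S q)\<^sup>2 / n"
      using inv[OF that] by (metis add_divide_distrib add_le_cancel_right)
    then have "1 / n / 2 \<le> (C q ^ (2 * n) + (S q)\<^sup>2 / n) / m q"
      using m[OF that] n by (intro frac_le) (auto intro: order_trans[rotated])
    then show ?thesis by (simp add: \<omega>_def mult.commute)
  qed
  have \<theta>: "(\<theta> has_real_derivative \<omega> q) (at q within {0..T})" if "q \<in> {0..T}" for q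
    unfolding \<theta>_def by (rule integral_has_real_derivative[OF cont\<omega> that])
  have \<theta>0: "\<theta> 0 = 0" by (simp add: \<theta>_def)
  \<comment> \<open>Coordinates of the curve in the frame rotating clockwise with angle \<open>\<theta>\<close>.\<close>
  define p where "p = (\<lambda>q. C q * sin (\<theta> q) + S q * cos (\<theta> q))"
  define k where "k = (\<lambda>q. C q * cos (\<theta> q) - S q * sin (\<theta> q))"
  have alg: "S q / n = \<alpha> q * C q + \<omega> q * S q"
            "- (C q ^ (2 * n - 1)) = \<alpha> q * S q - \<omega> q * C q" if "q \<in> {0..T}" for q
  proof -
    have pow: "C q ^ (2 * n) = C q * C q ^ (2 * n - 1)"
      using n by (metis mult_is_0 not_one_le_zero power_eq_if zero_neq_numeral)
    have "m q \<noteq> 0" using m[OF that] by auto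
    then have \<alpha>: "\<alpha> q * m q = C q * S q / n - S q * C q ^ (2 * n - 1)"
      and \<omega>': "\<omega> q * m q = C q * C q ^ (2 * n - 1) + (S q)\<^sup>2 / n"
      by (auto simp: \<alpha>_def \<omega>_def pow)
    have "(\<alpha> q * C q + \<omega> q * S q) * m q = (\<alpha> q * m q) * C q + (\<omega> q * m q) * S q"
      by (simp add: algebra_simps)
    also have "\<dots> = S q / n * m q"
      unfolding \<alpha> \<omega>' by (simp add: m_def algebra_simps power2_eq_square)
    finally show "S q / n = \<alpha> q * C q + \<omega> q * S q" using \<open>m q \<noteq> 0\<close> by (metis mult_right_cancel)
    have "(\<alpha> q * S q - \<omega> q * C q) * m q = (\<alpha> q * m q) * S q - (\<omega> q * m q) * C q"
      by (simp add: algebra_simps)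
    also have "\<dots> = - (C q ^ (2 * n - 1)) * m q"
      unfolding \<alpha> \<omega>' by (simp add: m_def algebra_simps power2_eq_square)
    finally show "- (C q ^ (2 * n - 1)) = \<alpha> q * S q - \<omega> q * C q" using \<open>m q \<noteq> 0\<close> by (metis mult_right_cancel)
  qed
  have p: "(p has_real_derivative \<alpha> q * p q) (at q within {0..T})" if "q \<in> {0..T}" for q
    unfolding p_def
    apply (rule derivative_eq_intros C[OF that] S[OF that] \<theta>[OF that] refl)+
    unfolding alg[OF that] by (simp add: algebra_simps)
  have cont\<alpha>: "continuous_on {0..T} \<alpha>" unfolding \<alpha>_def
    by (intro continuous_intros contC contS contm) (use n m in force)+
  obtain A where A: "\<And>q. q \<in> {0..T} \<Longrightarrow> \<bar>\<alpha> q\<bar> \<le> A" "A \<ge> 0"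
  proof -
    have "compact (\<alpha> ` {0..T})" by (rule compact_continuous_image[OF cont\<alpha>]) auto
    then obtain A where "\<forall>y\<in>\<alpha> ` {0..T}. \<bar>y\<bar> \<le> A"
      by (auto dest!: compact_imp_bounded simp: bounded_iff)
    then show ?thesis by (intro that[of "max A 0"]) (auto simp: max.coboundedI1)
  qed
  have p0: "p q = 0" if "q \<in> {0..T}" for q
  proof -
    have "\<bar>p q\<bar> \<le> 0 * sqrt (q * exp ((2 * A + 1) * q))"
    proof (rule abs_gronwall[OF p])
      show "\<bar>\<alpha> t * p t\<bar> \<le> A * \<bar>p t\<bar> + 0" if "t \<in> {0..T}" for t
        using A(1)[OF that] by (auto simp: abs_mult intro: mult_right_mono)
    qed (use A that init \<theta>0 in \<open>auto simp: p_def\<close>)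
    then show ?thesis by simp
  qed
  have k2: "(k q)\<^sup>2 = m q" if "q \<in> {0..T}" for q
  proof -
    have "(k q)\<^sup>2 + (p q)\<^sup>2 = m q * ((sin (\<theta> q))\<^sup>2 + (cos (\<theta> q))\<^sup>2)"
      unfolding k_def p_def m_def by algebra
    then show ?thesis using p0[OF that] by simp
  qed
  have cont\<theta>: "continuous_on {0..T} \<theta>" by (rule DERIV_continuous_on[OF \<theta>])
  have contk: "continuous_on {0..T} k" unfolding k_def
    by (intro continuous_intros contC contS cont\<theta>)
  have kpos: "k q > 0" if q: "q \<in> {0..T}" for q
  proof (rule ccontr)
    assume "\<not> k q > 0"
    moreover have "k 0 = 1" by (simp add: k_def init \<theta>0)
    moreover have "continuous_on {0..q} k" by (rule continuous_on_subset[OF contk]) (use q in auto)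
    ultimately obtain r where "r \<in> {0..q}" "k r = 0"
      using IVT2'[of k q 0 0] q by auto
    then show False using k2[of r] m(1)[of r] q by auto
  qed
  have growth: "\<theta> (4 * pi * n) \<ge> 2 * pi"
  proof -
    have "\<theta> 0 - 0 / (2 * n) \<le> \<theta> (4 * pi * n) - (4 * pi * n) / (2 * n)"
    proof (rule nondecreasing_if_derivative_nonneg[of T "\<lambda>q. \<theta> q - q / (2 * n)" "\<lambda>q. \<omega> q - 1 / (2 * n)"])
      fix q assume q: "q \<in> {0..T}"
      show "((\<lambda>q. \<theta> q - q / (2 * n)) has_real_derivative \<omega> q - 1 / (2 * n)) (at q within {0..T})"
        using \<theta>[OF q] n by (auto intro!: derivative_eq_intros simp: field_simps)
    qed (use \<omega> T in auto)
    then show ?thesis using n \<theta>0 by simp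
  qed
  have "continuous_on {0..4 * pi * n} \<theta>" by (rule continuous_on_subset[OF cont\<theta>]) (use T in auto)
  then obtain q where q: "0 \<le> q" "q \<le> 4 * pi * n" "\<theta> q = 2 * pi"
    using IVT'[of \<theta> 0 "2 * pi" "4 * pi * n"] growth \<theta>0 by auto
  have "q \<in> {0..T}" using q T by auto
  then have "S q = 0" "C q > 0" using p0[of q] kpos[of q] by (auto simp: p_def k_def q(3))
  moreover have "q \<noteq> 0" using q(3) \<theta>0 by auto
  ultimately show ?thesis using q by (intro exI[of _ q]) auto
qed

section \<open>Quasi-homogeneous polar coordinates\<close>

text \<open>
Homogeneous of degree one when \<open>x\<close> has weight \<open>1\<close> and \<open>w\<close> has weight \<open>n\<close>.
\<close>

definition qnorm :: "nat \<Rightarrow> real \<Rightarrow> real \<Rightarrow> real" where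
  "qnorm n x w = root (2 * n) (x ^ (2 * n) + w\<^sup>2)"

lemma qnorm_polar:
  assumes n: "n \<ge> 1" and pos: "x ^ (2 * n) + w\<^sup>2 > 0"
  defines "r \<equiv> qnorm n x w"
  shows "r > 0" "r ^ (2 * n) = x ^ (2 * n) + w\<^sup>2" "x = r * (x / r)" "w = r ^ n * (w / r ^ n)"
    "(x / r) ^ (2 * n) + (w / r ^ n)\<^sup>2 = 1"
proof -
  show r: "r > 0" using pos n by (simp add: r_def qnorm_def)
  show pow: "r ^ (2 * n) = x ^ (2 * n) + w\<^sup>2" using pos n by (simp add: r_def qnorm_def)
  show "x = r * (x / r)" "w = r ^ n * (w / r ^ n)" using r by auto
  have "(x / r) ^ (2 * n) + (w / r ^ n)\<^sup>2 = (x ^ (2 * n) + w\<^sup>2) / r ^ (2 * n)"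
    by (simp add: power_divide add_divide_distrib power_mult[symmetric] mult.commute)
  then show "(x / r) ^ (2 * n) + (w / r ^ n)\<^sup>2 = 1"
    using r pos by (simp add: pow)
qed

lemma qnorm_axis: "n \<ge> 1 \<Longrightarrow> x > 0 \<Longrightarrow> qnorm n x 0 = x"
  by (simp add: qnorm_def real_root_power_cancel)

text \<open>
A planar field \<open>x' = U x w\<close>, \<open>w' = V x w\<close> whose rescaled components \<open>U / r ^ n\<close> and
\<open>V / r ^ (2 * n - 1)\<close> in quasi-homogeneous polar coordinates are bounded and Lipschitz in \<open>r\<close>,
uniformly in the direction \<open>(c, s)\<close>. The assumption named rotation bounds the angular velocity,
divided by \<open>r ^ (n - 1)\<close>, below by \<open>\<kappa>\<close>.
\<close>

locale quasihomogeneous_rotation =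
  fixes n :: nat and U V :: "real \<Rightarrow> real \<Rightarrow> real" and R \<kappa> L :: real
  assumes n: "n \<ge> 1" and R: "0 < R" "R \<le> 1" and \<kappa>: "\<kappa> > 0" and L: "L \<ge> 0"
    and continuous: "continuous_on {(x, w). x ^ (2 * n) + w\<^sup>2 < R ^ (2 * n)} (\<lambda>(x, w). U x w)"
      "continuous_on {(x, w). x ^ (2 * n) + w\<^sup>2 < R ^ (2 * n)} (\<lambda>(x, w). V x w)"
    and bound_U: "\<And>(r::real) (c::real) (s::real). 0 < r \<Longrightarrow> r < R \<Longrightarrow> c ^ (2 * n) + s\<^sup>2 = 1 \<Longrightarrow>
        \<bar>U (r * c) (r ^ n * s) / r ^ n\<bar> \<le> L"
    and bound_V: "\<And>(r::real) (c::real) (s::real). 0 < r \<Longrightarrow> r < R \<Longrightarrow> c ^ (2 * n) + s\<^sup>2 = 1 \<Longrightarrow>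
        \<bar>V (r * c) (r ^ n * s) / r ^ (2 * n - 1)\<bar> \<le> L"
    and rotation: "\<And>(r::real) (c::real) (s::real). 0 < r \<Longrightarrow> r < R \<Longrightarrow> c ^ (2 * n) + s\<^sup>2 = 1 \<Longrightarrow>
        real n * s * (U (r * c) (r ^ n * s) / r ^ n) - c * (V (r * c) (r ^ n * s) / r ^ (2 * n - 1)) \<ge> \<kappa>"
    and lipschitz_U: "\<And>(r::real) (r'::real) (c::real) (s::real). 0 < r \<Longrightarrow> r < R \<Longrightarrow> 0 < r' \<Longrightarrow> r' < R \<Longrightarrow> c ^ (2 * n) + s\<^sup>2 = 1 \<Longrightarrow>
        \<bar>U (r * c) (r ^ n * s) / r ^ n - U (r' * c) (r' ^ n * s) / r' ^ n\<bar> \<le> L * \<bar>r - r'\<bar>"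
    and lipschitz_V: "\<And>(r::real) (r'::real) (c::real) (s::real). 0 < r \<Longrightarrow> r < R \<Longrightarrow> 0 < r' \<Longrightarrow> r' < R \<Longrightarrow> c ^ (2 * n) + s\<^sup>2 = 1 \<Longrightarrow>
        \<bar>V (r * c) (r ^ n * s) / r ^ (2 * n - 1) - V (r' * c) (r' ^ n * s) / r' ^ (2 * n - 1)\<bar>
          \<le> L * \<bar>r - r'\<bar>"
begin

definition u :: "real \<Rightarrow> real \<Rightarrow> real \<Rightarrow> real" where
  "u r c s = U (r * c) (r ^ n * s) / r ^ n"

definition v :: "real \<Rightarrow> real \<Rightarrow> real \<Rightarrow> real" where
  "v r c s = V (r * c) (r ^ n * s) / r ^ (2 * n - 1)"

definition rate :: "real \<Rightarrow> real \<Rightarrow> real \<Rightarrow> real" where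
  "rate r c s = (real n * c ^ (2 * n - 1) * u r c s + s * v r c s) / (real n * (real n * s * u r c s - c * v r c s))"

lemma power_splits:
  fixes z :: real
  shows "z ^ n = z * z ^ (n - 1)" "z ^ (2 * n - 1) = z * (z ^ (n - 1))\<^sup>2"
    "z ^ (2 * n) = z * z ^ (2 * n - 1)"
proof -
  obtain m where m: "n = Suc m" using n by (cases n) auto
  show "z ^ n = z * z ^ (n - 1)" "z ^ (2 * n - 1) = z * (z ^ (n - 1))\<^sup>2"
    "z ^ (2 * n) = z * z ^ (2 * n - 1)"
    unfolding m by (simp_all add: power_mult[symmetric] mult.commute)
qed

lemma in_range:
  assumes "0 < x ^ (2 * n) + w\<^sup>2" "x ^ (2 * n) + w\<^sup>2 < R ^ (2 * n)"
  shows "qnorm n x w < R"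
  using qnorm_polar(1,2)[OF n assms(1)] assms(2) R
  by (metis less_eq_real_def power_less_imp_less_base)

context
  fixes T :: real and x w :: "real \<Rightarrow> real"
  assumes T: "T > 0"
    and dx: "\<And>t. t \<in> {0..T} \<Longrightarrow> (x has_real_derivative U (x t) (w t)) (at t within {0..T})"
    and dw: "\<And>t. t \<in> {0..T} \<Longrightarrow> (w has_real_derivative V (x t) (w t)) (at t within {0..T})"
    and small: "\<And>t. t \<in> {0..T} \<Longrightarrow> x t ^ (2 * n) + (w t)\<^sup>2 < R ^ (2 * n)"
    and init: "x 0 > 0" "w 0 = 0"
begin

text \<open>
The expression \<open>x ^ (2 * n) + w\<^sup>2\<close> has logarithmic derivative bounded by \<open>(2 * n + 2) * L\<close>, so an
orbit cannot reach the origin in finite time.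
\<close>

lemma never_zero:
  assumes t: "t \<in> {0..T}"
  shows "x t ^ (2 * n) + (w t)\<^sup>2 > 0"
proof -
  define E where "E = (\<lambda>t. x t ^ (2 * n) + (w t)\<^sup>2)"
  define E' where "E' = (\<lambda>t. 2 * n * (x t ^ (2 * n - 1) * U (x t) (w t)) + 2 * (w t * V (x t) (w t)))"
  have "- E t \<le> (- E 0 + 0 * t) * exp (- ((2 * n + 2) * L) * t)"
  proof (rule gronwall_affine[where T = T and E' = "\<lambda>t. - E' t"])
    fix t assume t: "t \<in> {0..T}"
    show "((\<lambda>t. - E t) has_real_derivative - E' t) (at t within {0..T})"
      unfolding E_def E'_def using dx[OF t] dw[OF t]
      by (auto intro!: derivative_eq_intros simp: algebra_simps)
    show "- E' t \<le> - ((2 * n + 2) * L) * (- E t) + 0"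
    proof (cases "E t = 0")
      case True
      have "x t ^ (2 * n) \<ge> 0" "(w t)\<^sup>2 \<ge> 0" by simp_all
      then have "x t ^ (2 * n) = 0" "(w t)\<^sup>2 = 0"
        using True unfolding E_def by linarith+
      then have "x t = 0" "w t = 0" using n by auto
      then show ?thesis using n True by (simp add: E'_def E_def power_0_left)
    next
      case False
      then have pos: "x t ^ (2 * n) + (w t)\<^sup>2 > 0"
        unfolding E_def by (smt (verit) zero_le_even_power' zero_le_power2 dvd_triv_left)
      define r c s where "r = qnorm n (x t) (w t)" and "c = x t / r" and "s = w t / r ^ n"
      note polar = qnorm_polar[OF n pos, folded r_def, folded c_def s_def]
      have rR: "r < R" unfolding r_def by (rule in_range[OF pos small[OF t]])
      have r1: "r \<le> 1" using rR R by simp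
      note cs = unit_curve_bounds[OF polar(5) n]
      have U: "\<bar>U (x t) (w t)\<bar> \<le> L * r ^ n"
        using bound_U[OF polar(1) rR polar(5)] polar(1,3,4) by (simp add: abs_mult divide_le_eq)
      have V: "\<bar>V (x t) (w t)\<bar> \<le> L * r ^ (2 * n - 1)"
        using bound_V[OF polar(1) rR polar(5)] polar(1,3,4) by (simp add: abs_mult divide_le_eq)
      have xr: "\<bar>x t\<bar> \<le> r" using polar(1) cs(1) by (simp add: c_def abs_divide divide_le_eq)
      have wr: "\<bar>w t\<bar> \<le> r ^ n" using polar(1) cs(2) by (simp add: s_def abs_divide divide_le_eq)
      have cube: "r ^ (2 * n - 1) * r ^ n \<le> r ^ (2 * n)"
        unfolding power_add[symmetric] using polar(1) r1 n by (intro power_decreasing) auto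
      have "\<bar>x t ^ (2 * n - 1) * U (x t) (w t)\<bar> \<le> r ^ (2 * n - 1) * (L * r ^ n)"
        unfolding abs_mult power_abs
        by (rule mult_mono[OF power_mono[OF xr] U]) (use polar(1) in auto)
      also have "\<dots> = L * (r ^ (2 * n - 1) * r ^ n)" by simp
      also have "\<dots> \<le> L * r ^ (2 * n)" by (rule mult_left_mono[OF cube L])
      finally have 1: "\<bar>x t ^ (2 * n - 1) * U (x t) (w t)\<bar> \<le> L * E t"
        by (simp add: polar(2) E_def)
      have "\<bar>w t * V (x t) (w t)\<bar> \<le> r ^ n * (L * r ^ (2 * n - 1))"
        unfolding abs_mult by (rule mult_mono[OF wr V]) (use polar(1) in auto)
      also have "\<dots> = L * (r ^ (2 * n - 1) * r ^ n)" by simp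
      also have "\<dots> \<le> L * r ^ (2 * n)" by (rule mult_left_mono[OF cube L])
      finally have 2: "\<bar>w t * V (x t) (w t)\<bar> \<le> L * E t"
        by (simp add: polar(2) E_def)
      have "- E' t \<le> 2 * n * (L * E t) + 2 * (L * E t)"
        unfolding E'_def using mult_left_mono[OF 1, of "2 * real n"] 2 
        by (smt (verit) abs_le_iff abs_minus_cancel abs_mult abs_of_nat mult_nonneg_nonneg of_nat_0_le_iff
            mult_minus_right mult_left_mono 1)
      then show ?thesis by (simp add: algebra_simps)
    qed
  qed (use t in auto)
  then have "E t \<ge> E 0 * exp (- ((2 * n + 2) * L) * t)" by simp
  moreover have "E 0 > 0" using init n by (simp add: E_def)
  ultimately show ?thesis unfolding E_def by (smt (verit) mult_pos_pos exp_gt_zero)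
qed

definition "rho t = qnorm n (x t) (w t)"

lemma rho_polar:
  assumes t: "t \<in> {0..T}"
  defines "r \<equiv> rho t"
  shows "r > 0" "r < R" "r ^ (2 * n) = x t ^ (2 * n) + (w t)\<^sup>2" "x t = r * (x t / r)"
    "w t = r ^ n * (w t / r ^ n)" "(x t / r) ^ (2 * n) + (w t / r ^ n)\<^sup>2 = 1"
  using qnorm_polar[OF n never_zero[OF t]] in_range[OF never_zero[OF t] small[OF t]]
  unfolding r_def rho_def by auto

definition "clock t = (n * w t * U (x t) (w t) - x t * V (x t) (w t)) / rho t ^ (n + 1)"

text \<open>
The last two equations are the reason for the choice of the clock: divided by it, they no longer
contain the field. In the proof \<open>a = r ^ (n - 1)\<close> and \<open>k = c ^ (2 * n - 1)\<close> turn all symbolic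
exponents into monomials, and \<open>c * k + s\<^sup>2 = 1\<close> is the only relation needed.
\<close>

lemma polar_derivatives:
  assumes t: "t \<in> {0..T}"
  defines "r \<equiv> rho t" and "c \<equiv> x t / rho t" and "s \<equiv> w t / rho t ^ n"
  shows "clock t > 0"
    and "(rho has_real_derivative r * rate r c s * clock t) (at t within {0..T})"
    and "((\<lambda>t. x t / rho t) has_real_derivative s / n * clock t) (at t within {0..T})"
    and "((\<lambda>t. w t / rho t ^ n) has_real_derivative - (c ^ (2 * n - 1)) * clock t) (at t within {0..T})"
proof -
  note polar = rho_polar[OF t, folded r_def, folded c_def[folded r_def] s_def[folded r_def]]
  have c: "c = x t / r" and s: "s = w t / r ^ n" by (simp_all add: c_def s_def r_def)
  define a k where "a = r ^ (n - 1)" and "k = c ^ (2 * n - 1)"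
  have a: "a > 0" using polar(1) by (simp add: a_def)
  have rn: "r ^ n = r * a" "r ^ (2 * n - 1) = r * a\<^sup>2" "r ^ (2 * n) = r\<^sup>2 * a\<^sup>2" "r ^ (n + 1) = r\<^sup>2 * a"
    using power_splits[of r] by (auto simp: a_def power2_eq_square)
  have ck: "c * k + s\<^sup>2 = 1"
    using polar(6) power_splits(3)[of c] by (simp add: k_def c s)
  define U0 V0 where "U0 = U (x t) (w t)" and "V0 = V (x t) (w t)"
  have U: "U0 = r * a * u r c s"
    using polar(1,4,5) a unfolding u_def U0_def c s by (simp add: rn)
  have V: "V0 = r * a\<^sup>2 * v r c s"
  proof -
    have "v r c s = V0 / (r * a\<^sup>2)"
      unfolding v_def V0_def rn(2) using polar(1,4,5) by (simp add: c s)
    then show ?thesis using polar(1) a by simp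
  qed
  define Q where "Q = n * s * u r c s - c * v r c s"
  have Q: "Q > 0"
    using rotation[OF polar(1,2,6)] \<kappa> unfolding Q_def u_def v_def c s by linarith
  have xw: "x t = r * c" "w t = r * a * s"
    using polar(1,4,5) by (simp_all add: c s rn)
  have "clock t = (n * w t * U0 - x t * V0) / (r\<^sup>2 * a)"
    by (simp only: clock_def U0_def V0_def r_def[symmetric] rn)
  also have "n * w t * U0 - x t * V0 = (r\<^sup>2 * a) * (a * Q)"
    unfolding U V xw Q_def by (simp add: power2_eq_square algebra_simps)
  finally have clock: "clock t = a * Q" using polar(1) a by simp
  then show clock_pos: "clock t > 0" using a Q by simp
  define \<rho>' where "\<rho>' = a * r * (n * k * u r c s + s * v r c s) / n"
  have rate: "r * rate r c s * clock t = \<rho>'"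
    using Q unfolding clock rate_def k_def[symmetric] Q_def[symmetric] \<rho>'_def by simp
  have "((\<lambda>t. root (2 * n) (x t ^ (2 * n) + (w t)\<^sup>2)) has_real_derivative
        inverse (real (2 * n) * root (2 * n) (x t ^ (2 * n) + (w t)\<^sup>2) ^ (2 * n - Suc 0))
         * (2 * n * (x t ^ (2 * n - 1) * U0) + 2 * (w t * V0))) (at t within {0..T})"
  proof (rule DERIV_chain'[OF _ DERIV_real_root])
    show "((\<lambda>t. x t ^ (2 * n) + (w t)\<^sup>2) has_real_derivative
        2 * n * (x t ^ (2 * n - 1) * U0) + 2 * (w t * V0)) (at t within {0..T})"
      using dx[OF t] dw[OF t] unfolding U0_def V0_def
      by (auto intro!: derivative_eq_intros)
  qed (use n never_zero[OF t] in auto)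
  then have "(rho has_real_derivative
        inverse (real (2 * n) * r ^ (2 * n - 1))
         * (2 * n * (x t ^ (2 * n - 1) * U0) + 2 * (w t * V0))) (at t within {0..T})"
    by (simp add: rho_def[abs_def] r_def qnorm_def)
  also have "inverse (real (2 * n) * r ^ (2 * n - 1))
         * (2 * n * (x t ^ (2 * n - 1) * U0) + 2 * (w t * V0)) = \<rho>'"
  proof -
    have "x t ^ (2 * n - 1) = r * a\<^sup>2 * k"
      unfolding xw power_mult_distrib rn k_def ..
    then have "2 * n * (x t ^ (2 * n - 1) * U0) + 2 * (w t * V0)
        = (real (2 * n) * (r * a\<^sup>2)) * \<rho>'"
      unfolding U V \<rho>'_def xw using n by (simp add: field_simps power2_eq_square)
    then show ?thesis
      using polar(1) a n unfolding rn by (simp add: field_simps)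
  qed
  finally have d\<rho>: "(rho has_real_derivative \<rho>') (at t within {0..T})" .
  then show "(rho has_real_derivative r * rate r c s * clock t) (at t within {0..T})"
    by (simp add: rate)
  have r0: "rho t \<noteq> 0" "r \<noteq> 0" "a \<noteq> 0" "n > 0" using polar(1) a n by (auto simp: r_def)
  have "((\<lambda>t. x t / rho t) has_real_derivative (U0 * r - x t * \<rho>') / (r * r)) (at t within {0..T})"
    using DERIV_divide[OF dx[OF t] d\<rho> r0(1)] by (simp add: U0_def r_def)
  also have "(U0 * r - x t * \<rho>') / (r * r) = s / n * clock t"
  proof -
    have "n * (U0 * r - x t * \<rho>') = r * r * (a * (n * u r c s * (1 - c * k) - c * s * v r c s))"
      unfolding U xw \<rho>'_def using r0 by (simp add: field_simps power2_eq_square)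
    also have "1 - c * k = s\<^sup>2" using ck by simp
    also have "a * (n * u r c s * s\<^sup>2 - c * s * v r c s) = s * clock t"
      unfolding clock Q_def by (simp add: algebra_simps power2_eq_square)
    finally show ?thesis using r0 by (simp add: field_simps)
  qed
  finally show "((\<lambda>t. x t / rho t) has_real_derivative s / n * clock t) (at t within {0..T})" .
  have "((\<lambda>t. w t / rho t ^ n) has_real_derivative
        (V0 * r ^ n - w t * (n * (r ^ (n - 1) * \<rho>'))) / (r ^ n * r ^ n)) (at t within {0..T})"
    using DERIV_divide[OF dw[OF t] DERIV_power[OF d\<rho>, of n]] r0 by (simp add: V0_def r_def mult_ac)
  also have "(V0 * r ^ n - w t * (n * (r ^ (n - 1) * \<rho>'))) / (r ^ n * r ^ n) = - (c ^ (2 * n - 1)) * clock t"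
  proof -
    have "V0 * r ^ n - w t * (n * (r ^ (n - 1) * \<rho>'))
        = (r * a) * (r * a) * (a * (v r c s * (1 - s\<^sup>2) - n * s * k * u r c s))"
      unfolding V xw \<rho>'_def rn a_def[symmetric] using r0 by (simp add: field_simps power2_eq_square)
    also have "1 - s\<^sup>2 = c * k" using ck by simp
    also have "a * (v r c s * (c * k) - n * s * k * u r c s) = - k * clock t"
      unfolding clock Q_def by (simp add: algebra_simps)
    finally show ?thesis unfolding rn k_def using r0 by simp
  qed
  finally show "((\<lambda>t. w t / rho t ^ n) has_real_derivative - (c ^ (2 * n - 1)) * clock t)
     (at t within {0..T})" .
qed

lemma polar_reparametrization:
  obtains \<Psi> h r C S where
    "\<Psi> > 0" "lyapunov_curve n \<Psi> C S" "r 0 = x 0" "h \<Psi> = T"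
    "\<And>q. q \<in> {0<..<\<Psi>} \<Longrightarrow> h q \<in> {0<..<T}"
    "\<And>q. q \<in> {0..\<Psi>} \<Longrightarrow> 0 < r q \<and> r q < R \<and> x (h q) = r q * C q \<and> w (h q) = r q ^ n * S q"
    "\<And>q. q \<in> {0..\<Psi>} \<Longrightarrow>
        (r has_real_derivative r q * rate (r q) (C q) (S q)) (at q within {0..\<Psi>})"
proof -
  have contx: "continuous_on {0..T} x" and contw: "continuous_on {0..T} w"
    by (rule DERIV_continuous_on, erule dx, rule DERIV_continuous_on, erule dw)
  have contrho: "continuous_on {0..T} rho"
    by (rule DERIV_continuous_on, erule polar_derivatives(2))
  have contUV: "continuous_on {0..T} (\<lambda>t. U (x t) (w t))" "continuous_on {0..T} (\<lambda>t. V (x t) (w t))"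
  proof -
    have *: "(\<lambda>t. (x t, w t)) ` {0..T} \<subseteq> {(x, w). x ^ (2 * n) + w\<^sup>2 < R ^ (2 * n)}"
      using small by auto
    show "continuous_on {0..T} (\<lambda>t. U (x t) (w t))" "continuous_on {0..T} (\<lambda>t. V (x t) (w t))"
      using continuous_on_compose2[OF continuous(1) continuous_on_Pair[OF contx contw] *]
        continuous_on_compose2[OF continuous(2) continuous_on_Pair[OF contx contw] *] by simp_all
  qed
  have contclock: "continuous_on {0..T} clock"
    unfolding clock_def[abs_def]
    by (intro continuous_intros contx contw contrho contUV) (use rho_polar(1) in force)
  define \<psi> where "\<psi> = (\<lambda>t. integral {0..t} clock)"
  have "\<psi> 0 = 0" by (simp add: \<psi>_def)
  moreover have "(\<psi> has_real_derivative clock t) (at t within {0..T})" if "t \<in> {0..T}" for t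
    unfolding \<psi>_def by (rule integral_has_real_derivative[OF contclock that])
  ultimately obtain h where h: "\<psi> T > 0" "h 0 = 0" "h (\<psi> T) = T"
    "\<And>q. q \<in> {0..\<psi> T} \<Longrightarrow> h q \<in> {0..T}"
    "\<And>q. q \<in> {0<..<\<psi> T} \<Longrightarrow> h q \<in> {0<..<T}"
    "\<And>q. q \<in> {0..\<psi> T} \<Longrightarrow> (h has_real_derivative inverse (clock (h q))) (at q within {0..\<psi> T})"
    using inverse_reparametrization[of T \<psi> clock, OF T _ _ polar_derivatives(1)] by blast
  have chain: "((\<lambda>q. f (h q)) has_real_derivative d) (at q within {0..\<psi> T})"
    if q: "q \<in> {0..\<psi> T}" and f: "(f has_real_derivative d * clock (h q)) (at (h q) within {0..T})"
    for f d q
  proof -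
    have "(f has_real_derivative d * clock (h q)) (at (h q) within h ` {0..\<psi> T})"
      by (rule has_field_derivative_subset[OF f]) (use h(4) in auto)
    from DERIV_image_chain[OF this h(6)[OF q]] show ?thesis
      using polar_derivatives(1)[OF h(4)[OF q]] by (simp add: o_def mult.assoc)
  qed
  define r C S where "r = (\<lambda>q. rho (h q))" and "C = (\<lambda>q. x (h q) / rho (h q))"
    and "S = (\<lambda>q. w (h q) / rho (h q) ^ n)"
  show ?thesis
  proof (rule that[of "\<psi> T" C S r h])
    have r0: "rho 0 = x 0" using init n by (simp add: rho_def qnorm_axis)
    show "r 0 = x 0" by (simp add: r_def h r0)
    have "C 0 = 1" "S 0 = 0" using init by (auto simp: C_def S_def h r0)
    then show "lyapunov_curve n (\<psi> T) C S"
      unfolding lyapunov_curve_def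
      using chain[OF _ polar_derivatives(3)[OF h(4)]] chain[OF _ polar_derivatives(4)[OF h(4)]]
      unfolding C_def S_def by blast
    show "(r has_real_derivative r q * rate (r q) (C q) (S q)) (at q within {0..\<psi> T})"
      if "q \<in> {0..\<psi> T}" for q
      unfolding r_def C_def S_def
      using chain[OF that] polar_derivatives(2)[OF h(4)[OF that]] by blast
    show "0 < r q \<and> r q < R \<and> x (h q) = r q * C q \<and> w (h q) = r q ^ n * S q"
      if "q \<in> {0..\<psi> T}" for q
      unfolding r_def C_def S_def using rho_polar[OF h(4)[OF that]] by auto
  qed (use h in auto)
qed

end

end

section \<open>Comparison of first returns\<close>

text \<open>
The orbit starts on the positive half of the axis \<open>w = 0\<close>, meets it again for the first time at
\<open>x1\<close>, and in between stays in the region where the estimates on the field hold.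
\<close>

definition first_return ::
    "nat \<Rightarrow> (real \<Rightarrow> real \<Rightarrow> real) \<Rightarrow> (real \<Rightarrow> real \<Rightarrow> real) \<Rightarrow> real \<Rightarrow> real \<Rightarrow> real \<Rightarrow> bool" where
  "first_return n U V R x0 x1 \<longleftrightarrow>
     (\<exists>T x w. T > 0 \<and>
        (\<forall>t\<in>{0..T}. (x has_real_derivative U (x t) (w t)) (at t within {0..T}) \<and>
                     (w has_real_derivative V (x t) (w t)) (at t within {0..T}) \<and>
                     x t ^ (2 * n) + (w t)\<^sup>2 < R ^ (2 * n)) \<and>
        x 0 = x0 \<and> w 0 = 0 \<and> x T = x1 \<and> w T = 0 \<and> x0 > 0 \<and> x1 > 0 \<and>
        (\<forall>t\<in>{0<..<T}. \<not> (w t = 0 \<and> x t > 0)))"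

lemma quotient_diff_le:
  fixes N N' D D' \<delta> e M :: real
  assumes "D \<ge> \<delta>" "D' \<ge> \<delta>" "\<delta> > 0" "\<bar>N - N'\<bar> \<le> e" "\<bar>D - D'\<bar> \<le> e'" "\<bar>N'\<bar> \<le> M"
  shows "\<bar>N / D - N' / D'\<bar> \<le> e / \<delta> + M * e' / \<delta>\<^sup>2"
proof -
  have pos: "D > 0" "D' > 0" using assms by auto
  have "N / D - N' / D' = (N - N') / D + N' * (D' - D) / (D * D')"
    using pos by (simp add: field_simps)
  also have "\<bar>\<dots>\<bar> \<le> \<bar>N - N'\<bar> / D + \<bar>N'\<bar> * \<bar>D - D'\<bar> / (D * D')"
    using pos by (intro order_trans[OF abs_triangle_ineq]) (simp add: abs_mult abs_minus_commute)
  also have "\<dots> \<le> e / \<delta> + M * e' / \<delta>\<^sup>2"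
    unfolding power2_eq_square using assms pos
    by (intro add_mono frac_le mult_mono) (auto intro: order_trans[OF abs_ge_zero])
  finally show ?thesis .
qed

lemma abs_combination_le:
  fixes p q a b m :: real
  assumes "\<bar>p\<bar> \<le> 1" "\<bar>q\<bar> \<le> 1" "\<bar>a\<bar> \<le> m" "\<bar>b\<bar> \<le> m"
  shows "\<bar>real n * p * a + q * b\<bar> \<le> real (n + 1) * m"
proof -
  have "\<bar>p * a\<bar> \<le> 1 * m" "\<bar>q * b\<bar> \<le> 1 * m"
    unfolding abs_mult by (rule mult_mono; use assms in auto)+
  moreover have "\<bar>real n * (p * a)\<bar> = n * \<bar>p * a\<bar>" by (simp add: abs_mult)
  moreover have "n * \<bar>p * a\<bar> \<le> n * m" using \<open>\<bar>p * a\<bar> \<le> 1 * m\<close> by (intro mult_left_mono) auto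
  moreover have "\<bar>real n * (p * a) + q * b\<bar> \<le> \<bar>real n * (p * a)\<bar> + \<bar>q * b\<bar>" by (rule abs_triangle_ineq)
  ultimately have "\<bar>real n * (p * a) + q * b\<bar> \<le> n * m + m" by linarith
  then show ?thesis by (simp add: algebra_simps)
qed

text \<open>
The radial rate is a Lipschitz function of \<open>(u, v)\<close> as long as its denominator, \<open>n\<close> times the angular
velocity, is bounded below. This is used twice: for the same field at two radii and for two fields
at the same radius.
\<close>

lemma rate_diff_le:
  fixes c s u v u' v' \<kappa> L e :: real and n :: nat
  assumes n: "n \<ge> 1" and cs: "\<bar>c\<bar> \<le> 1" "\<bar>s\<bar> \<le> 1" and \<kappa>: "\<kappa> > 0"
    and den: "real n * s * u - c * v \<ge> \<kappa>" "real n * s * u' - c * v' \<ge> \<kappa>"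
    and bound: "\<bar>u'\<bar> \<le> L" "\<bar>v'\<bar> \<le> L" and e: "\<bar>u - u'\<bar> \<le> e" "\<bar>v - v'\<bar> \<le> e"
  shows "\<bar>(real n * c ^ (2 * n - 1) * u + s * v) / (real n * (real n * s * u - c * v))
        - (real n * c ^ (2 * n - 1) * u' + s * v') / (real n * (real n * s * u' - c * v'))\<bar>
      \<le> ((n + 1) / \<kappa> + (n + 1) * L * (n * (n + 1)) / \<kappa>\<^sup>2) * e"
proof -
  have k: "\<bar>c ^ (2 * n - 1)\<bar> \<le> 1" using cs by (simp add: power_abs power_le_one)
  note comb = abs_combination_le[where n = n]
  have "\<bar>(real n * c ^ (2 * n - 1) * u + s * v) / (real n * (real n * s * u - c * v))
        - (real n * c ^ (2 * n - 1) * u' + s * v') / (real n * (real n * s * u' - c * v'))\<bar>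
      \<le> ((n + 1) * e) / \<kappa> + ((n + 1) * L) * (n * ((n + 1) * e)) / \<kappa>\<^sup>2"
  proof (rule quotient_diff_le)
    have "\<kappa> \<le> z \<Longrightarrow> \<kappa> \<le> real n * z" for z
      using n \<kappa> mult_mono[of 1 "real n" \<kappa> z] by auto
    then show "\<kappa> \<le> real n * (real n * s * u - c * v)" "\<kappa> \<le> real n * (real n * s * u' - c * v')"
      using den by auto
    show "\<bar>(real n * c ^ (2 * n - 1) * u + s * v) - (real n * c ^ (2 * n - 1) * u' + s * v')\<bar> \<le> (n + 1) * e"
      using comb[OF k cs(2) e] by (simp add: algebra_simps)
    show "\<bar>real n * c ^ (2 * n - 1) * u' + s * v'\<bar> \<le> (n + 1) * L"
      by (rule comb[OF k cs(2) bound])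
    have "\<bar>real n * s * (u - u') + (- c) * (v - v')\<bar> \<le> (n + 1) * e"
      using comb[OF cs(2) _ e, of "- c"] cs by simp
    then have "real n * \<bar>real n * s * (u - u') + (- c) * (v - v')\<bar> \<le> n * ((n + 1) * e)"
      by (intro mult_left_mono) auto
    moreover have "real n * (real n * s * u - c * v) - real n * (real n * s * u' - c * v')
        = real n * (real n * s * (u - u') + (- c) * (v - v'))"
      by (simp add: algebra_simps)
    ultimately show "\<bar>real n * (real n * s * u - c * v) - real n * (real n * s * u' - c * v')\<bar> \<le> n * ((n + 1) * e)"
      by (simp only: abs_mult abs_of_nat)
  qed (use \<kappa> in auto)
  then show ?thesis by (simp add: algebra_simps add_divide_distrib)
qed

context quasihomogeneous_rotation
begin

definition "rate_bound = (n + 1) * L / \<kappa>"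

lemma abs_rate_le:
  assumes "0 < r" "r < R" "c ^ (2 * n) + s\<^sup>2 = 1"
  shows "\<bar>rate r c s\<bar> \<le> rate_bound"
proof -
  note cs = unit_curve_bounds[OF assms(3) n]
  have k: "\<bar>c ^ (2 * n - 1)\<bar> \<le> 1" using cs by (simp add: power_abs power_le_one)
  have "\<bar>u r c s\<bar> \<le> L" "\<bar>v r c s\<bar> \<le> L"
    using bound_U[OF assms] bound_V[OF assms] by (simp_all only: u_def v_def)
  from abs_combination_le[OF k cs(2) this]
  have num: "\<bar>real n * c ^ (2 * n - 1) * u r c s + s * v r c s\<bar> \<le> (n + 1) * L" .
  have den: "real n * (real n * s * u r c s - c * v r c s) \<ge> \<kappa>"
    using rotation[OF assms] \<kappa> n
      mult_mono[of 1 "real n" \<kappa> "real n * s * u r c s - c * v r c s"]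
    unfolding u_def v_def by auto
  show ?thesis
    unfolding rate_def rate_bound_def abs_divide
    by (rule frac_le[OF _ num \<kappa> order_trans[OF den abs_ge_self]]) (use L in auto)
qed

lemma rate_bound_nonneg: "rate_bound \<ge> 0"
  using \<kappa> L by (simp add: rate_bound_def)

text \<open>
An orbit without a return in the open interval cannot last longer than \<open>4 * pi * n\<close> in angular
time, and over such a span \<open>r\<close> grows at most by a constant factor. The end point need not be a
return: the lemma also serves to exclude that an orbit leaves a small region.
\<close>

lemma first_return_reparametrization:
  assumes T: "T > 0"
    and dx: "\<And>t. t \<in> {0..T} \<Longrightarrow> (x has_real_derivative U (x t) (w t)) (at t within {0..T})"
    and dw: "\<And>t. t \<in> {0..T} \<Longrightarrow> (w has_real_derivative V (x t) (w t)) (at t within {0..T})"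
    and small: "\<And>t. t \<in> {0..T} \<Longrightarrow> x t ^ (2 * n) + (w t)\<^sup>2 < R ^ (2 * n)"
    and init: "x 0 > 0" "w 0 = 0"
    and first: "\<And>t. t \<in> {0<..<T} \<Longrightarrow> \<not> (w t = 0 \<and> x t > 0)"
  obtains \<Psi> r C S where
    "0 < \<Psi>" "\<Psi> \<le> 4 * pi * n" "lyapunov_curve n \<Psi> C S" "r 0 = x 0"
    "x T = r \<Psi> * C \<Psi>" "w T = r \<Psi> ^ n * S \<Psi>"
    "\<And>q. q \<in> {0<..<\<Psi>} \<Longrightarrow> \<not> (S q = 0 \<and> C q > 0)"
    "\<And>q. q \<in> {0..\<Psi>} \<Longrightarrow> 0 < r q \<and> r q < R \<and> r q \<le> x 0 * exp (rate_bound * (4 * pi * n))"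
    "\<And>q. q \<in> {0..\<Psi>} \<Longrightarrow>
        (r has_real_derivative r q * rate (r q) (C q) (S q)) (at q within {0..\<Psi>})"
proof -
  obtain \<Psi> h r C S where \<Psi>: "\<Psi> > 0" and curve: "lyapunov_curve n \<Psi> C S"
    and r0: "r 0 = x 0" and h: "h \<Psi> = T" "\<And>q. q \<in> {0<..<\<Psi>} \<Longrightarrow> h q \<in> {0<..<T}"
    and polar: "\<And>q. q \<in> {0..\<Psi>} \<Longrightarrow> 0 < r q \<and> r q < R \<and> x (h q) = r q * C q \<and> w (h q) = r q ^ n * S q"
    and dr: "\<And>q. q \<in> {0..\<Psi>} \<Longrightarrow>
        (r has_real_derivative r q * rate (r q) (C q) (S q)) (at q within {0..\<Psi>})"
    by (rule polar_reparametrization[OF T dx dw small init]) (assumption | (rule that, assumption+))+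
  have no_return: "\<not> (S q = 0 \<and> C q > 0)" if q: "q \<in> {0<..<\<Psi>}" for q
    using first[OF h(2)[OF q]] polar[of q] q n by auto
  have short: "\<Psi> \<le> 4 * pi * n"
  proof (rule ccontr)
    assume long: "\<not> \<Psi> \<le> 4 * pi * n"
    then obtain q where "0 < q" "q \<le> 4 * pi * n" "S q = 0" "C q > 0"
      using lyapunov_curve_returns[OF curve n] by auto
    then show False using no_return[of q] long by auto
  qed
  have growth: "r q \<le> x 0 * exp (rate_bound * (4 * pi * n))" if q: "q \<in> {0..\<Psi>}" for q
  proof -
    have "r q \<le> (r 0 + 0 * q) * exp (rate_bound * q)"
    proof (rule gronwall_affine[OF dr])
      fix q assume q: "q \<in> {0..\<Psi>}"
      have "rate (r q) (C q) (S q) \<le> rate_bound"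
        using abs_rate_le[of "r q" "C q" "S q"] polar[OF q] lyapunov_curve_invariant[OF curve n q] by auto
      then show "r q * rate (r q) (C q) (S q) \<le> rate_bound * r q + 0"
        using polar[OF q] by (simp add: mult.commute mult_left_mono)
    qed (use q rate_bound_nonneg in auto)
    also have "\<dots> \<le> x 0 * exp (rate_bound * (4 * pi * n))"
      using q short init rate_bound_nonneg by (auto simp: r0 intro!: mult_left_mono)
    finally show ?thesis .
  qed
  show ?thesis
    using that[of \<Psi> C S r] \<Psi> short curve r0 polar[of \<Psi>] h(1) no_return growth polar dr by auto
qed

end

text \<open>
Both orbits follow the same curve \<open>(C, S)\<close>, hence return at the same angular time with \<open>C = 1\<close>,
where the abscissa equals \<open>r\<close>. The difference of the two radii satisfies a differential
inequality with the forcing term \<open>r * r ^ p\<close>, and \<open>r \<le> x0 * Z\<close>.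
\<close>

lemma first_returns_close:
  assumes rot1: "quasihomogeneous_rotation n U1 V1 R \<kappa> L"
    and rot2: "quasihomogeneous_rotation n U2 V2 R \<kappa> L"
    and B: "B \<ge> 0"
    and diff_U: "\<And>r c s :: real. 0 < r \<Longrightarrow> r < R \<Longrightarrow> c ^ (2 * n) + s\<^sup>2 = 1 \<Longrightarrow>
        \<bar>U1 (r * c) (r ^ n * s) / r ^ n - U2 (r * c) (r ^ n * s) / r ^ n\<bar> \<le> B * r ^ p"
    and diff_V: "\<And>r c s :: real. 0 < r \<Longrightarrow> r < R \<Longrightarrow> c ^ (2 * n) + s\<^sup>2 = 1 \<Longrightarrow>
        \<bar>V1 (r * c) (r ^ n * s) / r ^ (2 * n - 1) - V2 (r * c) (r ^ n * s) / r ^ (2 * n - 1)\<bar> \<le> B * r ^ p"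
  shows "\<exists>G. \<forall>x0 x1 x2. first_return n U1 V1 R x0 x1 \<longrightarrow> first_return n U2 V2 R x0 x2 \<longrightarrow>
           \<bar>x1 - x2\<bar> \<le> G * x0 ^ (p + 1)"
proof -
  interpret R1: quasihomogeneous_rotation n U1 V1 R \<kappa> L by (rule rot1)
  interpret R2: quasihomogeneous_rotation n U2 V2 R \<kappa> L by (rule rot2)
  note n = R1.n
  define Z where "Z = exp (R2.rate_bound * (4 * pi * n))"
  define M where "M = (n + 1) / \<kappa> + (n + 1) * L * (n * (n + 1)) / \<kappa>\<^sup>2"
  define K where "K = R1.rate_bound + M * L"
  define G where "G = M * B * Z ^ (p + 1) * sqrt (4 * pi * n * exp ((2 * K + 1) * (4 * pi * n)))"
  have M: "M \<ge> 0" using R1.\<kappa> R1.L by (simp add: M_def)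
  have K: "K \<ge> 0" using R1.rate_bound_nonneg M R1.L by (simp add: K_def)
  have "\<bar>x1 - x2\<bar> \<le> G * x0 ^ (p + 1)"
    if ret: "first_return n U1 V1 R x0 x1" "first_return n U2 V2 R x0 x2" for x0 x1 x2
  proof -
    have x0: "x0 > 0" using ret(1) by (auto simp: first_return_def)
    obtain T1 x w where T1: "T1 > 0" and d1:
      "\<And>t. t \<in> {0..T1} \<Longrightarrow> (x has_real_derivative U1 (x t) (w t)) (at t within {0..T1})"
      "\<And>t. t \<in> {0..T1} \<Longrightarrow> (w has_real_derivative V1 (x t) (w t)) (at t within {0..T1})"
      "\<And>t. t \<in> {0..T1} \<Longrightarrow> x t ^ (2 * n) + (w t)\<^sup>2 < R ^ (2 * n)"
      and e1: "x 0 = x0" "w 0 = 0" "x T1 = x1" "w T1 = 0" "x1 > 0"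
      and f1: "\<And>t. t \<in> {0<..<T1} \<Longrightarrow> \<not> (w t = 0 \<and> x t > 0)"
      using ret(1) unfolding first_return_def by blast
    have p1: "x 0 > 0" using e1 x0 by simp
    obtain \<Psi>1 r1 C1 S1 where 1: "0 < \<Psi>1" "\<Psi>1 \<le> 4 * pi * n" "lyapunov_curve n \<Psi>1 C1 S1" "r1 0 = x0"
      "x1 = r1 \<Psi>1 * C1 \<Psi>1" "0 = r1 \<Psi>1 ^ n * S1 \<Psi>1"
      "\<And>q. q \<in> {0<..<\<Psi>1} \<Longrightarrow> \<not> (S1 q = 0 \<and> C1 q > 0)"
      "\<And>q. q \<in> {0..\<Psi>1} \<Longrightarrow> 0 < r1 q \<and> r1 q < R \<and> r1 q \<le> x0 * Z"
      "\<And>q. q \<in> {0..\<Psi>1} \<Longrightarrow>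
          (r1 has_real_derivative r1 q * R1.rate (r1 q) (C1 q) (S1 q)) (at q within {0..\<Psi>1})"
      by (rule R1.first_return_reparametrization[OF T1 d1 p1 e1(2) f1, unfolded e1, folded Z_def])
        (assumption | (rule that, assumption+))+
    obtain T2 x w where T2: "T2 > 0" and d2:
      "\<And>t. t \<in> {0..T2} \<Longrightarrow> (x has_real_derivative U2 (x t) (w t)) (at t within {0..T2})"
      "\<And>t. t \<in> {0..T2} \<Longrightarrow> (w has_real_derivative V2 (x t) (w t)) (at t within {0..T2})"
      "\<And>t. t \<in> {0..T2} \<Longrightarrow> x t ^ (2 * n) + (w t)\<^sup>2 < R ^ (2 * n)"
      and e2: "x 0 = x0" "w 0 = 0" "x T2 = x2" "w T2 = 0" "x2 > 0"
      and f2: "\<And>t. t \<in> {0<..<T2} \<Longrightarrow> \<not> (w t = 0 \<and> x t > 0)"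
      using ret(2) unfolding first_return_def by blast
    have p2: "x 0 > 0" using e2 x0 by simp
    obtain \<Psi>2 r2 C2 S2 where 2: "0 < \<Psi>2" "\<Psi>2 \<le> 4 * pi * n" "lyapunov_curve n \<Psi>2 C2 S2" "r2 0 = x0"
      "x2 = r2 \<Psi>2 * C2 \<Psi>2" "0 = r2 \<Psi>2 ^ n * S2 \<Psi>2"
      "\<And>q. q \<in> {0<..<\<Psi>2} \<Longrightarrow> \<not> (S2 q = 0 \<and> C2 q > 0)"
      "\<And>q. q \<in> {0..\<Psi>2} \<Longrightarrow> 0 < r2 q \<and> r2 q < R \<and> r2 q \<le> x0 * Z"
      "\<And>q. q \<in> {0..\<Psi>2} \<Longrightarrow>
          (r2 has_real_derivative r2 q * R2.rate (r2 q) (C2 q) (S2 q)) (at q within {0..\<Psi>2})"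
      by (rule R2.first_return_reparametrization[OF T2 d2 p2 e2(2) f2, unfolded e2, folded Z_def])
        (assumption | (rule that, assumption+))+
    have end1: "S1 \<Psi>1 = 0" "C1 \<Psi>1 > 0" and end2: "S2 \<Psi>2 = 0" "C2 \<Psi>2 > 0"
      using 1(1,5,6) e1(5) 1(8)[of \<Psi>1] 2(1,5,6) e2(5) 2(8)[of \<Psi>2] by (auto simp: zero_less_mult_iff)
    have restrict: "lyapunov_curve n T' C S" if "lyapunov_curve n T C S" "T' \<le> T" for T T' C S
      using that unfolding lyapunov_curve_def
      by (auto intro: has_field_derivative_subset[where t = "{0..T'}" and s = "{0..T}"])
    \<comment> \<open>Both orbits run along the same curve, so they close up for the same parameter.\<close>
    have "\<not> \<Psi>1 < \<Psi>2"
    proof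
      assume less: "\<Psi>1 < \<Psi>2"
      have "C1 \<Psi>1 = C2 \<Psi>1" "S1 \<Psi>1 = S2 \<Psi>1"
        using lyapunov_curve_unique[OF 1(3) restrict[OF 2(3)] n, of \<Psi>1] 1(1) less by auto
      then show False using 2(7)[of \<Psi>1] end1 1(1) less by auto
    qed
    moreover have "\<not> \<Psi>2 < \<Psi>1"
    proof
      assume less: "\<Psi>2 < \<Psi>1"
      have "C2 \<Psi>2 = C1 \<Psi>2" "S2 \<Psi>2 = S1 \<Psi>2"
        using lyapunov_curve_unique[OF 2(3) restrict[OF 1(3)] n, of \<Psi>2] 2(1) less by auto
      then show False using 1(7)[of \<Psi>2] end2 2(1) less by auto
    qed
    ultimately have eq: "\<Psi>2 = \<Psi>1" by simp
    have CS: "C2 q = C1 q" "S2 q = S1 q" if "q \<in> {0..\<Psi>1}" for q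
      using lyapunov_curve_unique[OF 2(3)[unfolded eq] 1(3) n that] by auto
    have "C1 \<Psi>1 ^ (2 * n) = 1"
      using lyapunov_curve_invariant[OF 1(3) n, of \<Psi>1] end1 1(1) by simp
    then have "C1 \<Psi>1 = 1" using end1 n by (metis mult_eq_0_iff not_one_le_zero
          power_eq_1_iff zero_neq_numeral abs_of_pos real_norm_def)
    then have ends: "x1 = r1 \<Psi>1" "x2 = r2 \<Psi>1" using 1(5) 2(5) CS(1)[of \<Psi>1] 1(1) eq by auto
    define b where "b = M * B * (x0 * Z) ^ (p + 1)"
    have b: "b \<ge> 0" using M B x0 by (simp add: b_def Z_def)
    define f where "f = (\<lambda>q. r1 q - r2 q)"
    have "\<bar>f \<Psi>1\<bar> \<le> b * sqrt (\<Psi>1 * exp ((2 * K + 1) * \<Psi>1))"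
    proof (rule abs_gronwall)
      fix q assume q: "q \<in> {0..\<Psi>1}"
      let ?A1 = "\<lambda>r. R1.rate r (C1 q) (S1 q)" and ?A2 = "\<lambda>r. R2.rate r (C1 q) (S1 q)"
      show "(f has_real_derivative r1 q * ?A1 (r1 q) - r2 q * ?A2 (r2 q)) (at q within {0..\<Psi>1})"
        using DERIV_diff[OF 1(9)[OF q] 2(9)[of q, unfolded eq, OF q]] CS[OF q] by (simp add: f_def)
      have r1: "0 < r1 q" "r1 q < R" and r2: "0 < r2 q" "r2 q < R" "r2 q \<le> x0 * Z"
        using 1(8)[OF q] 2(8)[unfolded eq, OF q] by auto
      note inv = lyapunov_curve_invariant[OF 1(3) n q]
      note cs = unit_curve_bounds[OF inv n]
      have lip: "\<bar>?A1 (r1 q) - ?A1 (r2 q)\<bar> \<le> M * (L * \<bar>r1 q - r2 q\<bar>)"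
        unfolding M_def R1.rate_def
        by (rule rate_diff_le[OF n cs R1.\<kappa>
              R1.rotation[OF r1 inv, folded R1.u_def R1.v_def]
              R1.rotation[OF r2(1,2) inv, folded R1.u_def R1.v_def]
              R1.bound_U[OF r2(1,2) inv, folded R1.u_def] R1.bound_V[OF r2(1,2) inv, folded R1.v_def]
              R1.lipschitz_U[OF r1 r2(1,2) inv, folded R1.u_def]
              R1.lipschitz_V[OF r1 r2(1,2) inv, folded R1.v_def]])
      have dif: "\<bar>?A1 (r2 q) - ?A2 (r2 q)\<bar> \<le> M * (B * r2 q ^ p)"
        unfolding M_def R1.rate_def R2.rate_def
        by (rule rate_diff_le[OF n cs R1.\<kappa>
              R1.rotation[OF r2(1,2) inv, folded R1.u_def R1.v_def]
              R2.rotation[OF r2(1,2) inv, folded R2.u_def R2.v_def]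
              R2.bound_U[OF r2(1,2) inv, folded R2.u_def] R2.bound_V[OF r2(1,2) inv, folded R2.v_def]
              diff_U[OF r2(1,2) inv, folded R1.u_def R2.u_def]
              diff_V[OF r2(1,2) inv, folded R1.v_def R2.v_def]])
      define a1 a12 a2 where "a1 = ?A1 (r1 q)" and "a12 = ?A1 (r2 q)" and "a2 = ?A2 (r2 q)"
      have split: "r1 q * a1 - r2 q * a2 = f q * a1 + r2 q * (a1 - a12) + r2 q * (a12 - a2)"
        by (simp add: f_def algebra_simps)
      have t1: "\<bar>f q * a1\<bar> \<le> R1.rate_bound * \<bar>f q\<bar>"
        using R1.abs_rate_le[OF r1 inv] by (simp add: abs_mult mult.commute mult_left_mono a1_def)
      have t2: "\<bar>r2 q * (a1 - a12)\<bar> \<le> 1 * (M * (L * \<bar>f q\<bar>))"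
        unfolding abs_mult using lip r2 R1.R
        by (intro mult_mono) (auto simp: a1_def a12_def f_def)
      have "\<bar>r2 q * (a12 - a2)\<bar> \<le> r2 q * (M * (B * r2 q ^ p))"
        unfolding abs_mult using dif r2 by (intro mult_mono) (auto simp: a12_def a2_def)
      moreover have "r2 q * (M * (B * r2 q ^ p)) = M * B * r2 q ^ (p + 1)" by simp
      moreover have "M * B * r2 q ^ (p + 1) \<le> b"
        unfolding b_def using r2 M B by (intro mult_left_mono power_mono) auto
      ultimately have t3: "\<bar>r2 q * (a12 - a2)\<bar> \<le> b" by linarith
      have "\<bar>r1 q * a1 - r2 q * a2\<bar> \<le> \<bar>f q * a1\<bar> + \<bar>r2 q * (a1 - a12)\<bar> + \<bar>r2 q * (a12 - a2)\<bar>"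
        unfolding split by linarith
      also have "\<dots> \<le> K * \<bar>f q\<bar> + b"
        using t1 t2 t3 by (simp add: K_def algebra_simps)
      finally show "\<bar>r1 q * ?A1 (r1 q) - r2 q * ?A2 (r2 q)\<bar> \<le> K * \<bar>f q\<bar> + b"
        by (simp only: a1_def a2_def)
    qed (use K b 1(1,4) 2(4) in \<open>auto simp: f_def\<close>)
    also have "\<dots> \<le> b * sqrt (4 * pi * n * exp ((2 * K + 1) * (4 * pi * n)))"
      using b 1(1,2) K by (intro mult_left_mono real_sqrt_le_mono mult_mono) (auto intro!: mult_left_mono)
    also have "\<dots> = G * x0 ^ (p + 1)"
      by (simp add: G_def b_def power_mult_distrib)
    finally show ?thesis by (simp add: f_def ends)
  qed
  then show ?thesis by blast
qed

section \<open>Holomorphic functions vanishing to a given order on a half-line\<close>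

text \<open>
A bound on the positive reals alone suffices: it forces \<open>H 0 = 0\<close>, and one divides by \<open>z\<close>
repeatedly.
\<close>

lemma factor_of_vanishing_order:
  assumes "H holomorphic_on ball 0 R" "R > 0"
    and "\<forall>\<^sub>F t in at_right 0. cmod (H (of_real t)) \<le> K * t ^ m"
  shows "\<exists>q. q holomorphic_on ball 0 R \<and> (\<forall>z\<in>ball 0 R. H z = z ^ m * q z)"
  using assms
proof (induction m arbitrary: H)
  case 0
  then show ?case by (intro exI[of _ H]) auto
next
  case (Suc m)
  have "isCont H 0"
    using Suc.prems(1,2) by (intro continuous_on_interior[OF holomorphic_on_imp_continuous_on]) auto
  moreover have "((\<lambda>t. of_real t :: complex) \<longlongrightarrow> 0) (at_right 0)"
    by (auto intro!: tendsto_eq_intros)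
  ultimately have lim: "((\<lambda>t. H (of_real t)) \<longlongrightarrow> H 0) (at_right (0::real))"
    using isCont_tendsto_compose by blast
  moreover have "((\<lambda>t. H (of_real t)) \<longlongrightarrow> 0) (at_right (0::real))"
  proof (rule Lim_null_comparison[OF Suc.prems(3)])
    show "((\<lambda>t. K * t ^ Suc m) \<longlongrightarrow> 0) (at_right 0)"
      by (auto intro!: tendsto_eq_intros)
  qed
  ultimately have H0: "H 0 = 0" using tendsto_unique[OF trivial_limit_at_right_real] by blast
  define G where "G = (\<lambda>z. if z = 0 then deriv H 0 else H z / z)"
  have G: "G holomorphic_on ball 0 R"
    by (rule pole_theorem_open_0[OF Suc.prems(1)]) (auto simp: G_def H0)
  have HG: "H z = z * G z" for z by (simp add: G_def H0)
  have "\<forall>\<^sub>F t in at_right 0. cmod (G (of_real t)) \<le> K * t ^ m"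
    using Suc.prems(3) eventually_at_right_less[of 0]
  proof eventually_elim
    case (elim t)
    then have "t * cmod (G (of_real t)) \<le> t * (K * t ^ m)"
      unfolding HG by (simp add: norm_mult mult_ac)
    then show ?case using elim by simp
  qed
  from Suc.IH[OF G Suc.prems(2) this]
  obtain q where "q holomorphic_on ball 0 R" "\<forall>z\<in>ball 0 R. G z = z ^ m * q z" by blast
  then show ?case by (intro exI[of _ q]) (auto simp: HG)
qed

text \<open>
The constants depend on \<open>M\<close>, \<open>R\<close> and \<open>m\<close> only, and not on the constant \<open>K\<close> in the hypothesis on
the order. This is what makes pointwise limits sufficient for estimates that are uniform over a
family of functions \<open>H\<close>. The quotient \<open>H z / z ^ m\<close> is bounded by the maximum principle on the
circle of radius \<open>R / 2\<close>, and its derivative by Cauchy's inequality on discs of radius \<open>R / 4\<close>.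
\<close>

lemma scaled_quotient_estimates:
  fixes H :: "complex \<Rightarrow> complex" and h :: "real \<Rightarrow> real"
  assumes H: "H holomorphic_on ball 0 R" and R: "R > 0"
    and M_ball: "\<forall>z\<in>ball 0 R. cmod (H z) \<le> M"
    and real_segment: "\<forall>t\<in>{0<..<R}. H (of_real t) = of_real (h t)"
    and order: "\<forall>\<^sub>F t in at_right 0. \<bar>h t\<bar> \<le> K * t ^ m"
  defines "Q \<equiv> M * (2 / R) ^ m"
  shows "0 < t \<Longrightarrow> t < R / 2 \<Longrightarrow> \<bar>h t / t ^ m\<bar> \<le> Q"
    and "0 < t \<Longrightarrow> t < R / 4 \<Longrightarrow> 0 < t' \<Longrightarrow> t' < R / 4 \<Longrightarrow>
           \<bar>h t / t ^ m - h t' / t' ^ m\<bar> \<le> 4 * Q / R * \<bar>t - t'\<bar>"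
    and "0 < t \<Longrightarrow> t < R / 4 \<Longrightarrow> ((\<lambda>t. h t / t ^ m) \<longlongrightarrow> l) (at_right 0) \<Longrightarrow>
           \<bar>h t / t ^ m - l\<bar> \<le> 4 * Q / R * t"
proof -
  note M = M_ball[rule_format]
  have real: "H (of_real t) = of_real (h t)" if "0 < t" "t < R" for t
    using real_segment that by simp
  have "\<forall>\<^sub>F t in at_right 0. cmod (H (of_real t)) \<le> K * t ^ m"
    using order eventually_at_right_less[of 0] eventually_at_right_real[OF R]
    by eventually_elim (auto simp: real)
  from factor_of_vanishing_order[OF H R this]
  obtain q where q: "q holomorphic_on ball 0 R" and Hq: "\<And>z. z \<in> ball 0 R \<Longrightarrow> H z = z ^ m * q z"
    by blast
  have hq: "of_real (h t / t ^ m) = q (of_real t)" if "0 < t" "t < R" for t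
    using Hq[of "of_real t"] real[OF that] that by simp
  have bound: "cmod (q z) \<le> Q" if "z \<in> ball 0 (R / 2)" for z
  proof (rule maximum_modulus_frontier[of q "ball 0 (R / 2)"])
    show "q holomorphic_on interior (ball 0 (R / 2))"
      using q R by (auto intro: holomorphic_on_subset)
    show "continuous_on (closure (ball 0 (R / 2))) q"
      using R by (intro continuous_on_subset[OF holomorphic_on_imp_continuous_on[OF q]]) auto
    show "cmod (q z) \<le> Q" if "z \<in> frontier (ball 0 (R / 2))" for z
    proof -
      have z: "cmod z = R / 2" using that R by (simp add: frontier_ball)
      have "z \<in> ball 0 R" using z R by simp
      from M[OF this] Hq[OF this] have "cmod z ^ m * cmod (q z) \<le> M"
        by (simp add: norm_mult norm_power)
      then have "(R / 2) ^ m * cmod (q z) \<le> M" unfolding z .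
      then show ?thesis using R by (simp add: Q_def field_simps power_divide)
    qed
  qed (use that in auto)
  have lip: "cmod (q z - q z') \<le> 4 * Q / R * cmod (z - z')"
    if z: "z \<in> ball 0 (R / 4)" "z' \<in> ball 0 (R / 4)" for z z'
  proof (rule field_differentiable_bound[OF _ _ _ z])
    fix z :: complex assume z: "z \<in> ball 0 (R / 4)"
    show "(q has_field_derivative deriv q z) (at z within ball 0 (R / 4))"
      using holomorphic_derivI[OF q, of z] z R by (auto intro: has_field_derivative_at_within)
    have sub: "cball z (R / 4) \<subseteq> ball 0 (R / 2)"
    proof
      fix x assume "x \<in> cball z (R / 4)"
      then show "x \<in> ball 0 (R / 2)"
        using z norm_triangle_ineq[of z "x - z"] by (auto simp: dist_norm norm_minus_commute)
    qed
    have sub': "cball z (R / 4) \<subseteq> ball 0 R"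
      by (rule subset_trans[OF sub subset_ball]) (use R in auto)
    have "cmod ((deriv ^^ 1) q z) \<le> fact 1 * Q / (R / 4) ^ 1"
    proof (rule Cauchy_inequality)
      show "q holomorphic_on ball z (R / 4)"
        by (rule holomorphic_on_subset[OF q subset_trans[OF ball_subset_cball sub']])
      show "continuous_on (cball z (R / 4)) q"
        by (rule continuous_on_subset[OF holomorphic_on_imp_continuous_on[OF q] sub'])
      show "cmod (q x) \<le> Q" if "cmod (z - x) = R / 4" for x
        by (rule bound) (use sub that in \<open>auto simp: dist_norm\<close>)
    qed (use R in auto)
    then show "cmod (deriv q z) \<le> 4 * Q / R" by (simp add: mult.commute)
  qed auto
  show "\<bar>h t / t ^ m\<bar> \<le> Q" if t: "0 < t" "t < R / 2"
  proof -
    have "cmod (of_real (h t / t ^ m)) \<le> Q"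
      using bound[of "of_real t"] hq[of t] t R by simp
    then show ?thesis by (simp only: norm_of_real)
  qed
  have 2: "\<bar>h t / t ^ m - h t' / t' ^ m\<bar> \<le> 4 * Q / R * \<bar>t - t'\<bar>"
    if "0 < t" "t < R / 4" "0 < t'" "t' < R / 4" for t t'
  proof -
    have "q (of_real t) - q (of_real t') = of_real (h t / t ^ m - h t' / t' ^ m)"
      using hq[of t] hq[of t'] that by simp
    then have "\<bar>h t / t ^ m - h t' / t' ^ m\<bar> = cmod (q (of_real t) - q (of_real t'))"
      by (simp only: norm_of_real)
    also have "\<dots> \<le> 4 * Q / R * cmod (of_real t - of_real t')"
      by (rule lip) (use that in auto)
    also have "cmod (of_real t - of_real t') = \<bar>t - t'\<bar>"
      by (metis norm_of_real of_real_diff)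
    finally show ?thesis .
  qed
  then show "0 < t \<Longrightarrow> t < R / 4 \<Longrightarrow> 0 < t' \<Longrightarrow> t' < R / 4 \<Longrightarrow>
           \<bar>h t / t ^ m - h t' / t' ^ m\<bar> \<le> 4 * Q / R * \<bar>t - t'\<bar>" .
  show "\<bar>h t / t ^ m - l\<bar> \<le> 4 * Q / R * t"
    if t: "0 < t" "t < R / 4" and lim: "((\<lambda>t. h t / t ^ m) \<longlongrightarrow> l) (at_right 0)"
  proof (rule tendsto_le[OF trivial_limit_at_right_real])
    show "((\<lambda>t'. \<bar>h t / t ^ m - h t' / t' ^ m\<bar>) \<longlongrightarrow> \<bar>h t / t ^ m - l\<bar>) (at_right 0)"
      by (intro tendsto_intros lim)
    show "((\<lambda>t'. 4 * Q / R * \<bar>t - t'\<bar>) \<longlongrightarrow> 4 * Q / R * t) (at_right 0)"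
      using t by (auto intro!: tendsto_eq_intros)
    show "\<forall>\<^sub>F t' in at_right 0. \<bar>h t / t ^ m - h t' / t' ^ m\<bar> \<le> 4 * Q / R * \<bar>t - t'\<bar>"
      by (rule eventually_mono[OF eventually_at_right_real[of 0 "R / 4"]])
         (use R in simp, rule 2, use t in auto)
  qed
qed

lemma real_derivative_of_complex_derivative:
  fixes G :: "complex \<Rightarrow> complex" and g :: "real \<Rightarrow> real"
  assumes G: "(G has_field_derivative d) (at (of_real x))"
    and eq: "\<forall>\<^sub>F u in nhds x. G (of_real u) = of_real (g u)"
  shows "(g has_real_derivative Re d) (at x)" "d = of_real (Re d)" "deriv g x = Re d"
proof -
  have "((\<lambda>u. G (of_real u)) has_vector_derivative d) (at x)"
    by (rule has_vector_derivative_real_field[OF G])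
  moreover obtain S where "open S" "x \<in> S" "\<And>u. u \<in> S \<Longrightarrow> G (of_real u) = of_real (g u)"
    using eq unfolding eventually_nhds by blast
  ultimately have v: "((\<lambda>u. of_real (g u) :: complex) has_vector_derivative d) (at x)"
    by (rule has_vector_derivative_transform_within_open)
  have "((\<lambda>u. Re (of_real (g u))) has_vector_derivative Re d) (at x)"
    by (rule bounded_linear.has_vector_derivative[OF bounded_linear_Re v])
  then show g: "(g has_real_derivative Re d) (at x)"
    by (simp add: has_real_derivative_iff_has_vector_derivative)
  have "((\<lambda>u. Im (of_real (g u))) has_vector_derivative Im d) (at x)"
    by (rule bounded_linear.has_vector_derivative[OF bounded_linear_Im v])
  then have "((\<lambda>u. 0 :: real) has_vector_derivative Im d) (at x)" by simp
  from vector_derivative_unique_at[OF this has_vector_derivative_const] have "Im d = 0" .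
  then show "d = of_real (Re d)" by (simp add: complex_eq_iff)
  show "deriv g x = Re d" by (rule DERIV_imp_deriv[OF g])
qed

section \<open>Double power series\<close>

abbreviation idx1 :: "nat \<Rightarrow> nat" where "idx1 k \<equiv> fst (prod_decode k)"
abbreviation idx2 :: "nat \<Rightarrow> nat" where "idx2 k \<equiv> snd (prod_decode k)"

text \<open>
The double series is summed along the Cantor enumeration of pairs, which makes the theory of
ordinary series applicable; all series considered converge absolutely.
\<close>

definition double_term :: "(nat \<Rightarrow> nat \<Rightarrow> real) \<Rightarrow> complex \<Rightarrow> complex \<Rightarrow> nat \<Rightarrow> complex" where
  "double_term c a b k = of_real (c (idx1 k) (idx2 k)) * a ^ idx1 k * b ^ idx2 k"

definition double_series :: "(nat \<Rightarrow> nat \<Rightarrow> real) \<Rightarrow> complex \<Rightarrow> complex \<Rightarrow> complex" where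
  "double_series c a b = (\<Sum>k. double_term c a b k)"

definition double_majorant :: "(nat \<Rightarrow> nat \<Rightarrow> real) \<Rightarrow> real \<Rightarrow> nat \<Rightarrow> real" where
  "double_majorant c r k = \<bar>c (idx1 k) (idx2 k)\<bar> * r ^ (idx1 k + idx2 k)"

lemma norm_double_term_le:
  assumes "cmod a \<le> r" "cmod b \<le> r"
  shows "cmod (double_term c a b k) \<le> double_majorant c r k"
proof -
  have "cmod a ^ idx1 k * cmod b ^ idx2 k \<le> r ^ idx1 k * r ^ idx2 k"
    using assms order_trans[OF norm_ge_zero assms(1)] by (intro mult_mono power_mono) auto
  then show ?thesis
    by (simp add: double_term_def double_majorant_def norm_mult norm_power power_add mult_left_mono mult.assoc)
qed

lemma double_term_sums:
  assumes "summable (double_majorant c r)" "cmod a \<le> r" "cmod b \<le> r"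
  shows "double_term c a b sums double_series c a b"
  unfolding double_series_def
  by (rule summable_sums, rule summable_norm_cancel, rule summable_comparison_test'[OF assms(1)])
     (simp add: norm_double_term_le assms)

text \<open>
If all terms of degree below \<open>m\<close> vanish, shrinking the polydisc from \<open>r\<close> to \<open>s\<close> gains the factor
\<open>(s / r) ^ m\<close>. With \<open>m = 0\<close> this bounds the sum by its majorant.
\<close>

lemma norm_double_series_le:
  assumes sm: "summable (double_majorant c r)" and r: "0 < r"
    and vanish: "\<And>i j. i + j < m \<Longrightarrow> c i j = 0"
    and ab: "cmod a \<le> s" "cmod b \<le> s" "s \<le> r"
  shows "cmod (double_series c a b) \<le> (s / r) ^ m * suminf (double_majorant c r)"
proof -
  have s: "0 \<le> s" using order_trans[OF norm_ge_zero ab(1)] .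
  have le: "cmod (double_term c a b k) \<le> (s / r) ^ m * double_majorant c r k" for k
  proof (cases "idx1 k + idx2 k < m")
    case True
    then show ?thesis by (simp add: double_term_def double_majorant_def vanish)
  next
    case False
    have "cmod (double_term c a b k) \<le> double_majorant c s k"
      by (rule norm_double_term_le) (use ab in auto)
    also have "\<dots> = (s / r) ^ (idx1 k + idx2 k) * double_majorant c r k"
      using r by (simp add: double_majorant_def power_divide)
    also have "\<dots> \<le> (s / r) ^ m * double_majorant c r k"
      using False s r ab(3)
      by (intro mult_right_mono power_decreasing) (auto simp: double_majorant_def)
    finally show ?thesis .
  qed
  have "cmod (double_series c a b) \<le> (\<Sum>k. (s / r) ^ m * double_majorant c r k)"
    unfolding double_series_def by (rule norm_suminf_le[OF le summable_mult[OF sm]])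
  also have "\<dots> = (s / r) ^ m * suminf (double_majorant c r)" by (rule suminf_mult[OF sm])
  finally show ?thesis .
qed

lemma double_series_diff:
  assumes "summable (double_majorant c r)" "summable (double_majorant c' r)" "cmod a \<le> r" "cmod b \<le> r"
  shows "double_series c a b - double_series c' a b = double_series (\<lambda>i j. c i j - c' i j) a b"
    and "summable (double_majorant (\<lambda>i j. c i j - c' i j) r)"
proof -
  have r: "r \<ge> 0" using order_trans[OF norm_ge_zero assms(3)] .
  have "norm (double_majorant (\<lambda>i j. c i j - c' i j) r k) \<le> double_majorant c r k + double_majorant c' r k" for k
    using r by (auto simp: double_majorant_def abs_mult distrib_right[symmetric] intro!: mult_right_mono)
  then show sm: "summable (double_majorant (\<lambda>i j. c i j - c' i j) r)"
    by (intro summable_comparison_test'[OF summable_add[OF assms(1,2)]])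
  have "(\<lambda>k. double_term c a b k - double_term c' a b k) sums (double_series c a b - double_series c' a b)"
    by (intro sums_diff double_term_sums[OF _ assms(3,4)] assms)
  also have "(\<lambda>k. double_term c a b k - double_term c' a b k) = double_term (\<lambda>i j. c i j - c' i j) a b"
    by (simp add: fun_eq_iff double_term_def algebra_simps)
  finally show "double_series c a b - double_series c' a b = double_series (\<lambda>i j. c i j - c' i j) a b"
    using double_term_sums[OF sm assms(3,4)] sums_unique2 by blast
qed

lemma continuous_on_double_series:
  assumes "summable (double_majorant c r)"
  shows "continuous_on {(a, b). cmod a \<le> r \<and> cmod b \<le> r} (\<lambda>(a, b). double_series c a b)"
proof (rule uniform_limit_theorem[where F = sequentially])
  have "uniform_limit {(a, b). cmod a \<le> r \<and> cmod b \<le> r}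
      (\<lambda>n (a, b). \<Sum>k<n. double_term c a b k) (\<lambda>(a, b). double_series c a b) sequentially"
    using Weierstrass_m_test[of "{(a, b). cmod a \<le> r \<and> cmod b \<le> r}"
        "\<lambda>k (a, b). double_term c a b k" "double_majorant c r", OF _ assms]
    by (simp add: double_series_def case_prod_unfold norm_double_term_le)
  then show "uniform_limit {(a, b). cmod a \<le> r \<and> cmod b \<le> r}
      (\<lambda>n (a, b). \<Sum>k<n. double_term c a b k) (\<lambda>(a, b). double_series c a b) sequentially" .
  show "\<forall>\<^sub>F n in sequentially. continuous_on {(a, b). cmod a \<le> r \<and> cmod b \<le> r}
      (\<lambda>(a, b). \<Sum>k<n. double_term c a b k)"
    unfolding double_term_def case_prod_unfold by (intro always_eventually allI continuous_intros)
qed auto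

definition "partial1 c a b = deriv (\<lambda>a. double_series c a b) a"
definition "partial2 c a b = deriv (\<lambda>b. double_series c a b) b"

text \<open>
Termwise differentiation along an arbitrary pair of holomorphic functions. Taking one of them
constant gives the partial derivatives, and comparing the series then gives the chain rule
without a theory of holomorphic functions of two variables.
\<close>

lemma double_series_chain_terms:
  fixes A B A' B' :: "complex \<Rightarrow> complex"
  assumes sm: "summable (double_majorant c r)" and S: "open S"
    and A: "\<And>z. z \<in> S \<Longrightarrow> (A has_field_derivative A' z) (at z)" "\<And>z. z \<in> S \<Longrightarrow> cmod (A z) \<le> r"
    and B: "\<And>z. z \<in> S \<Longrightarrow> (B has_field_derivative B' z) (at z)" "\<And>z. z \<in> S \<Longrightarrow> cmod (B z) \<le> r"
    and z: "z \<in> S"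
  shows "\<exists>d. ((\<lambda>z. double_series c (A z) (B z)) has_field_derivative d) (at z) \<and>
    (\<lambda>k. A' z * (complex_of_real (c (idx1 k) (idx2 k)) * of_nat (idx1 k) * A z ^ (idx1 k - 1) * B z ^ idx2 k)
       + B' z * (complex_of_real (c (idx1 k) (idx2 k)) * of_nat (idx2 k) * A z ^ idx1 k * B z ^ (idx2 k - 1))) sums d"
proof -
  let ?d = "\<lambda>k z. A' z * (complex_of_real (c (idx1 k) (idx2 k)) * of_nat (idx1 k) * A z ^ (idx1 k - 1) * B z ^ idx2 k)
       + B' z * (complex_of_real (c (idx1 k) (idx2 k)) * of_nat (idx2 k) * A z ^ idx1 k * B z ^ (idx2 k - 1))"
  have "\<exists>g g'. \<forall>z\<in>S. (\<lambda>k. double_term c (A z) (B z) k) sums g z \<and> (\<lambda>k. ?d k z) sums g' z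
      \<and> (g has_field_derivative g' z) (at z)"
  proof (rule series_and_derivative_comparison_complex[OF S])
    show "((\<lambda>z. double_term c (A z) (B z) k) has_field_derivative ?d k z) (at z)" if "z \<in> S" for k z
      unfolding double_term_def
      by (rule derivative_eq_intros A(1)[OF that] B(1)[OF that] refl | simp add: algebra_simps)+
    show "\<exists>d h. 0 < d \<and> summable h \<and> range h \<subseteq> \<real>\<^sub>\<ge>\<^sub>0 \<and>
        (\<forall>\<^sub>F k in sequentially. \<forall>y\<in>ball z d \<inter> S. cmod (double_term c (A y) (B y) k) \<le> cmod (h k))"
      if "z \<in> S" for z
    proof (intro exI conjI)
      have r: "r \<ge> 0" using order_trans[OF norm_ge_zero A(2)[OF that]] .
      then show "range (\<lambda>k. complex_of_real (double_majorant c r k)) \<subseteq> \<real>\<^sub>\<ge>\<^sub>0"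
        by (auto simp: double_majorant_def)
      show "summable (\<lambda>k. complex_of_real (double_majorant c r k))"
        using sm by (rule summable_of_real)
      show "\<forall>\<^sub>F k in sequentially. \<forall>y\<in>ball z 1 \<inter> S.
          cmod (double_term c (A y) (B y) k) \<le> cmod (complex_of_real (double_majorant c r k))"
        using r by (auto intro!: always_eventually order_trans[OF norm_double_term_le[where r = r]] A(2) B(2))
    qed auto
  qed
  then obtain g g' where g: "\<And>z. z \<in> S \<Longrightarrow> (\<lambda>k. double_term c (A z) (B z) k) sums g z"
    "\<And>z. z \<in> S \<Longrightarrow> (\<lambda>k. ?d k z) sums g' z" "\<And>z. z \<in> S \<Longrightarrow> (g has_field_derivative g' z) (at z)"
    by blast
  have "double_series c (A z) (B z) = g z" if "z \<in> S" for z
    unfolding double_series_def by (rule sums_unique[OF g(1)[OF that], symmetric])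
  then have "((\<lambda>z. double_series c (A z) (B z)) has_field_derivative g' z) (at z)"
    by (intro has_field_derivative_transform_within_open[OF g(3)[OF z] S z]) simp
  then show ?thesis using g(2)[OF z] by blast
qed

lemma partial_sums:
  fixes a b :: complex
  assumes sm: "summable (double_majorant c r)" and ab: "cmod a < r" "cmod b < r"
  shows "((\<lambda>a. double_series c a b) has_field_derivative partial1 c a b) (at a)"
    "(\<lambda>k. complex_of_real (c (idx1 k) (idx2 k)) * of_nat (idx1 k) * a ^ (idx1 k - 1) * b ^ idx2 k) sums partial1 c a b"
    "((\<lambda>b. double_series c a b) has_field_derivative partial2 c a b) (at b)"
    "(\<lambda>k. complex_of_real (c (idx1 k) (idx2 k)) * of_nat (idx2 k) * a ^ idx1 k * b ^ (idx2 k - 1)) sums partial2 c a b"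
proof -
  have "\<exists>d. ((\<lambda>a. double_series c a b) has_field_derivative d) (at a) \<and>
      (\<lambda>k. 1 * (complex_of_real (c (idx1 k) (idx2 k)) * of_nat (idx1 k) * a ^ (idx1 k - 1) * b ^ idx2 k)
         + 0 * (complex_of_real (c (idx1 k) (idx2 k)) * of_nat (idx2 k) * a ^ idx1 k * b ^ (idx2 k - 1))) sums d"
    by (rule double_series_chain_terms[OF sm, of "ball 0 r"]) (use ab in \<open>auto intro!: derivative_eq_intros\<close>)
  then show "((\<lambda>a. double_series c a b) has_field_derivative partial1 c a b) (at a)"
    "(\<lambda>k. complex_of_real (c (idx1 k) (idx2 k)) * of_nat (idx1 k) * a ^ (idx1 k - 1) * b ^ idx2 k) sums partial1 c a b"
    unfolding partial1_def by (auto dest: DERIV_imp_deriv)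
  have "\<exists>d. ((\<lambda>b. double_series c a b) has_field_derivative d) (at b) \<and>
      (\<lambda>k. 0 * (complex_of_real (c (idx1 k) (idx2 k)) * of_nat (idx1 k) * a ^ (idx1 k - 1) * b ^ idx2 k)
         + 1 * (complex_of_real (c (idx1 k) (idx2 k)) * of_nat (idx2 k) * a ^ idx1 k * b ^ (idx2 k - 1))) sums d"
    by (rule double_series_chain_terms[OF sm, of "ball 0 r"]) (use ab in \<open>auto intro!: derivative_eq_intros\<close>)
  then show "((\<lambda>b. double_series c a b) has_field_derivative partial2 c a b) (at b)"
    "(\<lambda>k. complex_of_real (c (idx1 k) (idx2 k)) * of_nat (idx2 k) * a ^ idx1 k * b ^ (idx2 k - 1)) sums partial2 c a b"
    unfolding partial2_def by (auto dest: DERIV_imp_deriv)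
qed

lemma double_series_chain:
  fixes A B A' B' :: "complex \<Rightarrow> complex"
  assumes sm: "summable (double_majorant c r)" and S: "open S"
    and A: "\<And>z. z \<in> S \<Longrightarrow> (A has_field_derivative A' z) (at z)" "\<And>z. z \<in> S \<Longrightarrow> cmod (A z) < r"
    and B: "\<And>z. z \<in> S \<Longrightarrow> (B has_field_derivative B' z) (at z)" "\<And>z. z \<in> S \<Longrightarrow> cmod (B z) < r"
    and z: "z \<in> S"
  shows "((\<lambda>z. double_series c (A z) (B z)) has_field_derivative
      A' z * partial1 c (A z) (B z) + B' z * partial2 c (A z) (B z)) (at z)"
proof -
  obtain d where d: "((\<lambda>z. double_series c (A z) (B z)) has_field_derivative d) (at z)"
    "(\<lambda>k. A' z * (complex_of_real (c (idx1 k) (idx2 k)) * of_nat (idx1 k) * A z ^ (idx1 k - 1) * B z ^ idx2 k)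
       + B' z * (complex_of_real (c (idx1 k) (idx2 k)) * of_nat (idx2 k) * A z ^ idx1 k * B z ^ (idx2 k - 1))) sums d"
    using double_series_chain_terms[OF sm S A(1) less_imp_le[OF A(2)] B(1) less_imp_le[OF B(2)] z] by blast
  have "(\<lambda>k. A' z * (complex_of_real (c (idx1 k) (idx2 k)) * of_nat (idx1 k) * A z ^ (idx1 k - 1) * B z ^ idx2 k)
       + B' z * (complex_of_real (c (idx1 k) (idx2 k)) * of_nat (idx2 k) * A z ^ idx1 k * B z ^ (idx2 k - 1)))
      sums (A' z * partial1 c (A z) (B z) + B' z * partial2 c (A z) (B z))"
    by (intro sums_add sums_mult partial_sums(2,4)[OF sm A(2)[OF z] B(2)[OF z]])
  with d show ?thesis using sums_unique2 by blast
qed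

lemma double_series_compose_holomorphic:
  assumes sm: "summable (double_majorant c r)" and S: "open S"
    and A: "A holomorphic_on S" "\<And>z. z \<in> S \<Longrightarrow> cmod (A z) < r"
    and B: "B holomorphic_on S" "\<And>z. z \<in> S \<Longrightarrow> cmod (B z) < r"
  shows "(\<lambda>z. double_series c (A z) (B z)) holomorphic_on S"
  unfolding holomorphic_on_open[OF S]
  using double_series_chain[OF sm S holomorphic_derivI[OF A(1) S] A(2) holomorphic_derivI[OF B(1) S] B(2)]
  by blast

section \<open>Cauchy estimates and the implicit function\<close>

lemma norm_partial2_le:
  assumes sm: "summable (double_majorant c r)" and vanish: "\<And>i j. i + j < m \<Longrightarrow> c i j = 0"
    and s: "0 < s" "2 * s < r" and ab: "cmod a \<le> s" "cmod b \<le> s"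
  shows "cmod (partial2 c a b) \<le> (2 * s / r) ^ m * suminf (double_majorant c r) / s"
proof -
  have cball: "cmod z \<le> 2 * s" if "z \<in> cball b s" for z
    using that ab norm_triangle_ineq[of b "z - b"] by (auto simp: dist_norm norm_minus_commute)
  have "\<exists>d. (double_series c a has_field_derivative d) (at z within cball b s)" if z: "z \<in> cball b s" for z
    by (rule exI, rule has_field_derivative_at_within, rule partial_sums(3)[OF sm]) (use cball[OF z] ab s in auto)
  then have hol: "double_series c a holomorphic_on cball b s"
    by (simp add: holomorphic_on_def field_differentiable_def)
  have "cmod ((deriv ^^ 1) (double_series c a) b) \<le> fact 1 * ((2 * s / r) ^ m * suminf (double_majorant c r)) / s ^ 1"
  proof (rule Cauchy_inequality[OF _ holomorphic_on_imp_continuous_on[OF hol] s(1)])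
    fix z assume "cmod (b - z) = s"
    then have "cmod z \<le> 2 * s" by (intro cball) (simp add: dist_norm)
    then show "cmod (double_series c a z) \<le> (2 * s / r) ^ m * suminf (double_majorant c r)"
      by (intro norm_double_series_le[OF sm _ vanish]) (use ab s in auto)
  qed (rule holomorphic_on_subset[OF hol ball_subset_cball])
  then show ?thesis by (simp add: partial2_def)
qed

lemma double_series_lipschitz:
  assumes sm: "summable (double_majorant c r)" and vanish: "\<And>i j. i + j < m \<Longrightarrow> c i j = 0"
    and s: "0 < s" "2 * s < r" and ab: "cmod a \<le> s" "cmod b \<le> s" "cmod b' \<le> s"
  shows "cmod (double_series c a b - double_series c a b') \<le> (2 * s / r) ^ m * suminf (double_majorant c r) / s * cmod (b - b')"
proof (rule field_differentiable_bound[of "cball 0 s"])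
  fix z :: complex assume z: "z \<in> cball 0 s"
  show "(double_series c a has_field_derivative partial2 c a z) (at z within cball 0 s)"
    by (rule has_field_derivative_at_within, rule partial_sums(3)[OF sm]) (use z ab s in auto)
  show "cmod (partial2 c a z) \<le> (2 * s / r) ^ m * suminf (double_majorant c r) / s"
    by (rule norm_partial2_le[OF sm vanish s]) (use z ab in auto)
qed (use ab in auto)

text \<open>
Cauchy's inequality bounds the second derivative in \<open>b\<close> on the disc of radius \<open>s\<close> around \<open>b\<close>,
whose points have distance more than \<open>s\<close> to the boundary of the polydisc.
\<close>

lemma double_series_taylor2:
  assumes sm: "summable (double_majorant c r)" and s: "0 < s" "3 * s < r"
    and ab: "cmod a \<le> s" "cmod b \<le> s" "cmod w \<le> s"
  shows "cmod (double_series c a (b + w) - double_series c a b - w * partial2 c a b)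
    \<le> 2 * suminf (double_majorant c r) / s\<^sup>2 * (cmod w)\<^sup>2"
proof -
  have hol: "double_series c a holomorphic_on ball 0 r"
    unfolding holomorphic_on_open[OF open_ball]
    using partial_sums(3)[OF sm, of a] ab s by (auto intro!: exI)
  have b2: "cmod z \<le> 2 * s" if "z \<in> cball b s" for z
    using that ab norm_triangle_ineq[of b "z - b"] by (auto simp: dist_norm norm_minus_commute)
  have bound: "cmod ((deriv ^^ 2) (double_series c a) z) \<le> 2 * suminf (double_majorant c r) / s\<^sup>2"
    if z: "z \<in> cball b s" for z
  proof -
    have c3: "cmod x \<le> 3 * s" if "x \<in> cball z s" for x
      using that b2[OF z] norm_triangle_ineq[of z "x - z"] by (auto simp: dist_norm norm_minus_commute)
    have hol': "double_series c a holomorphic_on cball z s"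
      by (rule holomorphic_on_subset[OF hol]) (use c3 s in \<open>force simp: mem_ball\<close>)
    have "cmod ((deriv ^^ 2) (double_series c a) z) \<le> fact 2 * suminf (double_majorant c r) / s ^ 2"
    proof (rule Cauchy_inequality[OF _ holomorphic_on_imp_continuous_on[OF hol'] s(1)])
      show "cmod (double_series c a x) \<le> suminf (double_majorant c r)" if "cmod (z - x) = s" for x
      proof -
        have "cmod x \<le> 3 * s" by (rule c3) (use that in \<open>auto simp: dist_norm\<close>)
        then show ?thesis
          using norm_double_series_le[OF sm, of 0 a r x] ab s by auto
      qed
    qed (rule holomorphic_on_subset[OF hol' ball_subset_cball])
    then show ?thesis by (simp add: fact_numeral)
  qed
  have "cmod ((deriv ^^ 0) (double_series c a) (b + w)
        - (\<Sum>i\<le>1. (deriv ^^ i) (double_series c a) b * ((b + w) - b) ^ i / fact i))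
      \<le> 2 * suminf (double_majorant c r) / s\<^sup>2 * cmod ((b + w) - b) ^ Suc 1 / fact 1"
  proof (rule complex_Taylor[of "cball b s"])
    fix i :: nat and x :: complex assume x: "x \<in> cball b s" "i \<le> 1"
    have "x \<in> ball 0 r" using b2[OF x(1)] s by auto
    from holomorphic_derivI[OF holomorphic_higher_deriv[OF hol open_ball] open_ball this]
    show "((deriv ^^ i) (double_series c a) has_field_derivative (deriv ^^ Suc i) (double_series c a) x)
        (at x within cball b s)"
      by (auto intro: has_field_derivative_at_within)
  next
    show "cmod ((deriv ^^ Suc 1) (double_series c a) x) \<le> 2 * suminf (double_majorant c r) / s\<^sup>2"
      if "x \<in> cball b s" for x
      using bound[OF that] by (simp add: numeral_2_eq_2)
  qed (use ab s in \<open>auto simp: dist_norm\<close>)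
  then show ?thesis by (simp add: partial2_def power2_eq_square algebra_simps)
qed

text \<open>
By the quadratic order of the series, its derivative in the second variable is at most
\<open>4 * M * \<epsilon> / r\<^sup>2\<close> on the polydisc of radius \<open>\<epsilon>\<close>, where \<open>M\<close> is the sum of the majorant.
\<close>

lemma double_series_contraction:
  assumes sm: "summable (double_majorant c r)" and vanish: "\<And>i j. i + j < 2 \<Longrightarrow> c i j = 0"
    and \<epsilon>: "0 < \<epsilon>" "2 * \<epsilon> < r" "8 * suminf (double_majorant c r) * \<epsilon> \<le> r\<^sup>2"
    and ab: "cmod a \<le> \<epsilon>" "cmod b \<le> \<epsilon>" "cmod b' \<le> \<epsilon>"
  shows "cmod (double_series c a b - double_series c a b') \<le> 1 / 2 * cmod (b - b')"
proof -
  define M where "M = suminf (double_majorant c r)"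
  have r: "r > 0" using \<epsilon> by simp
  have "M * \<epsilon> / r\<^sup>2 \<le> 1 / 8" using \<epsilon>(3) r by (simp add: M_def field_simps)
  moreover have "(2 * \<epsilon> / r)\<^sup>2 * M / \<epsilon> = 4 * (M * \<epsilon> / r\<^sup>2)"
    using \<epsilon>(1) by (simp add: power_divide power2_eq_square)
  ultimately have "(2 * \<epsilon> / r)\<^sup>2 * M / \<epsilon> \<le> 1 / 2" by linarith
  then have "(2 * \<epsilon> / r)\<^sup>2 * M / \<epsilon> * cmod (b - b') \<le> 1 / 2 * cmod (b - b')"
    by (rule mult_right_mono) simp
  moreover have "cmod (double_series c a b - double_series c a b') \<le> (2 * \<epsilon> / r)\<^sup>2 * M / \<epsilon> * cmod (b - b')"
    unfolding M_def by (rule double_series_lipschitz[OF sm vanish \<epsilon>(1,2) ab])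
  ultimately show ?thesis by linarith
qed

text \<open>
Iteration of the contraction \<open>y \<mapsto> - X z y\<close> from \<open>0\<close>. The iterates are holomorphic in \<open>z\<close> and
converge geometrically, uniformly in \<open>z\<close>, so the limit is holomorphic.
\<close>

lemma complex_implicit_function:
  assumes sm: "summable (double_majorant c r)" and vanish: "\<And>i j. i + j < 2 \<Longrightarrow> c i j = 0"
    and \<epsilon>: "0 < \<epsilon>" "2 * \<epsilon> < r" "8 * suminf (double_majorant c r) * \<epsilon> \<le> r\<^sup>2"
  obtains Fc where "Fc holomorphic_on ball 0 \<epsilon>"
    "\<And>z. z \<in> ball 0 \<epsilon> \<Longrightarrow> Fc z + double_series c z (Fc z) = 0"
    "\<And>z. z \<in> ball 0 \<epsilon> \<Longrightarrow> cmod (Fc z) \<le> cmod z"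
    "\<And>z y. z \<in> ball 0 \<epsilon> \<Longrightarrow> cmod y \<le> \<epsilon> \<Longrightarrow> y + double_series c z y = 0 \<Longrightarrow> y = Fc z"
proof -
  define M where "M = suminf (double_majorant c r)"
  have r: "r > 0" using \<epsilon> by simp
  have M0: "M \<ge> 0" unfolding M_def by (rule suminf_nonneg[OF sm]) (use r in \<open>auto simp: double_majorant_def\<close>)
  have M: "M * \<epsilon> / r\<^sup>2 \<le> 1 / 8" using \<epsilon>(3) r by (simp add: M_def field_simps)
  have small: "cmod (double_series c a b) \<le> s / 8" if "cmod a \<le> s" "cmod b \<le> s" "s \<le> \<epsilon>" for a b s
  proof -
    have s: "0 \<le> s" using order_trans[OF norm_ge_zero that(1)] .
    have "cmod (double_series c a b) \<le> (s / r)\<^sup>2 * M"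
      unfolding M_def by (rule norm_double_series_le[OF sm r vanish that(1,2)]) (use that \<epsilon> in auto)
    also have "\<dots> = s * (M * s / r\<^sup>2)" by (simp add: power_divide power2_eq_square)
    also have "M * s / r\<^sup>2 \<le> M * \<epsilon> / r\<^sup>2"
      using M0 that r by (intro divide_right_mono mult_left_mono) auto
    also note M
    finally show ?thesis using s by (simp add: mult_left_mono)
  qed
  note contract = double_series_contraction[OF sm vanish \<epsilon>]
  define G where "G = rec_nat (\<lambda>z. 0) (\<lambda>_ g z. - double_series c z (g z))"
  have G: "G 0 = (\<lambda>z. 0)" "G (Suc k) = (\<lambda>z. - double_series c z (G k z))" for k by (simp_all add: G_def)
  have Gb: "cmod (G k z) \<le> \<epsilon>" if "z \<in> ball 0 \<epsilon>" for k z
  proof (induction k)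
    case (Suc k)
    then show ?case using small[of z \<epsilon> "G k z"] that \<epsilon> by (simp add: G)
  qed (use \<epsilon> in \<open>simp add: G\<close>)
  have Ghol: "G k holomorphic_on ball 0 \<epsilon>" for k
  proof (induction k)
    case (Suc k)
    show ?case unfolding G
      by (intro holomorphic_on_minus double_series_compose_holomorphic[OF sm] Suc)
         (use Gb[of _ k] \<epsilon> in \<open>force intro: holomorphic_intros order_le_less_trans\<close>)+
  qed (simp add: G)
  have step: "cmod (G (Suc k) z - G k z) \<le> \<epsilon> * (1 / 2) ^ k" if z: "z \<in> ball 0 \<epsilon>" for k z
  proof (induction k)
    case 0
    then show ?case using Gb[OF z, of 1] by (simp add: G)
  next
    case (Suc k)
    have "cmod (G (Suc (Suc k)) z - G (Suc k) z) = cmod (double_series c z (G (Suc k) z) - double_series c z (G k z))"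
    proof -
      define p q where "p = double_series c z (G k z)" and "q = double_series c z (G (Suc k) z)"
      have "G (Suc k) z = - p" "G (Suc (Suc k)) z = - q" by (simp_all only: G(2) p_def q_def)
      then have "cmod (G (Suc (Suc k)) z - G (Suc k) z) = cmod (q - p)" by (simp add: norm_minus_commute)
      then show ?thesis by (simp only: p_def q_def)
    qed
    also have "\<dots> \<le> 1 / 2 * cmod (G (Suc k) z - G k z)"
      by (rule contract) (use z Gb in auto)
    also have "\<dots> \<le> 1 / 2 * (\<epsilon> * (1 / 2) ^ k)" using Suc by (intro mult_left_mono) auto
    finally show ?case by simp
  qed
  define Fc where "Fc = (\<lambda>z. \<Sum>k. G (Suc k) z - G k z)"
  have telescope: "(\<Sum>k<n. G (Suc k) z - G k z) = G n z" for n z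
    using sum_lessThan_telescope[of "\<lambda>k. G k z" n] by (simp add: G(1))
  have "uniform_limit (ball 0 \<epsilon>) (\<lambda>n z. \<Sum>k<n. G (Suc k) z - G k z) Fc sequentially"
    unfolding Fc_def
    by (rule Weierstrass_m_test[where M = "\<lambda>k. \<epsilon> * (1 / 2) ^ k"])
       (use step in \<open>auto intro!: summable_mult summable_geometric\<close>)
  then have unif: "uniform_limit (ball 0 \<epsilon>) G Fc sequentially"
    by (simp only: telescope)
  have hol: "Fc holomorphic_on ball 0 \<epsilon>"
  proof (rule holomorphic_uniform_sequence[OF open_ball Ghol])
    fix z :: complex assume "z \<in> ball 0 \<epsilon>"
    then obtain e where "e > 0" "cball z e \<subseteq> ball 0 \<epsilon>"
      using open_contains_cball[THEN iffD1, OF open_ball] by blast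
    then show "\<exists>e>0. cball z e \<subseteq> ball 0 \<epsilon> \<and> uniform_limit (cball z e) G Fc sequentially"
      using uniform_limit_on_subset[OF unif] by blast
  qed
  have lim: "(\<lambda>k. G k z) \<longlonglongrightarrow> Fc z" if "z \<in> ball 0 \<epsilon>" for z
    using tendsto_uniform_limitI[OF unif that] .
  have Fb: "cmod (Fc z) \<le> \<epsilon>" if "z \<in> ball 0 \<epsilon>" for z
    by (rule tendsto_upperbound[OF tendsto_norm[OF lim[OF that]]]) (use Gb[OF that] in auto)
  have eq: "Fc z + double_series c z (Fc z) = 0" if z: "z \<in> ball 0 \<epsilon>" for z
  proof -
    have "(\<lambda>k. double_series c z (G k z) - double_series c z (Fc z)) \<longlonglongrightarrow> 0"
    proof (rule Lim_null_comparison)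
      show "\<forall>\<^sub>F k in sequentially. cmod (double_series c z (G k z) - double_series c z (Fc z))
          \<le> 1 / 2 * cmod (G k z - Fc z)"
        using contract[of z] Gb[OF z] Fb[OF z] z by auto
      show "(\<lambda>k. 1 / 2 * cmod (G k z - Fc z)) \<longlonglongrightarrow> 0"
        using lim[OF z] by (auto intro!: tendsto_eq_intros)
    qed
    then have "(\<lambda>k. - double_series c z (G k z)) \<longlonglongrightarrow> - double_series c z (Fc z)"
      by (rule tendsto_minus[OF LIM_zero_cancel])
    moreover have "(\<lambda>k. - double_series c z (G k z)) \<longlonglongrightarrow> Fc z"
      using LIMSEQ_Suc[OF lim[OF z]] by (simp add: G)
    ultimately have "Fc z = - double_series c z (Fc z)" by (rule LIMSEQ_unique[rotated])
    then show ?thesis by (metis add.left_inverse)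
  qed
  have le: "cmod (Fc z) \<le> cmod z" if z: "z \<in> ball 0 \<epsilon>" for z
  proof (rule ccontr)
    assume *: "\<not> cmod (Fc z) \<le> cmod z"
    have "cmod (Fc z) = cmod (double_series c z (Fc z))"
      using eq[OF z] by (metis add_eq_0_iff norm_minus_cancel)
    also have "\<dots> \<le> cmod (Fc z) / 8" by (rule small) (use * Fb[OF z] in auto)
    finally show False using * norm_ge_zero[of z] by linarith
  qed
  have uniq: "y = Fc z" if z: "z \<in> ball 0 \<epsilon>" and y: "cmod y \<le> \<epsilon>" "y + double_series c z y = 0" for z y
  proof -
    have "y - Fc z = double_series c z (Fc z) - double_series c z y"
      using y(2) eq[OF z] by (metis add_diff_cancel_left' diff_add_cancel diff_diff_add diff_eq_eq add.commute)
    then have "cmod (y - Fc z) \<le> 1 / 2 * cmod (Fc z - y)"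
      using contract[of z "Fc z" y] Fb[OF z] y z by auto
    then show ?thesis by (simp add: norm_minus_commute)
  qed
  show ?thesis using that hol eq le uniq by blast
qed

section \<open>The system near the curve of vertical tangents\<close>

text \<open>
One system of the family, for a fixed parameter. The coefficient arrays are those of the
expansions at the origin, and the radius \<open>r\<close> is kept variable so that it can be shared by two
systems.
\<close>

locale nilpotent_germ =
  fixes X Y :: "real \<Rightarrow> real \<Rightarrow> real" and F :: "real \<Rightarrow> real"
    and cX cY :: "nat \<Rightarrow> nat \<Rightarrow> real" and r :: real
  assumes r: "r > 0"
    and summable_X: "summable (double_majorant cX r)" and summable_Y: "summable (double_majorant cY r)"
    and X_eq: "\<And>x y. \<bar>x\<bar> \<le> r \<Longrightarrow> \<bar>y\<bar> \<le> r \<Longrightarrow> double_series cX (of_real x) (of_real y) = of_real (X x y)"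
    and Y_eq: "\<And>x y. \<bar>x\<bar> \<le> r \<Longrightarrow> \<bar>y\<bar> \<le> r \<Longrightarrow> double_series cY (of_real x) (of_real y) = of_real (Y x y)"
    and order_X: "\<And>i j. i + j < 2 \<Longrightarrow> cX i j = 0"
    and order_Y: "\<And>i j. i + j < 2 \<Longrightarrow> cY i j = 0"
    and F0: "F 0 = 0" "isCont F 0" and F_eq: "\<forall>\<^sub>F x in nhds 0. F x + X x (F x) = 0"

lemma partial_of_real:
  assumes sm: "summable (double_majorant c r)"
    and eq: "\<And>x y. \<bar>x\<bar> \<le> r \<Longrightarrow> \<bar>y\<bar> \<le> r \<Longrightarrow> double_series c (of_real x) (of_real y) = of_real (Z x y)"
    and xy: "\<bar>x\<bar> < r" "\<bar>y\<bar> < r"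
  shows "partial1 c (of_real x) (of_real y) = of_real (deriv (\<lambda>u. Z u y) x)"
    and "partial2 c (of_real x) (of_real y) = of_real (deriv (\<lambda>u. Z x u) y)"
proof -
  have near: "\<forall>\<^sub>F u in nhds p. \<bar>u\<bar> \<le> r" if "\<bar>p\<bar> < r" for p
  proof -
    have "\<forall>\<^sub>F u in nhds p. u \<in> {-r<..<r}"
      by (rule eventually_nhds_in_open) (use that in auto)
    then show ?thesis by eventually_elim auto
  qed
  have ev1: "\<forall>\<^sub>F u in nhds x. double_series c (of_real u) (of_real y) = of_real (Z u y)"
    using near[OF xy(1)] by eventually_elim (use eq xy in auto)
  have ev2: "\<forall>\<^sub>F u in nhds y. double_series c (of_real x) (of_real u) = of_real (Z x u)"
    using near[OF xy(2)] by eventually_elim (use eq xy in auto)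
  have d: "((\<lambda>a. double_series c a (of_real y)) has_field_derivative partial1 c (of_real x) (of_real y)) (at (of_real x))"
    "((\<lambda>b. double_series c (of_real x) b) has_field_derivative partial2 c (of_real x) (of_real y)) (at (of_real y))"
    using partial_sums(1,3)[OF sm, of "of_real x" "of_real y"] xy by auto
  show "partial1 c (of_real x) (of_real y) = of_real (deriv (\<lambda>u. Z u y) x)"
    using real_derivative_of_complex_derivative(2,3)[OF d(1) ev1] by simp
  show "partial2 c (of_real x) (of_real y) = of_real (deriv (\<lambda>u. Z x u) y)"
    using real_derivative_of_complex_derivative(2,3)[OF d(2) ev2] by simp
qed

context nilpotent_germ
begin

definition U :: "real \<Rightarrow> real \<Rightarrow> real" where
  "U x w = F x + w + X x (F x + w)"

definition V :: "real \<Rightarrow> real \<Rightarrow> real" where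
  "V x w = Y x (F x + w) - deriv F x * U x w"

text \<open>
A radius \<open>\<epsilon>\<close> on which \<open>F\<close> extends to the holomorphic function \<open>Fc\<close>, with enough room for the
Cauchy estimates and for the contraction.
\<close>

definition branch :: "real \<Rightarrow> (complex \<Rightarrow> complex) \<Rightarrow> bool" where
  "branch \<epsilon> Fc \<longleftrightarrow> 0 < \<epsilon> \<and> \<epsilon> \<le> 1 \<and> 8 * \<epsilon> < r \<and> 8 * suminf (double_majorant cX r) * \<epsilon> \<le> r\<^sup>2 \<and>
     Fc holomorphic_on ball 0 \<epsilon> \<and>
     (\<forall>z\<in>ball 0 \<epsilon>. Fc z + double_series cX z (Fc z) = 0 \<and> cmod (Fc z) \<le> cmod z) \<and>
     (\<forall>x. \<bar>x\<bar> < \<epsilon> \<longrightarrow> Fc (of_real x) = of_real (F x))"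

lemma MX_nonneg: "suminf (double_majorant cX r) \<ge> 0" and MY_nonneg: "suminf (double_majorant cY r) \<ge> 0"
  using r by (auto intro!: suminf_nonneg summable_X summable_Y simp: double_majorant_def)

lemma branch_smaller:
  assumes "branch \<epsilon> Fc" "0 < \<epsilon>'" "\<epsilon>' \<le> \<epsilon>"
  shows "branch \<epsilon>' Fc"
proof -
  have "ball (0::complex) \<epsilon>' \<subseteq> ball 0 \<epsilon>" using assms(3) by (rule subset_ball)
  moreover have "8 * suminf (double_majorant cX r) * \<epsilon>' \<le> 8 * suminf (double_majorant cX r) * \<epsilon>"
    using assms(3) MX_nonneg by (intro mult_left_mono) auto
  ultimately show ?thesis
    using assms holomorphic_on_subset[of Fc "ball 0 \<epsilon>" "ball 0 \<epsilon>'"] unfolding branch_def by auto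
qed

lemma branch_exists: "\<exists>\<epsilon> Fc. branch \<epsilon> Fc"
proof -
  define M where "M = suminf (double_majorant cX r)"
  define \<epsilon> where "\<epsilon> = min (min 1 (r / 9)) (r\<^sup>2 / (8 * (M + 1)))"
  have M: "M \<ge> 0" using MX_nonneg by (simp add: M_def)
  have "\<epsilon> \<le> r / 9" unfolding \<epsilon>_def by (meson min.cobounded1 min.cobounded2 order_trans)
  moreover have "0 < \<epsilon>" "\<epsilon> \<le> 1" using r M by (simp_all add: \<epsilon>_def)
  ultimately have \<epsilon>: "0 < \<epsilon>" "\<epsilon> \<le> 1" "8 * \<epsilon> < r" using r by linarith+
  have "8 * (M + 1) * \<epsilon> \<le> r\<^sup>2"
  proof -
    have "\<epsilon> \<le> r\<^sup>2 / (8 * (M + 1))" by (simp add: \<epsilon>_def)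
    then show ?thesis using M by (simp add: le_divide_eq mult.commute)
  qed
  moreover have "8 * M * \<epsilon> \<le> 8 * (M + 1) * \<epsilon>" using \<epsilon> by (intro mult_right_mono) auto
  ultimately have M\<epsilon>: "8 * M * \<epsilon> \<le> r\<^sup>2" by linarith
  obtain Fc where Fc: "Fc holomorphic_on ball 0 \<epsilon>"
    "\<And>z. z \<in> ball 0 \<epsilon> \<Longrightarrow> Fc z + double_series cX z (Fc z) = 0"
    "\<And>z. z \<in> ball 0 \<epsilon> \<Longrightarrow> cmod (Fc z) \<le> cmod z"
    "\<And>z y. z \<in> ball 0 \<epsilon> \<Longrightarrow> cmod y \<le> \<epsilon> \<Longrightarrow> y + double_series cX z y = 0 \<Longrightarrow> y = Fc z"
    using complex_implicit_function[OF summable_X order_X \<epsilon>(1) _ M\<epsilon>[unfolded M_def]] \<epsilon> by auto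
  have "(F \<longlongrightarrow> 0) (nhds 0)"
    using F0 by (metis isCont_def tendsto_at_iff_tendsto_nhds)
  then have "\<forall>\<^sub>F x in nhds 0. dist (F x) 0 < \<epsilon>" using \<epsilon>(1) tendstoD by blast
  with F_eq have "\<forall>\<^sub>F x in nhds 0. F x + X x (F x) = 0 \<and> \<bar>F x\<bar> < \<epsilon>"
    by eventually_elim simp
  then obtain e where e: "e > 0" "\<And>x. \<bar>x\<bar> < e \<Longrightarrow> F x + X x (F x) = 0 \<and> \<bar>F x\<bar> < \<epsilon>"
    unfolding eventually_nhds_metric by (auto simp: dist_real_def)
  have real: "Fc (of_real x) = of_real (F x)" if x: "\<bar>x\<bar> < e" "\<bar>x\<bar> < \<epsilon>" for x
  proof (rule Fc(4)[symmetric])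
    have "double_series cX (of_real x) (of_real (F x)) = of_real (X x (F x))"
      by (rule X_eq) (use e(2)[OF x(1)] x \<epsilon> in auto)
    then show "of_real (F x) + double_series cX (of_real x) (of_real (F x)) = 0"
      using e(2)[OF x(1)] by (metis of_real_add of_real_0)
  qed (use x e(2)[OF x(1)] in auto)
  define \<epsilon>' where "\<epsilon>' = min \<epsilon> e"
  have \<epsilon>': "0 < \<epsilon>'" "\<epsilon>' \<le> \<epsilon>" "\<epsilon>' \<le> e" using \<epsilon> e by (auto simp: \<epsilon>'_def)
  have "8 * M * \<epsilon>' \<le> 8 * M * \<epsilon>" using \<epsilon>' M by (intro mult_left_mono) auto
  then have "branch \<epsilon>' Fc"
    unfolding branch_def M_def[symmetric]
    using \<epsilon> \<epsilon>' M\<epsilon> Fc real holomorphic_on_subset[OF Fc(1) subset_ball[OF \<epsilon>'(2)]] by auto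
  then show ?thesis by blast
qed

context
  fixes \<epsilon> :: real and Fc :: "complex \<Rightarrow> complex"
  assumes branch: "branch \<epsilon> Fc"
begin

lemma \<epsilon>: "0 < \<epsilon>" "\<epsilon> \<le> 1" "8 * \<epsilon> < r" "8 * suminf (double_majorant cX r) * \<epsilon> \<le> r\<^sup>2"
  and Fc_holomorphic: "Fc holomorphic_on ball 0 \<epsilon>"
  and Fc_eq: "z \<in> ball 0 \<epsilon> \<Longrightarrow> Fc z + double_series cX z (Fc z) = 0"
  and Fc_le: "z \<in> ball 0 \<epsilon> \<Longrightarrow> cmod (Fc z) \<le> cmod z"
  and Fc_real: "\<bar>x\<bar> < \<epsilon> \<Longrightarrow> Fc (of_real x) = of_real (F x)"
  using branch unfolding branch_def by auto

lemma F_le: "\<bar>x\<bar> < \<epsilon> \<Longrightarrow> \<bar>F x\<bar> \<le> \<bar>x\<bar>"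
  using Fc_le[of "of_real x"] Fc_real[of x] by simp

lemma F_root:
  assumes "\<bar>x\<bar> < \<epsilon>" shows "F x + X x (F x) = 0"
proof -
  have "of_real (F x + X x (F x)) = (0 :: complex)"
    using Fc_eq[of "of_real x"] Fc_real[OF assms] X_eq[of x "F x"] F_le[OF assms] assms \<epsilon> by simp
  then show ?thesis using of_real_eq_0_iff by blast
qed

lemma F_derivative:
  assumes "\<bar>x\<bar> < \<epsilon>"
  shows "(F has_real_derivative deriv F x) (at x)" "deriv Fc (of_real x) = of_real (deriv F x)"
proof -
  have d: "(Fc has_field_derivative deriv Fc (of_real x)) (at (of_real x))"
    by (rule holomorphic_derivI[OF Fc_holomorphic]) (use assms in auto)
  have "\<forall>\<^sub>F u in nhds x. u \<in> {-\<epsilon><..<\<epsilon>}"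
    by (rule eventually_nhds_in_open) (use assms in auto)
  then have ev: "\<forall>\<^sub>F u in nhds x. Fc (of_real u) = of_real (F u)"
    by eventually_elim (auto simp: Fc_real)
  note * = real_derivative_of_complex_derivative[OF d ev]
  show "(F has_real_derivative deriv F x) (at x)" using *(1,3) by simp
  show "deriv Fc (of_real x) = of_real (deriv F x)" using *(2,3) by simp
qed

lemma deriv_Fc_le:
  assumes "cmod z < \<epsilon> / 2" shows "cmod (deriv Fc z) \<le> 2"
proof -
  have sub: "cball z (\<epsilon> / 2) \<subseteq> ball 0 \<epsilon>"
  proof
    fix y assume "y \<in> cball z (\<epsilon> / 2)"
    then show "y \<in> ball 0 \<epsilon>"
      using assms norm_triangle_ineq[of z "y - z"] by (auto simp: dist_norm norm_minus_commute)
  qed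
  have hol: "Fc holomorphic_on cball z (\<epsilon> / 2)" by (rule holomorphic_on_subset[OF Fc_holomorphic sub])
  have "cmod ((deriv ^^ 1) Fc z) \<le> fact 1 * \<epsilon> / (\<epsilon> / 2) ^ 1"
  proof (rule Cauchy_inequality[OF _ holomorphic_on_imp_continuous_on[OF hol]])
    show "cmod (Fc y) \<le> \<epsilon>" if "cmod (z - y) = \<epsilon> / 2" for y
    proof -
      have "y \<in> ball 0 \<epsilon>" using that sub by (auto simp: dist_norm)
      then show ?thesis using Fc_le[of y] by simp
    qed
  qed (use \<epsilon> holomorphic_on_subset[OF hol ball_subset_cball] in auto)
  then show ?thesis using \<epsilon> by simp
qed

lemma deriv_F_le: "\<bar>x\<bar> < \<epsilon> / 2 \<Longrightarrow> \<bar>deriv F x\<bar> \<le> 2"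
  using deriv_Fc_le[of "of_real x"] F_derivative(2)[of x] \<epsilon> by simp

text \<open>
Implicit differentiation. It identifies the coefficient of \<open>w\<close> in \<open>V\<close> with \<open>- f\<close>.
\<close>

lemma F_derivative_eq:
  assumes x: "\<bar>x\<bar> < \<epsilon>"
  shows "deriv F x * (1 + deriv (\<lambda>u. X x u) (F x)) = - deriv (\<lambda>u. X u (F x)) x"
proof -
  have in_r: "z \<in> ball 0 \<epsilon> \<Longrightarrow> cmod z < r" "z \<in> ball 0 \<epsilon> \<Longrightarrow> cmod (Fc z) < r" for z
    using Fc_le[of z] \<epsilon> by auto
  let ?x = "of_real x :: complex"
  have x': "?x \<in> ball 0 \<epsilon>" using x by simp
  have d: "((\<lambda>z. Fc z + double_series cX z (Fc z)) has_field_derivative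
      deriv Fc ?x + (1 * partial1 cX ?x (Fc ?x) + deriv Fc ?x * partial2 cX ?x (Fc ?x))) (at ?x)"
    by (intro DERIV_add holomorphic_derivI[OF Fc_holomorphic open_ball x']
        double_series_chain[OF summable_X open_ball _ in_r(1) holomorphic_derivI[OF Fc_holomorphic open_ball] in_r(2) x'])
       (auto intro!: derivative_eq_intros)
  have "((\<lambda>z. 0) has_field_derivative
      deriv Fc ?x + (1 * partial1 cX ?x (Fc ?x) + deriv Fc ?x * partial2 cX ?x (Fc ?x))) (at ?x)"
    by (rule has_field_derivative_transform_within_open[OF d open_ball x']) (rule Fc_eq)
  from DERIV_unique[OF this DERIV_const]
  have "of_real (deriv F x + (deriv (\<lambda>u. X u (F x)) x + deriv F x * deriv (\<lambda>u. X x u) (F x))) = (0 :: complex)"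
    using partial_of_real[OF summable_X X_eq, of x "F x"] F_le[OF x] x \<epsilon>
    by (simp add: F_derivative(2)[OF x] Fc_real[OF x])
  then have "deriv F x + (deriv (\<lambda>u. X u (F x)) x + deriv F x * deriv (\<lambda>u. X x u) (F x)) = 0"
    using of_real_eq_0_iff by blast
  then show ?thesis by (simp add: algebra_simps)
qed

end

end

section \<open>The straightened system rotates\<close>

lemma real_taylor2:
  assumes sm: "summable (double_majorant c r)"
    and eq: "\<And>x y. \<bar>x\<bar> \<le> r \<Longrightarrow> \<bar>y\<bar> \<le> r \<Longrightarrow> double_series c (of_real x) (of_real y) = of_real (Z x y)"
    and s: "0 < s" "3 * s < r" and xyw: "\<bar>x\<bar> \<le> s" "\<bar>y\<bar> \<le> s" "\<bar>w\<bar> \<le> s"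
  shows "\<bar>Z x (y + w) - Z x y - w * deriv (\<lambda>u. Z x u) y\<bar> \<le> 2 * suminf (double_majorant c r) / s\<^sup>2 * w\<^sup>2"
proof -
  have "double_series c (of_real x) (of_real y + of_real w) = of_real (Z x (y + w))"
    using eq[of x "y + w"] xyw s by simp
  moreover have "double_series c (of_real x) (of_real y) = of_real (Z x y)"
    using eq[of x y] xyw s by simp
  moreover have "partial2 c (of_real x) (of_real y) = of_real (deriv (\<lambda>u. Z x u) y)"
    using partial_of_real(2)[OF sm eq] xyw s by simp
  ultimately have "cmod (of_real (Z x (y + w) - Z x y - w * deriv (\<lambda>u. Z x u) y))
      \<le> 2 * suminf (double_majorant c r) / s\<^sup>2 * (cmod (of_real w))\<^sup>2"
    using double_series_taylor2[OF sm s, of "of_real x" "of_real y" "of_real w"] xyw by simp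
  then show ?thesis by (simp only: norm_of_real power2_abs)
qed

text \<open>
The factor is the determinant divided by the trace of the form, which is below its least
eigenvalue.
\<close>

lemma positive_quadratic_form:
  fixes A B C p q :: real
  assumes "A > 0" "C > 0" "B\<^sup>2 < 4 * A * C"
  shows "(A * C - B\<^sup>2 / 4) / (A + C) > 0"
    and "(A * C - B\<^sup>2 / 4) / (A + C) * (p\<^sup>2 + q\<^sup>2) \<le> A * p\<^sup>2 + B * p * q + C * q\<^sup>2"
proof -
  define k where "k = (A * C - B\<^sup>2 / 4) / (A + C)"
  show "(A * C - B\<^sup>2 / 4) / (A + C) > 0" using assms by simp
  have k: "k * (A + C) = A * C - B\<^sup>2 / 4" using assms by (simp add: k_def)
  have "A * A > 0" "B\<^sup>2 / 4 \<ge> 0" using assms by simp_all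
  then have "k * (A + C) < A * (A + C)" using k distrib_left[of A A C] by linarith
  then have Ak: "A - k > 0" using assms by (simp add: mult_less_cancel_right)
  have "(A - k) * (A * p\<^sup>2 + B * p * q + C * q\<^sup>2 - k * (p\<^sup>2 + q\<^sup>2))
      = ((A - k) * p + B * q / 2)\<^sup>2 + ((A * C - B\<^sup>2 / 4) - k * (A + C) + k\<^sup>2) * q\<^sup>2"
    by (simp add: power2_eq_square algebra_simps)
  also have "\<dots> \<ge> 0" unfolding k by simp
  finally have "A * p\<^sup>2 + B * p * q + C * q\<^sup>2 - k * (p\<^sup>2 + q\<^sup>2) \<ge> 0"
    using Ak by (simp add: zero_le_mult_iff)
  then show "(A * C - B\<^sup>2 / 4) / (A + C) * (p\<^sup>2 + q\<^sup>2) \<le> A * p\<^sup>2 + B * p * q + C * q\<^sup>2"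
    by (simp add: k_def)
qed

lemma quasihomogeneous_rotation_weaken:
  assumes "quasihomogeneous_rotation n U V R \<kappa> L"
    and "0 < R'" "R' \<le> R" "0 < \<kappa>'" "\<kappa>' \<le> \<kappa>" "L \<le> L'"
  shows "quasihomogeneous_rotation n U V R' \<kappa>' L'"
proof -
  interpret quasihomogeneous_rotation n U V R \<kappa> L by fact
  have sub: "{(x::real, w::real). x ^ (2 * n) + w\<^sup>2 < R' ^ (2 * n)} \<subseteq> {(x, w). x ^ (2 * n) + w\<^sup>2 < R ^ (2 * n)}"
    using power_mono[of R' R "2 * n"] assms by auto
  show ?thesis
  proof
    fix r r' c s :: real
    assume *: "0 < r" "r < R'" "c ^ (2 * n) + s\<^sup>2 = 1"
    then have r: "r < R" using assms by simp
    show "\<bar>U (r * c) (r ^ n * s) / r ^ n\<bar> \<le> L'" "\<bar>V (r * c) (r ^ n * s) / r ^ (2 * n - 1)\<bar> \<le> L'"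
      using bound_U[OF *(1) r *(3)] bound_V[OF *(1) r *(3)] assms by linarith+
    show "real n * s * (U (r * c) (r ^ n * s) / r ^ n) - c * (V (r * c) (r ^ n * s) / r ^ (2 * n - 1)) \<ge> \<kappa>'"
      using rotation[OF *(1) r *(3)] assms by linarith
    assume **: "0 < r'" "r' < R'"
    then have r': "r' < R" using assms by simp
    have "L * \<bar>r - r'\<bar> \<le> L' * \<bar>r - r'\<bar>" using assms by (intro mult_right_mono) auto
    then show "\<bar>U (r * c) (r ^ n * s) / r ^ n - U (r' * c) (r' ^ n * s) / r' ^ n\<bar> \<le> L' * \<bar>r - r'\<bar>"
      "\<bar>V (r * c) (r ^ n * s) / r ^ (2 * n - 1) - V (r' * c) (r' ^ n * s) / r' ^ (2 * n - 1)\<bar>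
          \<le> L' * \<bar>r - r'\<bar>"
      using lipschitz_U[OF *(1) r **(1) r' *(3)] lipschitz_V[OF *(1) r **(1) r' *(3)] by linarith+
  qed (use n R \<kappa> L assms continuous_on_subset[OF continuous(1) sub] continuous_on_subset[OF continuous(2) sub] in auto)
qed

context nilpotent_germ
begin

definition g :: "real \<Rightarrow> real" where "g x = - Y x (F x)"

definition f :: "real \<Rightarrow> real" where
  "f x = - (deriv (\<lambda>u. X u (F x)) x + deriv (\<lambda>u. Y x u) (F x))"

context
  fixes \<epsilon> :: real and Fc :: "complex \<Rightarrow> complex"
  assumes branch: "branch \<epsilon> Fc"
begin

lemmas \<epsilon>' = \<epsilon>[OF branch]

text \<open>
\<open>U\<close> vanishes for \<open>w = 0\<close> since \<open>F\<close> solves \<open>y + X = 0\<close>. In the linear term of \<open>V\<close> the contribution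
\<open>deriv F * (1 + X_y)\<close> equals \<open>- X_x\<close> by implicit differentiation, so that \<open>- f\<close> remains.
\<close>

lemma field_expansion:
  assumes x: "\<bar>x\<bar> < \<epsilon> / 2" and w: "\<bar>w\<bar> < \<epsilon>"
  defines "KX \<equiv> 2 * suminf (double_majorant cX r) / \<epsilon>\<^sup>2" and "KY \<equiv> 2 * suminf (double_majorant cY r) / \<epsilon>\<^sup>2"
  shows "\<bar>U x w - w * (1 + deriv (\<lambda>u. X x u) (F x))\<bar> \<le> KX * w\<^sup>2"
    and "\<bar>V x w + g x + f x * w\<bar> \<le> (KY + 2 * KX) * w\<^sup>2"
proof -
  have x': "\<bar>x\<bar> < \<epsilon>" using x \<epsilon>' by simp
  note Fx = F_le[OF branch x']
  define eX where "eX = X x (F x + w) - X x (F x) - w * deriv (\<lambda>u. X x u) (F x)"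
  define eY where "eY = Y x (F x + w) - Y x (F x) - w * deriv (\<lambda>u. Y x u) (F x)"
  have eX: "\<bar>eX\<bar> \<le> KX * w\<^sup>2" unfolding eX_def KX_def
    by (rule real_taylor2[OF summable_X X_eq]) (use x' w Fx \<epsilon>' in auto)
  have eY: "\<bar>eY\<bar> \<le> KY * w\<^sup>2" unfolding eY_def KY_def
    by (rule real_taylor2[OF summable_Y Y_eq]) (use x' w Fx \<epsilon>' in auto)
  have U: "U x w = w * (1 + deriv (\<lambda>u. X x u) (F x)) + eX"
    using F_root[OF branch x'] by (simp add: U_def eX_def algebra_simps)
  then show "\<bar>U x w - w * (1 + deriv (\<lambda>u. X x u) (F x))\<bar> \<le> KX * w\<^sup>2"
    using eX by simp
  have "V x w = - g x + w * deriv (\<lambda>u. Y x u) (F x) + eY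
      - (w * (deriv F x * (1 + deriv (\<lambda>u. X x u) (F x))) + deriv F x * eX)"
    unfolding V_def U g_def eY_def by (simp add: algebra_simps)
  then have V: "V x w + g x + f x * w = eY - deriv F x * eX"
    unfolding F_derivative_eq[OF branch x'] f_def by (simp add: algebra_simps)
  have "\<bar>deriv F x * eX\<bar> \<le> 2 * (KX * w\<^sup>2)"
    unfolding abs_mult by (rule mult_mono[OF deriv_F_le[OF branch x] eX]) auto
  then show "\<bar>V x w + g x + f x * w\<bar> \<le> (KY + 2 * KX) * w\<^sup>2"
    unfolding V using eY abs_triangle_ineq4[of eY "deriv F x * eX"] by (simp add: algebra_simps)
qed

lemma X2_le:
  assumes t: "0 < t" "t < \<epsilon>" "\<bar>x\<bar> \<le> t"
  shows "\<bar>deriv (\<lambda>u. X x u) (F x)\<bar> \<le> 4 * suminf (double_majorant cX r) / r\<^sup>2 * t"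
proof -
  have Fx: "\<bar>F x\<bar> \<le> t" using F_le[OF branch, of x] t by simp
  have "cmod (partial2 cX (of_real x) (of_real (F x))) \<le> (2 * t / r)\<^sup>2 * suminf (double_majorant cX r) / t"
    by (rule norm_partial2_le[OF summable_X order_X]) (use t Fx \<epsilon>' in auto)
  also have "partial2 cX (of_real x) (of_real (F x)) = of_real (deriv (\<lambda>u. X x u) (F x))"
    by (rule partial_of_real(2)[OF summable_X X_eq]) (use t Fx \<epsilon>' in auto)
  finally show ?thesis using t by (simp add: power2_eq_square field_simps)
qed

lemma U_limit:
  assumes n: "n \<ge> 1" and c: "\<bar>c\<bar> \<le> 1" and s: "\<bar>s\<bar> \<le> 1"
  shows "((\<lambda>t. U (t * c) (t ^ n * s) / t ^ n) \<longlongrightarrow> s) (at_right 0)"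
proof (rule LIM_zero_cancel, rule Lim_null_comparison)
  define K K' where "K = 2 * suminf (double_majorant cX r) / \<epsilon>\<^sup>2" and "K' = 4 * suminf (double_majorant cX r) / r\<^sup>2"
  have "\<forall>\<^sub>F t in at_right 0. t \<in> {0<..<\<epsilon> / 2}"
    by (rule eventually_at_right_real) (use \<epsilon>' in auto)
  then show "\<forall>\<^sub>F t in at_right 0. norm (U (t * c) (t ^ n * s) / t ^ n - s) \<le> K * t ^ n + K' * t"
  proof eventually_elim
    case (elim t)
    then have t: "0 < t" "t < \<epsilon> / 2" "t < \<epsilon>" "t < 1" using \<epsilon>' by auto
    have tc: "\<bar>t * c\<bar> \<le> t" using t c by (simp add: abs_mult mult_left_le)
    have tn: "t ^ n \<le> t" using t n power_decreasing[of 1 n t] by simp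
    have ts: "\<bar>t ^ n * s\<bar> \<le> t ^ n" using t s by (simp add: abs_mult mult_left_le)
    define e where "e = U (t * c) (t ^ n * s) - t ^ n * s * (1 + deriv (\<lambda>u. X (t * c) u) (F (t * c)))"
    have "\<bar>e\<bar> \<le> K * (t ^ n * s)\<^sup>2"
      unfolding e_def K_def by (rule field_expansion(1)) (use tc ts tn t in auto)
    also have "K * (t ^ n * s)\<^sup>2 \<le> K * (t ^ n)\<^sup>2"
      using abs_le_square_iff[THEN iffD1, of "t ^ n * s" "t ^ n"] ts t MX_nonneg
      by (intro mult_left_mono) (auto simp: K_def)
    finally have "\<bar>e\<bar> \<le> K * t ^ n * t ^ n" by (simp only: power2_eq_square mult.assoc)
    then have e: "\<bar>e / t ^ n\<bar> \<le> K * t ^ n" using t by (simp add: abs_divide divide_le_eq)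
    have "\<bar>s * deriv (\<lambda>u. X (t * c) u) (F (t * c))\<bar> \<le> 1 * (K' * t)"
      unfolding abs_mult K'_def by (rule mult_mono[OF s X2_le]) (use t tc in auto)
    moreover have "U (t * c) (t ^ n * s) / t ^ n - s = e / t ^ n + s * deriv (\<lambda>u. X (t * c) u) (F (t * c))"
      using t by (simp add: e_def field_simps)
    ultimately show ?case using e by (simp only: real_norm_def)
  qed
  show "((\<lambda>t. K * t ^ n + K' * t) \<longlongrightarrow> 0) (at_right 0)"
    using n by (auto intro!: tendsto_eq_intros simp: power_0_left)
qed

lemma V_limit:
  assumes n: "n \<ge> 1" and c: "\<bar>c\<bar> \<le> 1" and s: "\<bar>s\<bar> \<le> 1"
    and g_lim: "((\<lambda>t. g (t * c) / t ^ (2 * n - 1)) \<longlongrightarrow> a * c ^ (2 * n - 1)) (at_right 0)"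
    and f_lim: "((\<lambda>t. f (t * c) / t ^ (n - 1)) \<longlongrightarrow> b * c ^ (n - 1)) (at_right 0)"
  shows "((\<lambda>t. V (t * c) (t ^ n * s) / t ^ (2 * n - 1)) \<longlongrightarrow> - a * c ^ (2 * n - 1) - b * c ^ (n - 1) * s) (at_right 0)"
proof -
  define K where "K = 2 * suminf (double_majorant cY r) / \<epsilon>\<^sup>2 + 2 * (2 * suminf (double_majorant cX r) / \<epsilon>\<^sup>2)"
  have K: "K \<ge> 0" using MX_nonneg MY_nonneg by (simp add: K_def)
  define e where "e = (\<lambda>t. (V (t * c) (t ^ n * s) + g (t * c) + f (t * c) * (t ^ n * s)) / t ^ (2 * n - 1))"
  have ev: "\<forall>\<^sub>F t in at_right 0. t \<in> {0<..<\<epsilon> / 2}"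
    by (rule eventually_at_right_real) (use \<epsilon>' in auto)
  have e: "(e \<longlongrightarrow> 0) (at_right 0)"
  proof (rule Lim_null_comparison)
    show "\<forall>\<^sub>F t in at_right 0. norm (e t) \<le> K * t"
      using ev
    proof eventually_elim
      case (elim t)
      then have t: "0 < t" "t < \<epsilon> / 2" "t < \<epsilon>" "t < 1" using \<epsilon>' by auto
      have tc: "\<bar>t * c\<bar> \<le> t" using t c by (simp add: abs_mult mult_left_le)
      have tn: "t ^ n \<le> t" using t n power_decreasing[of 1 n t] by simp
      have ts: "\<bar>t ^ n * s\<bar> \<le> t ^ n" using t s by (simp add: abs_mult mult_left_le)
      have "\<bar>V (t * c) (t ^ n * s) + g (t * c) + f (t * c) * (t ^ n * s)\<bar> \<le> K * (t ^ n * s)\<^sup>2"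
        unfolding K_def by (rule field_expansion(2)) (use tc ts tn t in auto)
      also have "K * (t ^ n * s)\<^sup>2 \<le> K * (t ^ n)\<^sup>2"
        using abs_le_square_iff[THEN iffD1, of "t ^ n * s" "t ^ n"] ts t K
        by (intro mult_left_mono) auto
      also have "(t ^ n)\<^sup>2 = t ^ Suc (2 * n - 1)"
        using n by (simp add: power_mult[symmetric] mult.commute)
      finally have "\<bar>V (t * c) (t ^ n * s) + g (t * c) + f (t * c) * (t ^ n * s)\<bar> \<le> K * t * t ^ (2 * n - 1)"
        by (simp only: power_Suc mult.assoc)
      then show ?case using t by (simp add: e_def abs_divide divide_le_eq)
    qed
    show "((\<lambda>t. K * t) \<longlongrightarrow> 0) (at_right 0)" by (auto intro!: tendsto_eq_intros)
  qed
  have "((\<lambda>t. e t - g (t * c) / t ^ (2 * n - 1) - f (t * c) / t ^ (n - 1) * s)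
      \<longlongrightarrow> 0 - a * c ^ (2 * n - 1) - b * c ^ (n - 1) * s) (at_right 0)"
    by (intro tendsto_intros e g_lim f_lim)
  moreover have "\<forall>\<^sub>F t in at_right 0. e t - g (t * c) / t ^ (2 * n - 1) - f (t * c) / t ^ (n - 1) * s
      = V (t * c) (t ^ n * s) / t ^ (2 * n - 1)"
    using ev
  proof eventually_elim
    case (elim t)
    then have t: "t > 0" by simp
    have "t ^ n / t ^ (2 * n - 1) = 1 / t ^ (n - 1)"
    proof -
      have "t ^ (2 * n - 1) = t ^ n * t ^ (n - 1)"
      proof -
        have "2 * n - 1 = n + (n - 1)" using n by simp
        then show ?thesis by (simp only: power_add)
      qed
      then show ?thesis using t by simp
    qed
    then have "f (t * c) * (t ^ n * s) / t ^ (2 * n - 1) = f (t * c) / t ^ (n - 1) * s"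
      by (metis (no_types, opaque_lifting) mult.assoc mult.commute mult_1 times_divide_eq_left times_divide_eq_right)
    then show ?case by (simp add: e_def add_divide_distrib)
  qed
  ultimately show ?thesis by (simp add: filterlim_cong[OF refl refl])
qed

text \<open>
For a fixed direction \<open>(c, s)\<close> the field along the curve \<open>t \<mapsto> (t * c, t ^ n * s)\<close> is the restriction
of holomorphic functions of \<open>t\<close>; domain and bounds do not depend on the direction.
\<close>

lemma complexified_field:
  fixes c s :: real
  assumes n: "n \<ge> 1" and c: "\<bar>c\<bar> \<le> 1" and s: "\<bar>s\<bar> \<le> 1"
  obtains Hu Hv :: "complex \<Rightarrow> complex" where
    "Hu holomorphic_on ball 0 (\<epsilon> / 2)"
    "\<forall>z\<in>ball 0 (\<epsilon> / 2). cmod (Hu z) \<le> 2 + suminf (double_majorant cX r)"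
    "\<forall>t\<in>{0<..<\<epsilon> / 2}. Hu (of_real t) = of_real (U (t * c) (t ^ n * s))"
    "Hv holomorphic_on ball 0 (\<epsilon> / 2)"
    "\<forall>z\<in>ball 0 (\<epsilon> / 2). cmod (Hv z) \<le> suminf (double_majorant cY r) + 2 * (2 + suminf (double_majorant cX r))"
    "\<forall>t\<in>{0<..<\<epsilon> / 2}. Hv (of_real t) = of_real (V (t * c) (t ^ n * s))"
proof -
  define MU MV where "MU = 2 + suminf (double_majorant cX r)" and "MV = suminf (double_majorant cY r) + 2 * MU"
  define A where "A = (\<lambda>z. z * complex_of_real c)"
  define B where "B = (\<lambda>z. Fc (A z) + z ^ n * complex_of_real s)"
  define Hu where "Hu = (\<lambda>z. B z + double_series cX (A z) (B z))"
  define Hv where "Hv = (\<lambda>z. double_series cY (A z) (B z) - deriv Fc (A z) * Hu z)"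
  let ?S = "ball (0::complex) (\<epsilon> / 2)"
  have A: "cmod (A z) < \<epsilon> / 2" if "z \<in> ?S" for z
  proof -
    have "cmod (A z) \<le> cmod z" using c by (simp add: A_def norm_mult mult_left_le)
    then show ?thesis using that by simp
  qed
  have A\<epsilon>: "A z \<in> ball 0 \<epsilon>" if "z \<in> ?S" for z using A[OF that] \<epsilon>' by simp
  have B: "cmod (B z) \<le> \<epsilon>" if z: "z \<in> ?S" for z
  proof -
    have "cmod z \<le> 1" using z \<epsilon>' by simp
    then have "cmod z ^ n \<le> cmod z" using n power_decreasing[of 1 n "cmod z"] by simp
    moreover have "cmod (z ^ n * complex_of_real s) \<le> cmod z ^ n"
      using s by (simp add: norm_mult norm_power mult_left_le)
    moreover have "cmod (Fc (A z)) \<le> cmod (A z)" by (rule Fc_le[OF branch A\<epsilon>[OF z]])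
    ultimately show ?thesis
      unfolding B_def using A[OF z] z norm_triangle_ineq[of "Fc (A z)" "z ^ n * complex_of_real s"] by simp
  qed
  have Ahol: "A holomorphic_on ?S" unfolding A_def by (intro holomorphic_intros)
  have AS: "A ` ?S \<subseteq> ball 0 \<epsilon>" using A\<epsilon> by auto
  have FA: "(\<lambda>z. Fc (A z)) holomorphic_on ?S"
    using holomorphic_on_compose_gen[OF Ahol Fc_holomorphic[OF branch] AS] by (simp add: o_def)
  have FA': "(\<lambda>z. deriv Fc (A z)) holomorphic_on ?S"
    using holomorphic_on_compose_gen[OF Ahol holomorphic_deriv[OF Fc_holomorphic[OF branch] open_ball] AS]
    by (simp add: o_def)
  have Bhol: "B holomorphic_on ?S" unfolding B_def by (intro holomorphic_intros FA)
  have Ar: "cmod (A z) < r" "cmod (B z) < r" if "z \<in> ?S" for z using A[OF that] B[OF that] \<epsilon>' by auto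
  have Xhol: "(\<lambda>z. double_series cX (A z) (B z)) holomorphic_on ?S"
    and Yhol: "(\<lambda>z. double_series cY (A z) (B z)) holomorphic_on ?S"
    by (intro double_series_compose_holomorphic[OF summable_X open_ball Ahol Ar(1) Bhol Ar(2)]
          double_series_compose_holomorphic[OF summable_Y open_ball Ahol Ar(1) Bhol Ar(2)]; assumption)+
  have hol: "Hu holomorphic_on ?S" "Hv holomorphic_on ?S"
    unfolding Hu_def Hv_def by (intro holomorphic_intros Bhol Xhol Yhol FA')+
  have boundX: "cmod (double_series cX (A z) (B z)) \<le> suminf (double_majorant cX r)"
    and boundY: "cmod (double_series cY (A z) (B z)) \<le> suminf (double_majorant cY r)" if "z \<in> ?S" for z
    using norm_double_series_le[OF summable_X r, of 0 "A z" r "B z"]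
      norm_double_series_le[OF summable_Y r, of 0 "A z" r "B z"] Ar[OF that] by auto
  have boundU: "cmod (Hu z) \<le> MU" if "z \<in> ?S" for z
    using norm_triangle_ineq[of "B z" "double_series cX (A z) (B z)"] B[OF that] boundX[OF that] \<epsilon>'
    unfolding Hu_def MU_def by linarith
  have boundV: "cmod (Hv z) \<le> MV" if z: "z \<in> ?S" for z
  proof -
    have "cmod (deriv Fc (A z) * Hu z) \<le> 2 * MU"
      unfolding norm_mult by (rule mult_mono[OF deriv_Fc_le[OF branch A[OF z]] boundU[OF z]]) auto
    then show ?thesis
      using norm_triangle_ineq4[of "double_series cY (A z) (B z)" "deriv Fc (A z) * Hu z"] boundY[OF z]
      unfolding Hv_def MV_def by linarith
  qed
  have real: "Hu (of_real t) = of_real (U (t * c) (t ^ n * s))"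
    "Hv (of_real t) = of_real (V (t * c) (t ^ n * s))" if t: "0 < t" "t < \<epsilon> / 2" for t
  proof -
    have tS: "of_real t \<in> ?S" using t by simp
    have At: "A (of_real t) = of_real (t * c)" by (simp add: A_def)
    have tc: "\<bar>t * c\<bar> < \<epsilon> / 2" using A[OF tS] unfolding At norm_of_real .
    then have tc': "\<bar>t * c\<bar> < \<epsilon>" using \<epsilon>' by simp
    have Bt: "B (of_real t) = of_real (F (t * c) + t ^ n * s)"
      unfolding B_def At Fc_real[OF branch tc'] by simp
    have Fr: "\<bar>F (t * c) + t ^ n * s\<bar> \<le> r" "\<bar>t * c\<bar> \<le> r"
      using Ar[OF tS] unfolding At Bt norm_of_real by simp_all
    show U: "Hu (of_real t) = of_real (U (t * c) (t ^ n * s))"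
      unfolding Hu_def At Bt X_eq[OF Fr(2,1)] U_def by simp
    show "Hv (of_real t) = of_real (V (t * c) (t ^ n * s))"
      unfolding Hv_def U unfolding At Bt Y_eq[OF Fr(2,1)] V_def F_derivative(2)[OF branch tc'] by simp
  qed
  show ?thesis
    using that[of Hu Hv] hol boundU boundV real unfolding MV_def MU_def by auto
qed

lemma field_continuous:
  assumes n: "n \<ge> 1" and R: "0 < R" "R \<le> \<epsilon> / 2"
  shows "continuous_on {(x, w). x ^ (2 * n) + w\<^sup>2 < R ^ (2 * n)} (\<lambda>(x, w). U x w)"
    "continuous_on {(x, w). x ^ (2 * n) + w\<^sup>2 < R ^ (2 * n)} (\<lambda>(x, w). V x w)"
proof -
  let ?S = "{(x::real, w::real). x ^ (2 * n) + w\<^sup>2 < R ^ (2 * n)}"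
  have in_box: "\<bar>x\<bar> < R \<and> \<bar>w\<bar> < R" if "(x, w) \<in> ?S" for x w
  proof -
    have lt: "x ^ (2 * n) + w\<^sup>2 < R ^ (2 * n)" using that by simp
    have "x ^ (2 * n) \<ge> 0" "w\<^sup>2 \<ge> 0" by simp_all
    moreover have "\<bar>x\<bar> ^ (2 * n) = x ^ (2 * n)" by (simp add: power_even_abs)
    moreover have "R ^ (2 * n) = (R ^ n)\<^sup>2" by (simp add: power_mult[symmetric] mult.commute)
    ultimately have "\<bar>x\<bar> ^ (2 * n) < R ^ (2 * n)" "\<bar>w\<bar>\<^sup>2 < (R ^ n)\<^sup>2"
      using lt by (simp_all only: power2_abs)
    then have "\<bar>x\<bar> < R" "\<bar>w\<bar> < R ^ n"
      using R power_less_imp_less_base[of "\<bar>x\<bar>" "2 * n" R] power2_less_imp_less[of "\<bar>w\<bar>" "R ^ n"]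
      by auto
    moreover have "R ^ n \<le> R" using n R \<epsilon>' power_decreasing[of 1 n R] by simp
    ultimately show ?thesis by simp
  qed
  have contF: "continuous_on {-\<epsilon><..<\<epsilon>} F"
    by (rule DERIV_continuous_on[where D = "deriv F"])
       (auto intro!: has_field_derivative_at_within F_derivative[OF branch])
  have contF': "continuous_on {-\<epsilon><..<\<epsilon>} (deriv F)"
  proof -
    have "continuous_on (ball 0 \<epsilon>) (deriv Fc)"
      by (intro holomorphic_on_imp_continuous_on holomorphic_deriv Fc_holomorphic[OF branch]) auto
    then have "continuous_on {-\<epsilon><..<\<epsilon>} (\<lambda>x. Re (deriv Fc (of_real x)))"
      by (intro continuous_intros continuous_on_compose2[of _ "deriv Fc" _ of_real]) (auto simp: abs_less_iff)
    then show ?thesis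
      by (rule continuous_on_cong[THEN iffD1, rotated 2]) (auto simp: F_derivative(2)[OF branch])
  qed
  have cx: "continuous_on ?S (\<lambda>p. F (fst p))" "continuous_on ?S (\<lambda>p. deriv F (fst p))"
    using in_box R \<epsilon>' by (auto intro!: continuous_on_compose2[OF contF] continuous_on_compose2[OF contF']
        continuous_intros dest!: in_box)
  have Z: "continuous_on ?S (\<lambda>p. Z (fst p) (F (fst p) + snd p))"
    if sm: "summable (double_majorant c r)"
      and eq: "\<And>x y. \<bar>x\<bar> \<le> r \<Longrightarrow> \<bar>y\<bar> \<le> r \<Longrightarrow> double_series c (of_real x) (of_real y) = of_real (Z x y)" for Z c
  proof -
    have range: "\<bar>x\<bar> \<le> r \<and> \<bar>F x + w\<bar> \<le> r" if "(x, w) \<in> ?S" for x w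
      using in_box[OF that] F_le[OF branch, of x] R \<epsilon>' by auto
    have "continuous_on ?S (\<lambda>p. (complex_of_real (fst p), complex_of_real (F (fst p) + snd p)))"
      by (intro continuous_intros cx)
    then have "continuous_on ?S (\<lambda>p. (\<lambda>(a, b). double_series c a b)
        (complex_of_real (fst p), complex_of_real (F (fst p) + snd p)))"
    proof (rule continuous_on_compose2[OF continuous_on_double_series[OF sm]])
      show "(\<lambda>p. (complex_of_real (fst p), complex_of_real (F (fst p) + snd p))) ` ?S
          \<subseteq> {(a, b). cmod a \<le> r \<and> cmod b \<le> r}"
      proof (clarify, intro conjI)
        fix x w :: real assume "x ^ (2 * n) + w\<^sup>2 < R ^ (2 * n)"
        then have "(x, w) \<in> ?S" by simp
        from range[OF this] show "cmod (complex_of_real (fst (x, w))) \<le> r"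
          "cmod (complex_of_real (F (fst (x, w)) + snd (x, w))) \<le> r"
          by (simp_all only: norm_of_real fst_conv snd_conv)
      qed
    qed
    then have "continuous_on ?S (\<lambda>p. Re (double_series c (of_real (fst p)) (of_real (F (fst p) + snd p))))"
      by (intro continuous_intros) simp
    then show ?thesis
    proof (rule continuous_on_cong[THEN iffD1, rotated 2])
      fix p assume "p \<in> ?S"
      then have "double_series c (of_real (fst p)) (of_real (F (fst p) + snd p)) = of_real (Z (fst p) (F (fst p) + snd p))"
        using range[of "fst p" "snd p"] by (intro eq) auto
      then show "Re (double_series c (of_real (fst p)) (of_real (F (fst p) + snd p))) = Z (fst p) (F (fst p) + snd p)"
        by simp
    qed simp
  qed
  have U: "continuous_on ?S (\<lambda>p. U (fst p) (snd p))"
    unfolding U_def by (intro continuous_intros cx Z[OF summable_X X_eq])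
  then show "continuous_on ?S (\<lambda>(x, w). U x w)" by (simp add: case_prod_unfold)
  have "continuous_on ?S (\<lambda>p. V (fst p) (snd p))"
    unfolding V_def by (intro continuous_intros cx U Z[OF summable_Y Y_eq])
  then show "continuous_on ?S (\<lambda>(x, w). V x w)" by (simp add: case_prod_unfold)
qed

text \<open>
At radius \<open>0\<close> the angular velocity is the quadratic form \<open>a * p\<^sup>2 + b * p * q + n * q\<^sup>2\<close> at
\<open>p = c ^ n\<close>, \<open>q = s\<close>, where \<open>p\<^sup>2 + q\<^sup>2 = 1\<close>; it is positive definite. By the uniform Lipschitz
estimates it changes by at most \<open>(n + 1) * L * R\<close> up to radius \<open>R\<close>, so half of the bound
survives for small \<open>R\<close>.
\<close>

lemma rotation_exists:
  assumes n: "n \<ge> 1" and a: "a > 0" and discriminant: "b\<^sup>2 < 4 * real n * a"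
    and g_lim: "\<And>c. \<bar>c\<bar> \<le> 1 \<Longrightarrow> ((\<lambda>t. g (t * c) / t ^ (2 * n - 1)) \<longlongrightarrow> a * c ^ (2 * n - 1)) (at_right 0)"
    and f_lim: "\<And>c. \<bar>c\<bar> \<le> 1 \<Longrightarrow> ((\<lambda>t. f (t * c) / t ^ (n - 1)) \<longlongrightarrow> b * c ^ (n - 1)) (at_right 0)"
  shows "\<exists>R \<kappa> L. R \<le> \<epsilon> / 8 \<and> quasihomogeneous_rotation n U V R \<kappa> L"
proof -
  define MU MV where "MU = 2 + suminf (double_majorant cX r)"
    and "MV = suminf (double_majorant cY r) + 2 * MU"
  define QU QV where "QU = MU * (2 / (\<epsilon> / 2)) ^ n" and "QV = MV * (2 / (\<epsilon> / 2)) ^ (2 * n - 1)"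
  define LU LV where "LU = 4 * QU / (\<epsilon> / 2)" and "LV = 4 * QV / (\<epsilon> / 2)"
  have "QU \<ge> 0" "QV \<ge> 0" using MX_nonneg MY_nonneg \<epsilon>' by (simp_all add: QU_def QV_def MU_def MV_def)
  then have Q: "QU \<ge> 0" "QV \<ge> 0" "LU \<ge> 0" "LV \<ge> 0" using \<epsilon>' by (simp_all add: LU_def LV_def)
  define L where "L = QU + QV + LU + LV"
  define k where "k = (a * real n - b\<^sup>2 / 4) / (a + real n)"
  have disc: "b\<^sup>2 < 4 * a * real n" using discriminant by (simp add: mult_ac)
  have k: "k > 0" "\<And>p q :: real. k * (p\<^sup>2 + q\<^sup>2) \<le> a * p\<^sup>2 + b * p * q + real n * q\<^sup>2"
    using positive_quadratic_form[OF a _ disc] n by (simp_all add: k_def)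
  define R where "R = min (\<epsilon> / 8) (k / (2 * ((n + 1) * L + 1)))"
  have L: "L \<ge> 0" using Q by (simp add: L_def)
  have den: "(n + 1) * L + 1 > 0" using L by (simp add: add_nonneg_pos)
  have "k / (2 * ((n + 1) * L + 1)) > 0" using k(1) den by (intro divide_pos_pos) auto
  then have "0 < R" unfolding R_def using \<epsilon>' by (simp only: min_less_iff_conj) simp
  moreover have "R \<le> \<epsilon> / 8" unfolding R_def by (rule min.cobounded1)
  ultimately have R: "0 < R" "R \<le> \<epsilon> / 8" by auto
  have "R \<le> k / (2 * ((n + 1) * L + 1))" unfolding R_def by (rule min.cobounded2)
  then have "R * (2 * ((n + 1) * L + 1)) \<le> k" using den by (subst (asm) le_divide_eq) auto
  then have Rk: "(n + 1) * L * R \<le> k / 2" using R by (simp add: algebra_simps)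
  have estimates: "\<bar>U (t * c) (t ^ n * s) / t ^ n\<bar> \<le> L" "\<bar>V (t * c) (t ^ n * s) / t ^ (2 * n - 1)\<bar> \<le> L"
    "\<bar>U (t * c) (t ^ n * s) / t ^ n - U (t' * c) (t' ^ n * s) / t' ^ n\<bar> \<le> L * \<bar>t - t'\<bar>"
    "\<bar>V (t * c) (t ^ n * s) / t ^ (2 * n - 1) - V (t' * c) (t' ^ n * s) / t' ^ (2 * n - 1)\<bar> \<le> L * \<bar>t - t'\<bar>"
    "k / 2 \<le> real n * s * (U (t * c) (t ^ n * s) / t ^ n) - c * (V (t * c) (t ^ n * s) / t ^ (2 * n - 1))"
    if t: "0 < t" "t < R" and t': "0 < t'" "t' < R" and cs: "c ^ (2 * n) + s\<^sup>2 = 1" for t t' c s :: real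
  proof -
    note cs1 = unit_curve_bounds[OF cs n]
    obtain Hu Hv where H: "Hu holomorphic_on ball 0 (\<epsilon> / 2)"
      "\<forall>z\<in>ball 0 (\<epsilon> / 2). cmod (Hu z) \<le> MU"
      "\<forall>t\<in>{0<..<\<epsilon> / 2}. Hu (of_real t) = of_real (U (t * c) (t ^ n * s))"
      "Hv holomorphic_on ball 0 (\<epsilon> / 2)" "\<forall>z\<in>ball 0 (\<epsilon> / 2). cmod (Hv z) \<le> MV"
      "\<forall>t\<in>{0<..<\<epsilon> / 2}. Hv (of_real t) = of_real (V (t * c) (t ^ n * s))"
      using complexified_field[OF n cs1, folded MU_def, folded MV_def] by blast
    define u v where "u = (\<lambda>t. U (t * c) (t ^ n * s) / t ^ n)"
      and "v = (\<lambda>t. V (t * c) (t ^ n * s) / t ^ (2 * n - 1))"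
    define v0 where "v0 = - a * c ^ (2 * n - 1) - b * c ^ (n - 1) * s"
    have ulim: "(u \<longlongrightarrow> s) (at_right 0)" unfolding u_def by (rule U_limit[OF n cs1])
    have vlim: "(v \<longlongrightarrow> v0) (at_right 0)" unfolding v_def v0_def
      by (rule V_limit[OF n cs1 g_lim f_lim]) (use cs1 in auto)
    have order: "\<exists>K. \<forall>\<^sub>F t in at_right 0. \<bar>h t\<bar> \<le> K * t ^ m"
      if "((\<lambda>t. h t / t ^ m) \<longlongrightarrow> l) (at_right 0)" for h m and l :: real
    proof
      have "\<forall>\<^sub>F t in at_right 0. dist (h t / t ^ m) l < 1" using tendstoD[OF that] by simp
      then show "\<forall>\<^sub>F t in at_right 0. \<bar>h t\<bar> \<le> (\<bar>l\<bar> + 1) * t ^ m"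
        using eventually_at_right_less[of 0]
      proof eventually_elim
        case (elim t)
        then have "\<bar>h t / t ^ m\<bar> \<le> \<bar>l\<bar> + 1" by (simp add: dist_real_def)
        then show ?case using elim by (simp add: abs_divide divide_le_eq)
      qed
    qed
    obtain KU where KU: "\<forall>\<^sub>F t in at_right 0. \<bar>U (t * c) (t ^ n * s)\<bar> \<le> KU * t ^ n"
      using order[OF ulim[unfolded u_def]] by blast
    obtain KV where KV: "\<forall>\<^sub>F t in at_right 0. \<bar>V (t * c) (t ^ n * s)\<bar> \<le> KV * t ^ (2 * n - 1)"
      using order[OF vlim[unfolded v_def]] by blast
    have \<epsilon>2: "\<epsilon> / 2 > 0" using \<epsilon>' by simp
    note estU = scaled_quotient_estimates[OF H(1) \<epsilon>2 H(2,3) KU, folded QU_def, folded LU_def]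
    note estV = scaled_quotient_estimates[OF H(4) \<epsilon>2 H(5,6) KV, folded QV_def, folded LV_def]
    have tt: "t < \<epsilon> / 2 / 2" "t < \<epsilon> / 2 / 4" "t' < \<epsilon> / 2 / 4" using t t' R by auto
    show "\<bar>U (t * c) (t ^ n * s) / t ^ n\<bar> \<le> L"
      using estU(1)[OF t(1) tt(1)] Q unfolding L_def by linarith
    show "\<bar>V (t * c) (t ^ n * s) / t ^ (2 * n - 1)\<bar> \<le> L"
      using estV(1)[OF t(1) tt(1)] Q unfolding L_def by linarith
    have "LU * \<bar>t - t'\<bar> \<le> L * \<bar>t - t'\<bar>" "LV * \<bar>t - t'\<bar> \<le> L * \<bar>t - t'\<bar>"
      using Q by (auto simp: L_def intro!: mult_right_mono)
    then show "\<bar>U (t * c) (t ^ n * s) / t ^ n - U (t' * c) (t' ^ n * s) / t' ^ n\<bar> \<le> L * \<bar>t - t'\<bar>"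
      "\<bar>V (t * c) (t ^ n * s) / t ^ (2 * n - 1) - V (t' * c) (t' ^ n * s) / t' ^ (2 * n - 1)\<bar> \<le> L * \<bar>t - t'\<bar>"
      using estU(2)[OF t(1) tt(2) t'(1) tt(3)] estV(2)[OF t(1) tt(2) t'(1) tt(3)] by linarith+
    have "LU * t \<le> L * R" "LV * t \<le> L * R"
      using Q t L by (auto simp: L_def intro!: mult_mono)
    then have du: "\<bar>s - u t\<bar> \<le> L * R" and dv: "\<bar>v t - v0\<bar> \<le> L * R"
      using estU(3)[OF t(1) tt(2) ulim[unfolded u_def]] estV(3)[OF t(1) tt(2) vlim[unfolded v_def]]
      unfolding u_def v_def by linarith+
    have "\<bar>real n * s * (s - u t) + c * (v t - v0)\<bar> \<le> real (n + 1) * (L * R)"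
      by (rule abs_combination_le[OF cs1(2,1) du dv])
    then have close: "n * s * s - c * v0 - k / 2 \<le> real n * s * u t - c * v t"
      using Rk by (simp add: algebra_simps)
    have "n * s * s - c * v0 = a * (c ^ n)\<^sup>2 + b * c ^ n * s + n * s\<^sup>2"
    proof -
      obtain m where "n = Suc m" using n by (cases n) auto
      then show ?thesis
        by (simp add: v0_def power2_eq_square algebra_simps power_add[symmetric] mult_2_right)
    qed
    also have "\<dots> \<ge> k * ((c ^ n)\<^sup>2 + s\<^sup>2)" by (rule k(2))
    also have "(c ^ n)\<^sup>2 + s\<^sup>2 = 1" using cs by (simp add: power_mult[symmetric] mult.commute)
    finally show "k / 2 \<le> real n * s * (U (t * c) (t ^ n * s) / t ^ n) - c * (V (t * c) (t ^ n * s) / t ^ (2 * n - 1))"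
      using close unfolding u_def v_def by linarith
  qed
  have "quasihomogeneous_rotation n U V R (k / 2) L"
  proof
    show "continuous_on {(x, w). x ^ (2 * n) + w\<^sup>2 < R ^ (2 * n)} (\<lambda>(x, w). U x w)"
      "continuous_on {(x, w). x ^ (2 * n) + w\<^sup>2 < R ^ (2 * n)} (\<lambda>(x, w). V x w)"
      using field_continuous[OF n R(1)] R \<epsilon>' by auto
  qed (use n R \<epsilon>' k(1) L in \<open>simp, simp, simp, simp, simp\<close>, (rule estimates; assumption)+)
  then show ?thesis using R by blast
qed

end

end

section \<open>Dependence of the straightened system on the Taylor terms\<close>

lemma norm_double_series_diff_le:
  assumes sm: "summable (double_majorant c r)" "summable (double_majorant c' r)" and r: "r > 0"
    and agree: "\<And>i j. i + j \<le> N \<Longrightarrow> c i j = c' i j"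
  obtains K where "K \<ge> 0"
    "\<forall>a b s. cmod a \<le> s \<and> cmod b \<le> s \<and> s \<le> r \<longrightarrow>
       cmod (double_series c a b - double_series c' a b) \<le> K * s ^ (N + 1)"
proof -
  define e where "e = (\<lambda>i j. c i j - c' i j)"
  have sme: "summable (double_majorant e r)"
    unfolding e_def using double_series_diff(2)[OF sm, of 0 0] r by simp
  define K where "K = suminf (double_majorant e r) / r ^ (N + 1)"
  show ?thesis
  proof (rule that[of K])
    show "K \<ge> 0" unfolding K_def using r by (auto intro!: divide_nonneg_pos suminf_nonneg sme simp: double_majorant_def)
    have "cmod (double_series c a b - double_series c' a b) \<le> K * s ^ (N + 1)"
      if *: "cmod a \<le> s" "cmod b \<le> s" "s \<le> r" for a b s
    proof -
    have "double_series c a b - double_series c' a b = double_series e a b"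
      unfolding e_def by (rule double_series_diff(1)[OF sm]) (use * in auto)
    moreover have "cmod (double_series e a b) \<le> (s / r) ^ (N + 1) * suminf (double_majorant e r)"
      by (rule norm_double_series_le[OF sme r _ *]) (simp add: e_def agree)
    ultimately show ?thesis
      by (simp add: K_def power_divide mult.commute)
    qed
    then show "\<forall>a b s. cmod a \<le> s \<and> cmod b \<le> s \<and> s \<le> r \<longrightarrow>
       cmod (double_series c a b - double_series c' a b) \<le> K * s ^ (N + 1)" by blast
  qed
qed

text \<open>
The contraction estimate transfers the difference of the two series to the two branches.
Cauchy's inequality on the disc of radius \<open>t\<close> around \<open>x\<close>, with \<open>t \<ge> \<bar>x\<bar>\<close> instead of \<open>\<bar>x\<bar>\<close> so that
\<open>x = 0\<close> is allowed, loses one power of \<open>t\<close> for the derivatives.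
\<close>

lemma branch_difference:
  assumes germ: "nilpotent_germ X Y F cX cY r" and germ': "nilpotent_germ X' Y' F' cX' cY' r"
    and branch: "nilpotent_germ.branch F cX r \<epsilon> Fc" and branch': "nilpotent_germ.branch F' cX' r \<epsilon> Fc'"
    and K: "K \<ge> 0" "\<forall>a b s. cmod a \<le> s \<and> cmod b \<le> s \<and> s \<le> r \<longrightarrow>
              cmod (double_series cX a b - double_series cX' a b) \<le> K * s ^ (N + 1)"
  shows "z \<in> ball 0 \<epsilon> \<Longrightarrow> cmod (Fc z - Fc' z) \<le> 2 * K * cmod z ^ (N + 1)"
    and "0 < t \<Longrightarrow> t < \<epsilon> / 2 \<Longrightarrow> \<bar>x\<bar> \<le> t \<Longrightarrow> \<bar>F x - F' x\<bar> \<le> 2 * K * t ^ (N + 1)"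
    and "0 < t \<Longrightarrow> t < \<epsilon> / 2 \<Longrightarrow> \<bar>x\<bar> \<le> t \<Longrightarrow> \<bar>deriv F x - deriv F' x\<bar> \<le> 2 * K * 2 ^ (N + 1) * t ^ N"
proof -
  interpret G: nilpotent_germ X Y F cX cY r by (rule germ)
  interpret G': nilpotent_germ X' Y' F' cX' cY' r by (rule germ')
  note \<epsilon> = G.\<epsilon>[OF branch]
  show diff: "cmod (Fc z - Fc' z) \<le> 2 * K * cmod z ^ (N + 1)" if z: "z \<in> ball 0 \<epsilon>" for z
  proof -
    have le: "cmod (Fc z) \<le> cmod z" "cmod (Fc' z) \<le> cmod z"
      using G.Fc_le[OF branch z] G'.Fc_le[OF branch' z] by auto
    have "cmod (double_series cX z (Fc z) - double_series cX z (Fc' z)) \<le> 1 / 2 * cmod (Fc z - Fc' z)"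
      by (rule double_series_contraction[OF G.summable_X G.order_X \<epsilon>(1) _ \<epsilon>(4)]) (use z le \<epsilon> in auto)
    moreover have "cmod (double_series cX z (Fc' z) - double_series cX' z (Fc' z)) \<le> K * cmod z ^ (N + 1)"
      by (rule K(2)[rule_format]) (use le z \<epsilon> in auto)
    moreover have "Fc z - Fc' z = - ((double_series cX z (Fc z) - double_series cX z (Fc' z))
        + (double_series cX z (Fc' z) - double_series cX' z (Fc' z)))"
      using G.Fc_eq[OF branch z] G'.Fc_eq[OF branch' z] by (simp add: add_eq_0_iff)
    then have "cmod (Fc z - Fc' z) \<le> cmod (double_series cX z (Fc z) - double_series cX z (Fc' z))
        + cmod (double_series cX z (Fc' z) - double_series cX' z (Fc' z))"
      by (metis norm_minus_cancel norm_triangle_ineq)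
    ultimately show ?thesis by linarith
  qed
  have mono: "2 * K * s ^ (N + 1) \<le> 2 * K * t ^ (N + 1)" if "0 \<le> s" "s \<le> t" for s t
    using that K(1) by (intro mult_left_mono power_mono) auto
  fix t x :: real assume t: "0 < t" "t < \<epsilon> / 2" and x: "\<bar>x\<bar> \<le> t"
  have x\<epsilon>: "\<bar>x\<bar> < \<epsilon>" using t x by simp
  have "cmod (Fc (of_real x) - Fc' (of_real x)) \<le> 2 * K * t ^ (N + 1)"
    using diff[of "of_real x"] mono[of "\<bar>x\<bar>" t] x x\<epsilon> by auto
  then have "cmod (of_real (F x - F' x)) \<le> 2 * K * t ^ (N + 1)"
    by (simp add: G.Fc_real[OF branch x\<epsilon>] G'.Fc_real[OF branch' x\<epsilon>])
  then show "\<bar>F x - F' x\<bar> \<le> 2 * K * t ^ (N + 1)" by (simp only: norm_of_real)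
  let ?x = "complex_of_real x"
  have sub: "cball ?x t \<subseteq> ball 0 \<epsilon>" and in2: "z \<in> cball ?x t \<Longrightarrow> cmod z \<le> 2 * t" for z
  proof -
    show in2: "cmod z \<le> 2 * t" if "z \<in> cball ?x t" for z
      using that x norm_triangle_ineq[of ?x "z - ?x"] by (auto simp: dist_norm norm_minus_commute)
    show "cball ?x t \<subseteq> ball 0 \<epsilon>" using in2 t by fastforce
  qed
  have hol: "(\<lambda>z. Fc z - Fc' z) holomorphic_on ball 0 \<epsilon>"
    by (intro holomorphic_intros G.Fc_holomorphic[OF branch] G'.Fc_holomorphic[OF branch'])
  have hol': "(\<lambda>z. Fc z - Fc' z) holomorphic_on cball ?x t" by (rule holomorphic_on_subset[OF hol sub])
  have "cmod ((deriv ^^ 1) (\<lambda>z. Fc z - Fc' z) ?x) \<le> fact 1 * (2 * K * (2 * t) ^ (N + 1)) / t ^ 1"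
  proof (rule Cauchy_inequality[OF _ holomorphic_on_imp_continuous_on[OF hol'] t(1)])
    show "(\<lambda>z. Fc z - Fc' z) holomorphic_on ball ?x t"
      by (rule holomorphic_on_subset[OF hol' ball_subset_cball])
    fix z assume "cmod (?x - z) = t"
    then have z: "z \<in> cball ?x t" by (simp add: dist_norm)
    show "cmod (Fc z - Fc' z) \<le> 2 * K * (2 * t) ^ (N + 1)"
      using order_trans[OF diff mono[OF norm_ge_zero in2[OF z]]] sub z by blast
  qed
  also have "(deriv ^^ 1) (\<lambda>z. Fc z - Fc' z) ?x = deriv Fc ?x - deriv Fc' ?x"
    using x\<epsilon> by (auto intro!: deriv_diff holomorphic_on_imp_differentiable_at[OF G.Fc_holomorphic[OF branch]]
        holomorphic_on_imp_differentiable_at[OF G'.Fc_holomorphic[OF branch']])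
  also have "\<dots> = of_real (deriv F x - deriv F' x)"
    by (simp add: G.F_derivative(2)[OF branch x\<epsilon>] G'.F_derivative(2)[OF branch' x\<epsilon>])
  also have "fact 1 * (2 * K * (2 * t) ^ (N + 1)) / t ^ 1 = 2 * K * 2 ^ (N + 1) * t ^ N"
    using t by (simp add: power_mult_distrib)
  finally show "\<bar>deriv F x - deriv F' x\<bar> \<le> 2 * K * 2 ^ (N + 1) * t ^ N"
    by (simp only: norm_of_real)
qed

text \<open>
The derivatives of the two branches agree only to order \<open>N\<close>; the lost power is recovered because
they are multiplied by \<open>U\<close>, which is \<open>O(t)\<close>.
\<close>

lemma field_difference:
  assumes germ: "nilpotent_germ X Y F cX cY r" and germ': "nilpotent_germ X' Y' F' cX' cY' r"
    and branch: "nilpotent_germ.branch F cX r \<epsilon> Fc" and branch': "nilpotent_germ.branch F' cX' r \<epsilon> Fc'"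
    and agree: "\<And>i j. i + j \<le> N \<Longrightarrow> cX i j = cX' i j" "\<And>i j. i + j \<le> N \<Longrightarrow> cY i j = cY' i j"
  obtains C where "C \<ge> 0"
    "\<And>t x w. 0 < t \<Longrightarrow> t < \<epsilon> / 2 \<Longrightarrow> \<bar>x\<bar> \<le> t \<Longrightarrow> \<bar>w\<bar> \<le> t \<Longrightarrow>
       \<bar>nilpotent_germ.U X F x w - nilpotent_germ.U X' F' x w\<bar> \<le> C * t ^ (N + 1)"
    "\<And>t x w. 0 < t \<Longrightarrow> t < \<epsilon> / 2 \<Longrightarrow> \<bar>x\<bar> \<le> t \<Longrightarrow> \<bar>w\<bar> \<le> t \<Longrightarrow>
       \<bar>nilpotent_germ.V X Y F x w - nilpotent_germ.V X' Y' F' x w\<bar> \<le> C * t ^ (N + 1)"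
proof -
  interpret G: nilpotent_germ X Y F cX cY r by (rule germ)
  interpret G': nilpotent_germ X' Y' F' cX' cY' r by (rule germ')
  note \<epsilon> = G.\<epsilon>[OF branch]
  obtain KX where KX: "KX \<ge> 0" "\<forall>a b s. cmod a \<le> s \<and> cmod b \<le> s \<and> s \<le> r \<longrightarrow>
        cmod (double_series cX a b - double_series cX' a b) \<le> KX * s ^ (N + 1)"
    using norm_double_series_diff_le[of cX r cX' N, OF G.summable_X G'.summable_X G.r agree(1)] by blast
  obtain KY where KY: "KY \<ge> 0" "\<forall>a b s. cmod a \<le> s \<and> cmod b \<le> s \<and> s \<le> r \<longrightarrow>
        cmod (double_series cY a b - double_series cY' a b) \<le> KY * s ^ (N + 1)"
    using norm_double_series_diff_le[of cY r cY' N, OF G.summable_Y G'.summable_Y G.r agree(2)] by blast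
  note diff = branch_difference[OF germ germ' branch branch' KX]
  define MX' MY where "MX' = suminf (double_majorant cX' r)" and "MY = suminf (double_majorant cY r)"
  have M: "MX' \<ge> 0" "MY \<ge> 0" using G'.MX_nonneg G.MY_nonneg by (simp_all add: MX'_def MY_def)
  define CF where "CF = 2 * KX"
  define CF' where "CF' = 2 * KX * 2 ^ (N + 1)"
  define CU where "CU = 2 * CF + KX * 2 ^ (N + 1)"
  define CV where "CV = MY / \<epsilon> * CF + KY * 2 ^ (N + 1) + 2 * CU + CF' * (2 + 2 * MX' / r)"
  have C: "CF \<ge> 0" "CF' \<ge> 0" "CU \<ge> 0" "CV \<ge> 0"
    using KX KY M \<epsilon> G.r by (simp_all add: CF_def CF'_def CU_def CV_def)
  have main: "\<bar>G.U x w - G'.U x w\<bar> \<le> CU * t ^ (N + 1)" "\<bar>G.V x w - G'.V x w\<bar> \<le> CV * t ^ (N + 1)"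
    if t: "0 < t" "t < \<epsilon> / 2" and x: "\<bar>x\<bar> \<le> t" and w: "\<bar>w\<bar> \<le> t" for t x w
  proof -
    define y y' where "y = F x + w" and "y' = F' x + w"
    have x\<epsilon>: "\<bar>x\<bar> < \<epsilon>" "\<bar>x\<bar> < \<epsilon> / 2" using t x by auto
    have y: "\<bar>y\<bar> \<le> 2 * t" "\<bar>y'\<bar> \<le> 2 * t"
      using G.F_le[OF branch x\<epsilon>(1)] G'.F_le[OF branch' x\<epsilon>(1)] w x unfolding y_def y'_def by linarith+
    have r: "\<bar>x\<bar> \<le> r" "\<bar>y\<bar> \<le> r" "\<bar>y'\<bar> \<le> r" "2 * t \<le> r" using x y t \<epsilon> by auto
    have yy: "\<bar>y - y'\<bar> \<le> CF * t ^ (N + 1)"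
      using diff(2)[OF t x] by (simp add: y_def y'_def CF_def)
    have X1: "\<bar>X x y - X x y'\<bar> \<le> 1 / 2 * \<bar>y - y'\<bar>"
    proof -
      have "cmod (double_series cX (of_real x) (of_real y) - double_series cX (of_real x) (of_real y'))
          \<le> 1 / 2 * cmod (of_real y - of_real y')"
        by (rule double_series_contraction[OF G.summable_X G.order_X \<epsilon>(1) _ \<epsilon>(4)]) (use x y t \<epsilon> in auto)
      then show ?thesis
        unfolding G.X_eq[OF r(1,2)] G.X_eq[OF r(1,3)] of_real_diff[symmetric] norm_of_real .
    qed
    have X2: "\<bar>X x y' - X' x y'\<bar> \<le> KX * (2 * t) ^ (N + 1)"
    proof -
      have "cmod (double_series cX (of_real x) (of_real y') - double_series cX' (of_real x) (of_real y')) \<le> KX * (2 * t) ^ (N + 1)"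
        by (rule KX(2)[rule_format]) (use x y t r in auto)
      then show ?thesis
        unfolding G.X_eq[OF r(1,3)] G'.X_eq[OF r(1,3)] of_real_diff[symmetric] norm_of_real .
    qed
    have Y1: "\<bar>Y x y - Y x y'\<bar> \<le> MY / \<epsilon> * \<bar>y - y'\<bar>"
    proof -
      have "cmod (double_series cY (of_real x) (of_real y) - double_series cY (of_real x) (of_real y'))
          \<le> (2 * \<epsilon> / r) ^ 0 * suminf (double_majorant cY r) / \<epsilon> * cmod (of_real y - of_real y')"
        by (rule double_series_lipschitz[OF G.summable_Y _ \<epsilon>(1)]) (use x y t \<epsilon> in auto)
      then show ?thesis
        unfolding G.Y_eq[OF r(1,2)] G.Y_eq[OF r(1,3)] of_real_diff[symmetric] norm_of_real MY_def by simp
    qed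
    have Y2: "\<bar>Y x y' - Y' x y'\<bar> \<le> KY * (2 * t) ^ (N + 1)"
    proof -
      have "cmod (double_series cY (of_real x) (of_real y') - double_series cY' (of_real x) (of_real y')) \<le> KY * (2 * t) ^ (N + 1)"
        by (rule KY(2)[rule_format]) (use x y t r in auto)
      then show ?thesis
        unfolding G.Y_eq[OF r(1,3)] G'.Y_eq[OF r(1,3)] of_real_diff[symmetric] norm_of_real .
    qed
    define T where "T = t ^ (N + 1)"
    have T: "T > 0" using t by (simp add: T_def)
    have two: "(2 * t) ^ (N + 1) = 2 ^ (N + 1) * T" by (simp only: power_mult_distrib T_def)
    have split: "G.U x w - G'.U x w = (y - y') + (X x y - X x y') + (X x y' - X' x y')"
      by (simp add: G.U_def G'.U_def y_def y'_def)
    have yT: "\<bar>y - y'\<bar> \<le> CF * T" using yy unfolding T_def .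
    have "1 / 2 * \<bar>y - y'\<bar> \<le> \<bar>y - y'\<bar>" by simp
    with X1 yT have XT: "\<bar>X x y - X x y'\<bar> \<le> CF * T" by (meson order_trans)
    have "\<bar>G.U x w - G'.U x w\<bar> \<le> \<bar>y - y'\<bar> + \<bar>X x y - X x y'\<bar> + \<bar>X x y' - X' x y'\<bar>"
      unfolding split by linarith
    also have "\<dots> \<le> CF * T + CF * T + KX * (2 ^ (N + 1) * T)"
      by (intro add_mono yT XT X2[unfolded two])
    also have "\<dots> = CU * T" by (simp add: CU_def algebra_simps)
    finally show U: "\<bar>G.U x w - G'.U x w\<bar> \<le> CU * t ^ (N + 1)" unfolding T_def .
    have U': "\<bar>G'.U x w\<bar> \<le> (2 + 2 * MX' / r) * t"
    proof -
      have "cmod (double_series cX' (of_real x) (of_real y')) \<le> (2 * t / r) ^ 1 * suminf (double_majorant cX' r)"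
        by (rule norm_double_series_le[OF G'.summable_X G.r]) (use x y t r G'.order_X in auto)
      then have "\<bar>X' x y'\<bar> \<le> 2 * t / r * MX'"
        unfolding G'.X_eq[OF r(1,3)] norm_of_real MX'_def by simp
      moreover have "G'.U x w = y' + X' x y'" by (simp add: G'.U_def y'_def)
      ultimately have "\<bar>G'.U x w\<bar> \<le> 2 * t + 2 * t / r * MX'" using y(2) by linarith
      then show ?thesis by (simp add: algebra_simps)
    qed
    have p1: "\<bar>deriv F x * (G.U x w - G'.U x w)\<bar> \<le> 2 * (CU * T)"
      unfolding abs_mult by (rule mult_mono[OF G.deriv_F_le[OF branch x\<epsilon>(2)]]) (use U in \<open>auto simp: T_def\<close>)
    have "\<bar>(deriv F x - deriv F' x) * G'.U x w\<bar> \<le> (CF' * t ^ N) * ((2 + 2 * MX' / r) * t)"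
      unfolding abs_mult
      by (rule mult_mono[OF _ U']) (use diff(3)[OF t x] C t in \<open>auto simp: CF'_def\<close>)
    also have "\<dots> = CF' * (2 + 2 * MX' / r) * T" by (simp add: T_def)
    finally have p2: "\<bar>(deriv F x - deriv F' x) * G'.U x w\<bar> \<le> CF' * (2 + 2 * MX' / r) * T" .
    have "MY / \<epsilon> * \<bar>y - y'\<bar> \<le> MY / \<epsilon> * (CF * T)"
      using yy M \<epsilon> by (intro mult_left_mono) (auto simp: T_def)
    with Y1 have Y1': "\<bar>Y x y - Y x y'\<bar> \<le> MY / \<epsilon> * (CF * T)" by linarith
    have "G.V x w - G'.V x w = (Y x y - Y x y') + (Y x y' - Y' x y')
        - deriv F x * (G.U x w - G'.U x w) - (deriv F x - deriv F' x) * G'.U x w"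
      unfolding G.V_def G'.V_def y_def y'_def by (simp add: algebra_simps)
    then have "\<bar>G.V x w - G'.V x w\<bar>
        \<le> MY / \<epsilon> * (CF * T) + KY * (2 ^ (N + 1) * T) + 2 * (CU * T) + CF' * (2 + 2 * MX' / r) * T"
      using Y1' Y2 p1 p2 unfolding two by linarith
    also have "\<dots> = CV * T" by (simp add: CV_def algebra_simps)
    finally show "\<bar>G.V x w - G'.V x w\<bar> \<le> CV * t ^ (N + 1)" unfolding T_def .
  qed
  show ?thesis
  proof (rule that[of "CU + CV"])
    show "CU + CV \<ge> 0" using C by simp
    fix t x w :: real assume *: "0 < t" "t < \<epsilon> / 2" "\<bar>x\<bar> \<le> t" "\<bar>w\<bar> \<le> t"
    have "t ^ (N + 1) \<ge> 0" using * by simp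
    then have "CU * t ^ (N + 1) \<le> (CU + CV) * t ^ (N + 1)" "CV * t ^ (N + 1) \<le> (CU + CV) * t ^ (N + 1)"
      using C by (auto intro!: mult_right_mono)
    then show "\<bar>G.U x w - G'.U x w\<bar> \<le> (CU + CV) * t ^ (N + 1)"
      "\<bar>G.V x w - G'.V x w\<bar> \<le> (CU + CV) * t ^ (N + 1)"
      using main[OF *] by linarith+
  qed
qed

section \<open>Taylor coefficients of analytic right-hand sides\<close>

lemma real_power_series_higher_deriv:
  fixes f :: "real \<Rightarrow> real"
  assumes "r > 0" and "\<And>x. \<bar>x\<bar> < r \<Longrightarrow> (\<lambda>k. a k * x ^ k) sums f x"
  shows "(deriv ^^ k) f 0 = fact k * a k"
  using assms(2)
proof (induction k arbitrary: f a)
  case 0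
  then show ?case using sums_unique2[OF 0[of 0] powser_sums_zero[of a]] \<open>r > 0\<close> by simp
next
  case (Suc k)
  have sm: "summable (\<lambda>n. a n * x ^ n)" if "\<bar>x\<bar> < r" for x using Suc.prems[OF that] by (rule sums_summable)
  have deriv: "deriv f x = (\<Sum>n. diffs a n * x ^ n)" "(\<lambda>n. diffs a n * x ^ n) sums deriv f x" if x: "\<bar>x\<bar> < r" for x
  proof -
    obtain K where K: "\<bar>x\<bar> < K" "K < r" using dense x by blast
    have d: "((\<lambda>x. \<Sum>n. a n * x ^ n) has_real_derivative (\<Sum>n. diffs a n * x ^ n)) (at x)"
      by (rule termdiffs_strong[OF sm[of K]]) (use K in auto)
    have "\<forall>\<^sub>F u in nhds x. u \<in> {-r<..<r}"
      by (rule eventually_nhds_in_open) (use x in auto)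
    then have ev: "\<forall>\<^sub>F u in nhds x. (\<Sum>n. a n * u ^ n) = f u"
      by eventually_elim (use sums_unique[OF Suc.prems] in auto)
    have "(f has_real_derivative (\<Sum>n. diffs a n * x ^ n)) (at x)"
      using d DERIV_cong_ev[OF refl ev refl] by simp
    then show *: "deriv f x = (\<Sum>n. diffs a n * x ^ n)" by (rule DERIV_imp_deriv)
    have "summable (\<lambda>n. diffs a n * x ^ n)"
      by (rule termdiff_converges[of x r]) (use x sm in auto)
    then show "(\<lambda>n. diffs a n * x ^ n) sums deriv f x" unfolding * by (rule summable_sums)
  qed
  have "(deriv ^^ Suc k) f 0 = (deriv ^^ k) (deriv f) 0" by (simp add: funpow_swap1)
  also have "\<dots> = fact k * diffs a k" by (rule Suc.IH[OF deriv(2)])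
  finally show ?case by (simp add: diffs_def)
qed

text \<open>
At points with unchanged parameter, all terms containing a power of a parameter coordinate
vanish. The remaining multi-indices correspond to pairs \<open>(i, j)\<close>.
\<close>

lemma double_series_of_multiindex_series:
  fixes h :: "real \<times> real \<times> (real^'m) \<Rightarrow> real"
  assumes "real_analytic_at h (0, 0, \<delta>)"
  obtains c r where "r > 0"
    "\<And>x y. \<bar>x\<bar> \<le> r \<Longrightarrow> \<bar>y\<bar> \<le> r \<Longrightarrow>
       ((\<lambda>(i, j). c i j * x ^ i * y ^ j) has_sum h (x, y, \<delta>)) (UNIV :: (nat \<times> nat) set)"
proof -
  let ?B = "Basis :: (real \<times> real \<times> (real^'m)) set"
  obtain c0 r0 where r0: "r0 > 0" and sum: "\<And>z. z \<in> ball (0, 0, \<delta>) r0 \<Longrightarrow>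
      ((\<lambda>\<alpha>. c0 \<alpha> * (\<Prod>b\<in>?B. ((z - (0, 0, \<delta>)) \<bullet> b) ^ \<alpha> b)) has_sum h z) (?B \<rightarrow>\<^sub>E (UNIV :: nat set))"
    using assms unfolding real_analytic_at_def by blast
  define b1 b2 where "b1 = (1 :: real, 0 :: real, 0 :: real^'m)" and "b2 = (0 :: real, 1 :: real, 0 :: real^'m)"
  have B: "?B = {b1, b2} \<union> (\<lambda>e. (0, 0, e)) ` Basis"
    by (auto simp: Basis_prod_def b1_def b2_def image_image zero_prod_def)
  have ne: "b1 \<noteq> b2" by (simp add: b1_def b2_def)
  define \<iota> where "\<iota> = (\<lambda>(i, j). restrict (\<lambda>b. if b = b1 then i else if b = b2 then j else (0::nat)) ?B)"
  have inB: "b1 \<in> ?B" "b2 \<in> ?B" using B by auto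
  have \<iota>: "\<iota> (i, j) b1 = i" "\<iota> (i, j) b2 = j" "b \<in> ?B \<Longrightarrow> b \<noteq> b1 \<Longrightarrow> b \<noteq> b2 \<Longrightarrow> \<iota> (i, j) b = 0" for i j b
    using inB ne by (auto simp: \<iota>_def)
  have inj: "inj \<iota>"
    by (rule injI) (metis \<iota>(1,2) prod.collapse)
  show ?thesis
  proof (rule that[of "r0 / 3" "\<lambda>i j. c0 (\<iota> (i, j))"])
    fix x y :: real assume xy: "\<bar>x\<bar> \<le> r0 / 3" "\<bar>y\<bar> \<le> r0 / 3"
    define z where "z = (x, y, \<delta>)"
    have z: "z - (0, 0, \<delta>) = (x, y, 0)" by (simp add: z_def)
    have "norm (x, y, 0 :: real^'m) \<le> \<bar>x\<bar> + \<bar>y\<bar>"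
      using norm_Pair_le[of x "(y, 0 :: real^'m)"] by simp
    then have "z \<in> ball (0, 0, \<delta>) r0"
      using xy r0 z by (simp add: dist_norm norm_minus_commute[of _ z])
    from sum[OF this] have s: "((\<lambda>\<alpha>. c0 \<alpha> * (\<Prod>b\<in>?B. ((x, y, 0) \<bullet> b) ^ \<alpha> b)) has_sum h (x, y, \<delta>)) (?B \<rightarrow>\<^sub>E UNIV)"
      unfolding z by (simp add: z_def)
    have inner: "(x, y, 0 :: real^'m) \<bullet> b1 = x" "(x, y, 0 :: real^'m) \<bullet> b2 = y"
      "b \<in> ?B \<Longrightarrow> b \<noteq> b1 \<Longrightarrow> b \<noteq> b2 \<Longrightarrow> (x, y, 0 :: real^'m) \<bullet> b = 0" for b
      using B by (auto simp: b1_def b2_def)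
    have prod: "(\<Prod>b\<in>?B. ((x, y, 0 :: real^'m) \<bullet> b) ^ \<iota> (i, j) b) = x ^ i * y ^ j" for i j
    proof -
      have "(\<Prod>b\<in>?B. ((x, y, 0 :: real^'m) \<bullet> b) ^ \<iota> (i, j) b) = (\<Prod>b\<in>{b1, b2}. ((x, y, 0 :: real^'m) \<bullet> b) ^ \<iota> (i, j) b)"
        by (rule prod.mono_neutral_right) (use inB \<iota>(3) in auto)
      then show ?thesis using ne by (simp add: inner \<iota>)
    qed
    have outside: "(\<Prod>b\<in>?B. ((x, y, 0 :: real^'m) \<bullet> b) ^ \<alpha> b) = 0"
      if \<alpha>: "\<alpha> \<in> (?B \<rightarrow>\<^sub>E UNIV) - range \<iota>" for \<alpha> :: "_ \<Rightarrow> nat"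
    proof -
      have "\<exists>b\<in>?B. b \<noteq> b1 \<and> b \<noteq> b2 \<and> \<alpha> b \<noteq> 0"
      proof (rule ccontr)
        assume "\<not> ?thesis"
        then have "\<alpha> = \<iota> (\<alpha> b1, \<alpha> b2)"
          using \<alpha> by (auto simp: \<iota>_def fun_eq_iff PiE_iff extensional_def restrict_def)
        then show False using \<alpha> by blast
      qed
      then obtain b where b: "b \<in> ?B" "b \<noteq> b1" "b \<noteq> b2" "\<alpha> b \<noteq> 0" by blast
      then have "((x, y, 0 :: real^'m) \<bullet> b) ^ \<alpha> b = 0" by (simp add: inner(3) power_0_left)
      then show ?thesis using b(1) by (auto intro: prod_zero)
    qed
    have range: "range \<iota> \<subseteq> ?B \<rightarrow>\<^sub>E UNIV" by (auto simp: \<iota>_def)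
    have "((\<lambda>\<alpha>. c0 \<alpha> * (\<Prod>b\<in>?B. ((x, y, 0) \<bullet> b) ^ \<alpha> b)) has_sum h (x, y, \<delta>)) (range \<iota>)"
      using s by (rule has_sum_cong_neutral[THEN iffD1, rotated 3]) (use range outside in auto)
    then have "((\<lambda>\<alpha>. c0 \<alpha> * (\<Prod>b\<in>?B. ((x, y, 0) \<bullet> b) ^ \<alpha> b)) \<circ> \<iota> has_sum h (x, y, \<delta>)) UNIV"
      by (simp add: has_sum_reindex[OF inj])
    also have "(\<lambda>\<alpha>. c0 \<alpha> * (\<Prod>b\<in>?B. ((x, y, 0) \<bullet> b) ^ \<alpha> b)) \<circ> \<iota> = (\<lambda>(i, j). c0 (\<iota> (i, j)) * x ^ i * y ^ j)"
      by (auto simp: fun_eq_iff prod)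
    finally show "((\<lambda>(i, j). c0 (\<iota> (i, j)) * x ^ i * y ^ j) has_sum h (x, y, \<delta>)) UNIV" .
  qed (use r0 in auto)
qed

lemma double_series_sum:
  fixes Z :: "real \<Rightarrow> real \<Rightarrow> real"
  assumes r: "r > 0" and sum: "\<And>x y. \<bar>x\<bar> \<le> r \<Longrightarrow> \<bar>y\<bar> \<le> r \<Longrightarrow>
       ((\<lambda>(i, j). c i j * x ^ i * y ^ j) has_sum Z x y) (UNIV :: (nat \<times> nat) set)"
  shows "summable (double_majorant c r)"
    and "\<bar>x\<bar> \<le> r \<Longrightarrow> \<bar>y\<bar> \<le> r \<Longrightarrow> double_series c (of_real x) (of_real y) = of_real (Z x y)"
proof -
  have bij: "bij_betw prod_decode UNIV UNIV" using bij_prod_decode by simp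
  have reindex: "((\<lambda>k. c (idx1 k) (idx2 k) * x ^ idx1 k * y ^ idx2 k) has_sum Z x y) UNIV"
    if "\<bar>x\<bar> \<le> r" "\<bar>y\<bar> \<le> r" for x y
    using has_sum_reindex_bij_betw[OF bij, THEN iffD2, OF sum[OF that]] by (simp add: case_prod_unfold)
  have "(\<lambda>k. c (idx1 k) (idx2 k) * r ^ idx1 k * r ^ idx2 k) summable_on UNIV"
    using reindex[of r r] r by (auto simp: summable_on_def)
  then have "(\<lambda>k. norm (c (idx1 k) (idx2 k) * r ^ idx1 k * r ^ idx2 k)) summable_on UNIV"
    by (rule summable_on_iff_abs_summable_on_real[THEN iffD1])
  then have "summable (\<lambda>k. norm (c (idx1 k) (idx2 k) * r ^ idx1 k * r ^ idx2 k))"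
    by (rule summable_on_imp_summable)
  also have "(\<lambda>k. norm (c (idx1 k) (idx2 k) * r ^ idx1 k * r ^ idx2 k)) = double_majorant c r"
    using r by (auto simp: double_majorant_def fun_eq_iff abs_mult power_add)
  finally show sm: "summable (double_majorant c r)" .
  assume xy: "\<bar>x\<bar> \<le> r" "\<bar>y\<bar> \<le> r"
  have "double_term c (of_real x) (of_real y) = (\<lambda>k. of_real (c (idx1 k) (idx2 k) * x ^ idx1 k * y ^ idx2 k))"
    by (auto simp: double_term_def)
  moreover have "(\<lambda>k. complex_of_real (c (idx1 k) (idx2 k) * x ^ idx1 k * y ^ idx2 k)) sums of_real (Z x y)"
    by (rule sums_of_real[OF has_sum_imp_sums[OF reindex[OF xy]]])
  ultimately have "double_term c (of_real x) (of_real y) sums of_real (Z x y)" by (simp only:)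
  then show "double_series c (of_real x) (of_real y) = of_real (Z x y)"
    unfolding double_series_def by (rule sums_unique[symmetric])
qed

text \<open>
Summing by columns gives, for each small \<open>x\<close>, a power series in \<open>y\<close>; its \<open>j\<close>-th coefficient is in
turn a power series in \<open>x\<close>.
\<close>

lemma double_series_coefficient:
  fixes Z :: "real \<Rightarrow> real \<Rightarrow> real"
  assumes r: "r > 0" and sum: "\<And>x y. \<bar>x\<bar> \<le> r \<Longrightarrow> \<bar>y\<bar> \<le> r \<Longrightarrow>
       ((\<lambda>(i, j). c i j * x ^ i * y ^ j) has_sum Z x y) (UNIV :: (nat \<times> nat) set)"
  shows "(deriv ^^ i) (\<lambda>x. (deriv ^^ j) (\<lambda>y. Z x y) 0) 0 / (fact i * fact j) = c i j"
proof -
  define e where "e = (\<lambda>j x. infsum (\<lambda>i. c i j * x ^ i) UNIV)"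
  have swap: "((\<lambda>(j, i). c i j * x ^ i * y ^ j) has_sum Z x y) (UNIV \<times> UNIV)"
    if "\<bar>x\<bar> \<le> r" "\<bar>y\<bar> \<le> r" for x y
    using has_sum_swap[where f = "\<lambda>(i, j). c i j * x ^ i * y ^ j" and A = UNIV and B = UNIV] sum[OF that]
    by (simp add: case_prod_unfold)
  have row: "((\<lambda>i. c i j * x ^ i) has_sum e j x) UNIV" if x: "\<bar>x\<bar> \<le> r" for j x
  proof -
    have "(\<lambda>(j, i). c i j * x ^ i * r ^ j) summable_on (UNIV \<times> UNIV)"
      using swap[OF x, of r] r by (auto simp: summable_on_def)
    then have "(\<lambda>i. c i j * x ^ i * r ^ j) summable_on UNIV"
      by (rule summable_on_SigmaD1[where x = j]) simp
    then have "(\<lambda>i. (c i j * x ^ i * r ^ j) * inverse (r ^ j)) summable_on UNIV"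
      by (rule summable_on_cmult_left)
    then have "(\<lambda>i. c i j * x ^ i) summable_on UNIV" using r by (simp add: mult.assoc)
    then show ?thesis unfolding e_def by (rule has_sum_infsum)
  qed
  have col: "(\<lambda>j. e j x * y ^ j) sums Z x y" if "\<bar>x\<bar> \<le> r" "\<bar>y\<bar> \<le> r" for x y
  proof (rule has_sum_imp_sums, rule has_sum_SigmaD[OF swap[OF that]])
    show "((\<lambda>i. case (j, i) of (j, i) \<Rightarrow> c i j * x ^ i * y ^ j) has_sum e j x * y ^ j) UNIV" for j
      using has_sum_cmult_left[OF row[OF that(1), of j], of "y ^ j"] by simp
  qed
  have inner: "(deriv ^^ j) (\<lambda>y. Z x y) 0 = fact j * e j x" if "\<bar>x\<bar> < r" for x
    by (rule real_power_series_higher_deriv[OF r]) (use col that in auto)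
  have "\<forall>\<^sub>F x in nhds 0. x \<in> {-r<..<r}"
    by (rule eventually_nhds_in_open) (use r in auto)
  then have "\<forall>\<^sub>F x in nhds 0. (deriv ^^ j) (\<lambda>y. Z x y) 0 = fact j * e j x"
    by eventually_elim (auto intro: inner)
  then have "(deriv ^^ i) (\<lambda>x. (deriv ^^ j) (\<lambda>y. Z x y) 0) 0 = (deriv ^^ i) (\<lambda>x. fact j * e j x) 0"
    by (rule higher_deriv_cong_ev) simp
  also have "\<dots> = fact i * (fact j * c i j)"
  proof (rule real_power_series_higher_deriv[OF r])
    show "(\<lambda>i. fact j * c i j * x ^ i) sums (fact j * e j x)" if "\<bar>x\<bar> < r" for x
      using sums_mult[OF has_sum_imp_sums[OF row[of x j]], of "fact j"] that by (simp add: mult.assoc)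
  qed
  finally show ?thesis by simp
qed

section \<open>From the return map to first returns\<close>

lemma at_right_scaled: "filterlim (\<lambda>t. t * c) (nhds 0) (at_right (0::real))"
  by (auto intro!: tendsto_eq_intros)

lemma scaled_limit_of_order:
  fixes h R :: "real \<Rightarrow> real"
  assumes R: "R \<in> O[nhds 0](\<lambda>x. x)" and h: "\<forall>\<^sub>F x in nhds 0. h x = x ^ m * (a + R x)"
  shows "((\<lambda>t. h (t * c) / t ^ m) \<longlongrightarrow> a * c ^ m) (at_right 0)"
proof -
  obtain K where K: "\<forall>\<^sub>F x in nhds 0. norm (R x) \<le> K * norm x" using landau_o.bigE[OF R] by blast
  have "((\<lambda>t. R (t * c)) \<longlongrightarrow> 0) (at_right 0)"
  proof (rule Lim_null_comparison)
    show "\<forall>\<^sub>F t in at_right 0. norm (R (t * c)) \<le> K * norm (t * c)"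
      using eventually_compose_filterlim[OF K at_right_scaled] .
    show "((\<lambda>t. K * norm (t * c)) \<longlongrightarrow> 0) (at_right 0)"
      by (auto intro!: tendsto_eq_intros)
  qed
  then have "((\<lambda>t. c ^ m * (a + R (t * c))) \<longlongrightarrow> c ^ m * (a + 0)) (at_right 0)"
    by (intro tendsto_intros)
  moreover have "\<forall>\<^sub>F t in at_right 0. c ^ m * (a + R (t * c)) = h (t * c) / t ^ m"
    using eventually_compose_filterlim[OF h at_right_scaled, of c] eventually_at_right_less[of 0]
    by eventually_elim (simp add: power_mult_distrib)
  ultimately show ?thesis by (simp add: filterlim_cong[OF refl refl] mult.commute)
qed

text \<open>
The case \<open>c = 0\<close> is the reason for \<open>m \<ge> 1\<close>: then \<open>h 0 = 0\<close>, and both sides vanish.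
\<close>

lemma scaled_limit_of_fps:
  fixes h :: "real \<Rightarrow> real"
  assumes h: "h has_fps_expansion A" and vanish: "\<And>j. j < m \<Longrightarrow> fps_nth A j = 0" and m: "m \<ge> 1"
  shows "((\<lambda>t. h (t * c) / t ^ m) \<longlongrightarrow> fps_nth A m * c ^ m) (at_right 0)"
proof (cases "A = 0")
  case True
  have "\<forall>\<^sub>F x in nhds 0. eval_fps A x = h x" using h by (simp add: has_fps_expansion_def)
  then have "\<forall>\<^sub>F x in nhds 0. h x = x ^ m * (0 + (\<lambda>_. 0) x)"
    by eventually_elim (simp add: True)
  from scaled_limit_of_order[OF _ this, of c] show ?thesis by (simp add: True)
next
  case False
  have sub: "m \<le> subdegree A" by (rule subdegree_geI[OF False vanish])
  define q where "q = (\<lambda>x. if x = 0 then fps_nth A m else h x / x ^ m)"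
  have "q has_fps_expansion fps_shift m A"
    unfolding q_def by (rule has_fps_expansion_shift[OF h sub refl])
  then have "isCont q 0" by (rule has_fps_expansion_imp_continuous)
  then have "((\<lambda>t. q (t * c)) \<longlongrightarrow> q 0) (at_right 0)"
    by (rule isCont_tendsto_compose) (rule at_right_scaled)
  then have lim: "((\<lambda>t. c ^ m * q (t * c)) \<longlongrightarrow> c ^ m * fps_nth A m) (at_right 0)"
    by (intro tendsto_intros) (simp add: q_def)
  have h0: "h 0 = 0"
    using has_fps_expansion_imp_0_eq_fps_nth_0[OF h] vanish[of 0] m by simp
  have "\<forall>\<^sub>F t in at_right 0. c ^ m * q (t * c) = h (t * c) / t ^ m"
    using eventually_at_right_less[of 0]
    by eventually_elim (use m h0 in \<open>auto simp: q_def power_mult_distrib power_0_left\<close>)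
  with lim show ?thesis by (simp add: filterlim_cong[OF refl refl] mult.commute)
qed

lemma fps_coefficients_vanish_of_bound:
  fixes h :: "real \<Rightarrow> real"
  assumes h: "h has_fps_expansion A" and bound: "\<forall>\<^sub>F x in at_right 0. \<bar>h x\<bar> \<le> K * x ^ m" and j: "j < m"
  shows "fps_nth A j = 0"
proof (rule ccontr)
  assume nz: "fps_nth A j \<noteq> 0"
  define d where "d = subdegree A"
  have A: "A \<noteq> 0" using nz by auto
  have d: "d < m" using nz j by (metis d_def order_le_less_trans not_less nth_less_subdegree_zero)
  define q where "q = (\<lambda>x. if x = 0 then fps_nth A d else h x / x ^ d)"
  have "q has_fps_expansion fps_shift d A"
    unfolding q_def by (rule has_fps_expansion_shift[OF h]) (simp_all add: d_def)
  then have "isCont q 0" by (rule has_fps_expansion_imp_continuous)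
  then have "(q \<longlongrightarrow> fps_nth A d) (at 0)" by (simp add: isCont_def q_def)
  then have "(q \<longlongrightarrow> fps_nth A d) (at_right 0)" by (rule tendsto_within_subset) simp
  moreover have "(q \<longlongrightarrow> 0) (at_right 0)"
  proof (rule Lim_null_comparison)
    show "\<forall>\<^sub>F x in at_right 0. norm (q x) \<le> K * x ^ (m - d)"
      using bound eventually_at_right_less[of 0]
    proof eventually_elim
      case (elim x)
      have "K * x ^ m = K * x ^ (m - d) * x ^ d" using d by (simp add: mult.assoc flip: power_add)
      with elim(1) have "\<bar>h x\<bar> \<le> K * x ^ (m - d) * x ^ d" by (simp only:)
      then show ?case using elim(2) by (simp add: q_def abs_divide divide_le_eq)
    qed
    show "((\<lambda>x. K * x ^ (m - d)) \<longlongrightarrow> 0) (at_right 0)"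
      using d by (auto intro!: tendsto_eq_intros simp: power_0_left)
  qed
  ultimately have "fps_nth A d = 0" using tendsto_unique[OF trivial_limit_at_right_real] by blast
  then show False using A by (simp add: d_def)
qed

lemma deriv_zero_of_quadratic_bound:
  fixes h :: "real \<Rightarrow> real"
  assumes bound: "\<forall>\<^sub>F u in nhds 0. \<bar>h u\<bar> \<le> C * u\<^sup>2"
  shows "h 0 = 0" "deriv h 0 = 0"
proof -
  show h0: "h 0 = 0" using eventually_nhds_x_imp_x[OF bound] by simp
  have "((\<lambda>u. (h u - h 0) / (u - 0)) \<longlongrightarrow> 0) (at 0)"
  proof (rule Lim_null_comparison)
    have "\<forall>\<^sub>F u in at 0. \<bar>h u\<bar> \<le> C * u\<^sup>2" using bound by (simp add: eventually_at_filter eventually_mono)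
    then show "\<forall>\<^sub>F u in at 0. norm ((h u - h 0) / (u - 0)) \<le> C * \<bar>u\<bar>"
      using eventually_neq_at_within[of 0 0 UNIV]
    proof eventually_elim
      case (elim u)
      have "u\<^sup>2 = \<bar>u\<bar> * \<bar>u\<bar>" by (simp add: power2_eq_square)
      then show ?case using elim by (simp add: h0 abs_divide divide_le_eq)
    qed
    show "((\<lambda>u. C * \<bar>u\<bar>) \<longlongrightarrow> 0) (at 0)" by (auto intro!: tendsto_eq_intros)
  qed
  then have "(h has_real_derivative 0) (at 0)" by (simp add: has_field_derivative_iff)
  then show "deriv h 0 = 0" by (rule DERIV_imp_deriv)
qed

text \<open>
The quadratic bound, restricted to the two axes, shows that the value and the first partial
derivatives at the origin vanish.
\<close>

lemma higher_order_term_expansion: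
  fixes D :: "(real^'m) set"
  assumes ho: "higher_order_term D X" and \<delta>: "\<delta> \<in> D"
  obtains c r0 where "r0 > 0" "\<forall>i j. i + j < 2 \<longrightarrow> c i j = 0" "\<forall>i j. c i j = taylor_coeff X i j \<delta>"
    "\<forall>r x y. 0 < r \<and> r \<le> r0 \<longrightarrow> summable (double_majorant c r) \<and>
       (\<bar>x\<bar> \<le> r \<and> \<bar>y\<bar> \<le> r \<longrightarrow> double_series c (of_real x) (of_real y) = of_real (X x y \<delta>))"
proof -
  have "real_analytic_at (\<lambda>(x, y, \<delta>). X x y \<delta>) (0, 0, \<delta>)"
    using ho \<delta> unfolding higher_order_term_def real_analytic_on_def by auto
  then obtain c r0 where r0: "r0 > 0" and sum0: "\<And>x y. \<bar>x\<bar> \<le> r0 \<Longrightarrow> \<bar>y\<bar> \<le> r0 \<Longrightarrow>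
       ((\<lambda>(i, j). c i j * x ^ i * y ^ j) has_sum (\<lambda>(x, y, \<delta>). X x y \<delta>) (x, y, \<delta>)) (UNIV :: (nat \<times> nat) set)"
    by (rule double_series_of_multiindex_series) (rule that)
  note sum = sum0[unfolded prod.case]
  have coeff: "c i j = taylor_coeff X i j \<delta>" for i j
    unfolding taylor_coeff_def
    by (rule double_series_coefficient[of r0 c "\<lambda>x y. X x y \<delta>", OF r0 sum, symmetric])
  have smaller: "summable (double_majorant c r)"
    "\<bar>x\<bar> \<le> r \<Longrightarrow> \<bar>y\<bar> \<le> r \<Longrightarrow> double_series c (of_real x) (of_real y) = of_real (X x y \<delta>)"
    if "0 < r" "r \<le> r0" for r x y
    using double_series_sum[of r c "\<lambda>x y. X x y \<delta>", OF that(1) sum] that(2) by auto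
  obtain C where C: "\<forall>\<^sub>F z in nhds (0, 0) \<times>\<^sub>F principal D.
      norm ((\<lambda>((x, y), \<delta>). X x y \<delta>) z) \<le> C * norm ((\<lambda>((x, y), \<delta>). (norm (x, y))\<^sup>2) z)"
    using ho landau_o.bigE unfolding higher_order_term_def by blast
  then obtain P Q where PQ: "eventually P (nhds (0, 0))" "eventually Q (principal D)"
    "\<And>p d. P p \<Longrightarrow> Q d \<Longrightarrow> norm ((\<lambda>((x, y), \<delta>). X x y \<delta>) (p, d))
        \<le> C * norm ((\<lambda>((x, y), \<delta>). (norm (x, y))\<^sup>2) (p, d))"
    unfolding eventually_prod_filter by blast
  have "Q \<delta>" using PQ(2) \<delta> by (simp add: eventually_principal)
  then have near: "\<bar>X x y \<delta>\<bar> \<le> C * (norm (x, y))\<^sup>2" if "P (x, y)" for x y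
    using PQ(3)[OF that] by simp
  have "filterlim (\<lambda>u. (u, 0 :: real)) (nhds (0, 0)) (nhds (0 :: real))"
    "filterlim (\<lambda>u. (0 :: real, u)) (nhds (0, 0)) (nhds (0 :: real))"
    by (auto intro!: tendsto_Pair simp: filterlim_ident)
  then have evP: "\<forall>\<^sub>F u in nhds 0. P (u, 0)" "\<forall>\<^sub>F u in nhds 0. P (0, u)"
    using PQ(1) eventually_compose_filterlim by blast+
  have ev: "\<forall>\<^sub>F u in nhds 0. \<bar>X u 0 \<delta>\<bar> \<le> C * u\<^sup>2" "\<forall>\<^sub>F u in nhds 0. \<bar>X 0 u \<delta>\<bar> \<le> C * u\<^sup>2"
    by (rule eventually_mono[OF evP(1)], force dest: near simp: norm_Pair,
        rule eventually_mono[OF evP(2)], force dest: near simp: norm_Pair)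
  have low: "c i j = 0" if "i + j < 2" for i j
  proof -
    have "(i, j) = (0, 0) \<or> (i, j) = (1, 0) \<or> (i, j) = (0, 1)" using that by auto
    then show ?thesis
      unfolding coeff taylor_coeff_def
      using deriv_zero_of_quadratic_bound[OF ev(1)] deriv_zero_of_quadratic_bound[OF ev(2)] by auto
  qed
  show ?thesis by (rule that[of r0 c]) (use r0 low coeff smaller in auto)
qed

text \<open>
Let \<open>e\<close> be a size, fixed in advance, at which the orbit still lies in the region of the estimates,
and suppose that the orbit attains it, for the first time at \<open>T\<close>. It has not returned before
\<open>T\<close>, so its quasi-homogeneous norm at \<open>T\<close> is at most \<open>x0 * Z\<close> with a constant \<open>Z\<close>. For
\<open>x0 < e / (2 * Z)\<close> this contradicts the choice of \<open>T\<close>.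
\<close>

lemma small_return_is_first_return:
  assumes germ: "nilpotent_germ X Y F cX cY r" and branch: "nilpotent_germ.branch F cX r \<epsilon> Fc"
    and rot: "quasihomogeneous_rotation n (nilpotent_germ.U X F) (nilpotent_germ.V X Y F) R \<kappa> L"
    and R: "R \<le> \<epsilon> / 8"
  obtains \<eta> where "\<eta> > 0" "\<And>x y \<tau> x0. 0 < x0 \<Longrightarrow> x0 < \<eta> \<Longrightarrow> \<tau> > 0 \<Longrightarrow>
    \<forall>t\<in>{0..\<tau>}. (x has_real_derivative y t + X (x t) (y t)) (at t within {0..\<tau>}) \<and>
      (y has_real_derivative Y (x t) (y t)) (at t within {0..\<tau>}) \<Longrightarrow>
    x 0 = x0 \<Longrightarrow> y 0 = F x0 \<Longrightarrow> y \<tau> = F (x \<tau>) \<Longrightarrow> x0 * x \<tau> > 0 \<Longrightarrow>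
    \<forall>s\<in>{0<..<\<tau>}. \<not> (y s = F (x s) \<and> x0 * x s > 0) \<Longrightarrow>
    first_return n (nilpotent_germ.U X F) (nilpotent_germ.V X Y F) R x0 (x \<tau>)"
proof -
  interpret G: nilpotent_germ X Y F cX cY r by (rule germ)
  interpret Q: quasihomogeneous_rotation n G.U G.V R \<kappa> L by (rule rot)
  note \<epsilon> = G.\<epsilon>[OF branch]
  define Z where "Z = exp (Q.rate_bound * (4 * pi * n))"
  \<comment> \<open>\<open>\<bar>x\<bar> \<le> e\<close> and \<open>\<bar>y\<bar> \<le> e\<close> imply \<open>\<bar>w\<bar> \<le> 2 * e\<close>, and \<open>e\<^sup>2 + (2 * e)\<^sup>2\<close> is below \<open>R ^ (2 * n) = (3 * e)\<^sup>2\<close>.\<close>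
  define e where "e = R ^ n / 3"
  have Rn: "R ^ n \<le> R" using power_decreasing[of 1 n R] Q.n Q.R by simp
  have e: "0 < e" "e < R" "e < 1" "e < \<epsilon> / 2" using Q.R Rn R \<epsilon> by (auto simp: e_def)
  have Z: "Z > 0" by (simp add: Z_def)
  define \<eta> where "\<eta> = min e (e / (2 * Z))"
  show ?thesis
  proof (rule that[of \<eta>])
    show "\<eta> > 0" using e Z by (simp add: \<eta>_def)
    fix x y :: "real \<Rightarrow> real" and \<tau> x0 :: real
    assume x0: "0 < x0" "x0 < \<eta>" and \<tau>: "\<tau> > 0"
      and sol: "\<forall>t\<in>{0..\<tau>}. (x has_real_derivative y t + X (x t) (y t)) (at t within {0..\<tau>}) \<and>
        (y has_real_derivative Y (x t) (y t)) (at t within {0..\<tau>})"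
      and init: "x 0 = x0" "y 0 = F x0" and ret: "y \<tau> = F (x \<tau>)" "x0 * x \<tau> > 0"
      and first: "\<forall>s\<in>{0<..<\<tau>}. \<not> (y s = F (x s) \<and> x0 * x s > 0)"
    define w where "w = (\<lambda>t. y t - F (x t))"
    define m where "m = (\<lambda>t. max \<bar>x t\<bar> \<bar>y t\<bar>)"
    have x0e: "x0 < e" "x0 < e / (2 * Z)" using x0 by (auto simp: \<eta>_def)
    have contx: "continuous_on {0..\<tau>} x"
      by (rule DERIV_continuous_on[where D = "\<lambda>t. y t + X (x t) (y t)"]) (use sol in blast)
    have conty: "continuous_on {0..\<tau>} y"
      by (rule DERIV_continuous_on[where D = "\<lambda>t. Y (x t) (y t)"]) (use sol in blast)
    have contm: "continuous_on {0..\<tau>} m"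
      unfolding m_def by (intro continuous_intros contx conty)
    have m0: "m 0 < e"
      using G.F_le[OF branch, of x0] x0 x0e e init by (auto simp: m_def)
    have region: "\<bar>x t\<bar> \<le> e" "\<bar>x t\<bar> < \<epsilon>" "x t ^ (2 * n) + (w t)\<^sup>2 < R ^ (2 * n)" if mt: "m t \<le> e" for t
    proof -
      show x: "\<bar>x t\<bar> \<le> e" "\<bar>x t\<bar> < \<epsilon>" using mt e \<epsilon> by (auto simp: m_def)
      have "\<bar>w t\<bar> \<le> 2 * e"
        using G.F_le[OF branch x(2)] mt x unfolding w_def m_def by auto
      then have "\<bar>w t\<bar>\<^sup>2 \<le> (2 * e)\<^sup>2" by (intro power_mono) auto
      then have "(w t)\<^sup>2 \<le> 4 * e\<^sup>2" by (simp add: power_mult_distrib)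
      moreover have "x t ^ (2 * n) \<le> e\<^sup>2"
      proof -
        have "x t ^ (2 * n) = \<bar>x t\<bar> ^ (2 * n)" by (simp add: power_even_abs)
        also have "\<dots> \<le> e ^ (2 * n)" using x by (intro power_mono) auto
        also have "\<dots> \<le> e\<^sup>2" using e Q.n by (intro power_decreasing) auto
        finally show ?thesis .
      qed
      moreover have "R ^ (2 * n) = 9 * e\<^sup>2"
        by (simp add: e_def power_divide power_mult[symmetric] mult.commute)
      moreover have "0 < e\<^sup>2" using e by simp
      ultimately show "x t ^ (2 * n) + (w t)\<^sup>2 < R ^ (2 * n)" by linarith
    qed
    have derivs: "(x has_real_derivative G.U (x t) (w t)) (at t within {0..T})"
      "(w has_real_derivative G.V (x t) (w t)) (at t within {0..T})"
      if t: "t \<in> {0..T}" and T: "T \<le> \<tau>" and mt: "m t \<le> e" for t T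
    proof -
      have sub: "{0..T} \<subseteq> {0..\<tau>}" using T by auto
      have dx: "(x has_real_derivative y t + X (x t) (y t)) (at t within {0..T})"
        and dy: "(y has_real_derivative Y (x t) (y t)) (at t within {0..T})"
        using sol t sub has_field_derivative_subset[OF _ sub] by blast+
      have y: "y t = F (x t) + w t" by (simp add: w_def)
      have U: "y t + X (x t) (y t) = G.U (x t) (w t)" by (simp add: G.U_def y)
      show dxU: "(x has_real_derivative G.U (x t) (w t)) (at t within {0..T})" using dx unfolding U .
      have "((\<lambda>t. F (x t)) has_real_derivative deriv F (x t) * G.U (x t) (w t)) (at t within {0..T})"
        by (rule DERIV_chain2[OF G.F_derivative(1)[OF branch region(2)[OF mt]] dxU])
      from DERIV_diff[OF dy this] show "(w has_real_derivative G.V (x t) (w t)) (at t within {0..T})"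
        unfolding w_def[symmetric] G.V_def y[symmetric] by simp
    qed
    have w0: "w 0 = 0" "x 0 > 0" using init x0 by (auto simp: w_def)
    have no_return: "\<not> (w t = 0 \<and> x t > 0)" if "t \<in> {0<..<\<tau>}" for t
      using first that x0 by (auto simp: w_def)
    have inside: "m t < e" if t: "t \<in> {0..\<tau>}" for t
    proof (rule ccontr)
      assume "\<not> m t < e"
      define E where "E = {t \<in> {0..\<tau>}. e \<le> m t}"
      have "closed E"
        unfolding E_def by (intro continuous_on_closed_Collect_le closed_atLeastAtMost continuous_on_const contm)
      then have "compact E" unfolding compact_eq_bounded_closed
        by (auto simp: E_def intro: bounded_subset[OF bounded_closed_interval])
      moreover have "E \<noteq> {}" using t \<open>\<not> m t < e\<close> by (auto simp: E_def)
      ultimately obtain T where T: "T \<in> E" "\<And>s. s \<in> E \<Longrightarrow> T \<le> s"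
        using compact_attains_inf by metis
      have Tr: "0 \<le> T" "T \<le> \<tau>" "e \<le> m T" using T(1) by (auto simp: E_def)
      obtain s where s: "0 \<le> s" "s \<le> T" "m s = e"
        using IVT'[of m 0 e T] m0 Tr continuous_on_subset[OF contm, of "{0..T}"] by auto
      have "T \<le> s" by (rule T(2)) (use s Tr in \<open>auto simp: E_def\<close>)
      then have mT: "m T = e" using s by simp
      have T0: "T > 0" using mT m0 Tr by (cases "T = 0") auto
      have le: "m s \<le> e" if "s \<in> {0..T}" for s
      proof (cases "s = T")
        case False
        then have "s \<notin> E" using T(2)[of s] that by auto
        then show ?thesis using that Tr by (auto simp: E_def)
      qed (simp add: mT)
      obtain \<Psi> \<rho> C S where \<Psi>: "0 < \<Psi>" "\<Psi> \<le> 4 * pi * n" "lyapunov_curve n \<Psi> C S" "\<rho> 0 = x 0"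
        "x T = \<rho> \<Psi> * C \<Psi>" "w T = \<rho> \<Psi> ^ n * S \<Psi>"
        "\<And>q. q \<in> {0<..<\<Psi>} \<Longrightarrow> \<not> (S q = 0 \<and> C q > 0)"
        "\<And>q. q \<in> {0..\<Psi>} \<Longrightarrow> 0 < \<rho> q \<and> \<rho> q < R \<and> \<rho> q \<le> x 0 * Z"
        "\<And>q. q \<in> {0..\<Psi>} \<Longrightarrow>
          (\<rho> has_real_derivative \<rho> q * Q.rate (\<rho> q) (C q) (S q)) (at q within {0..\<Psi>})"
      proof (rule Q.first_return_reparametrization[of T x w, folded Z_def])
        fix t assume "t \<in> {0..T}"
        then show "(x has_real_derivative G.U (x t) (w t)) (at t within {0..T})"
          "(w has_real_derivative G.V (x t) (w t)) (at t within {0..T})"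
          "x t ^ (2 * n) + (w t)\<^sup>2 < R ^ (2 * n)"
          using derivs[OF _ Tr(2)] region(3) le by auto
      next
        fix t assume "t \<in> {0<..<T}"
        then show "\<not> (w t = 0 \<and> x t > 0)" using no_return[of t] Tr by auto
      qed (use T0 w0 in \<open>assumption | blast\<close>)+
      have \<rho>: "0 < \<rho> \<Psi>" "\<rho> \<Psi> < R" "\<rho> \<Psi> \<le> x0 * Z" using \<Psi>(8)[of \<Psi>] \<Psi>(1) init by auto
      have "C \<Psi> ^ (2 * n) + (S \<Psi>)\<^sup>2 = 1"
        by (rule lyapunov_curve_invariant[OF \<Psi>(3) Q.n]) (use \<Psi>(1) in auto)
      note CS = unit_curve_bounds[OF this Q.n]
      have "\<rho> \<Psi> ^ n \<le> \<rho> \<Psi>" using power_decreasing[of 1 n "\<rho> \<Psi>"] \<rho> Q.n Q.R by simp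
      moreover have "\<bar>w T\<bar> \<le> \<rho> \<Psi> ^ n" using CS(2) \<rho> by (simp add: \<Psi>(6) abs_mult mult_left_le)
      moreover have "\<bar>x T\<bar> \<le> \<rho> \<Psi>" using CS(1) \<rho> by (simp add: \<Psi>(5) abs_mult mult_left_le)
      moreover have "\<bar>F (x T)\<bar> \<le> \<bar>x T\<bar>" by (rule G.F_le[OF branch region(2)]) (simp add: mT)
      ultimately have "m T \<le> 2 * \<rho> \<Psi>" unfolding m_def w_def by auto
      also have "\<dots> \<le> 2 * (x0 * Z)" using \<rho> by simp
      also have "\<dots> < e" using x0e(2) Z by (simp add: field_simps)
      finally show False using mT by simp
    qed
    show "first_return n G.U G.V R x0 (x \<tau>)"
      unfolding first_return_def
    proof (intro exI conjI ballI)
      fix t assume t: "t \<in> {0..\<tau>}"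
      then have mt: "m t \<le> e" using inside[of t] by simp
      show "(x has_real_derivative G.U (x t) (w t)) (at t within {0..\<tau>})"
        "(w has_real_derivative G.V (x t) (w t)) (at t within {0..\<tau>})"
        by (rule derivs[OF t order_refl mt])+
      show "x t ^ (2 * n) + (w t)\<^sup>2 < R ^ (2 * n)" by (rule region(3)[OF mt])
    qed (use \<tau> init w0 ret x0 no_return in \<open>auto simp: w_def zero_less_mult_iff\<close>)
  qed
qed

section \<open>Coefficients of the return map\<close>

lemma nilpotent_system_germ:
  fixes D :: "(real^'m) set"
  assumes "nilpotent_system D n X Y F" and \<delta>: "\<delta> \<in> D"
  shows "\<exists>cX cY r0. r0 > 0 \<and> (\<forall>i j. cX i j = taylor_coeff X i j \<delta>) \<and> (\<forall>i j. cY i j = taylor_coeff Y i j \<delta>) \<and>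
    (\<forall>r. 0 < r \<longrightarrow> r \<le> r0 \<longrightarrow>
      nilpotent_germ (\<lambda>x y. X x y \<delta>) (\<lambda>x y. Y x y \<delta>) (\<lambda>x. F x \<delta>) cX cY r)"
proof -
  have hoX: "higher_order_term D X" and hoY: "higher_order_term D Y" and F: "implicit_solution D X F"
    using assms(1) unfolding nilpotent_system_def by blast+
  obtain cX rX where cX: "rX > 0" "\<forall>i j. i + j < 2 \<longrightarrow> cX i j = 0" "\<forall>i j. cX i j = taylor_coeff X i j \<delta>"
    "\<forall>r x y. 0 < r \<and> r \<le> rX \<longrightarrow> summable (double_majorant cX r) \<and>
       (\<bar>x\<bar> \<le> r \<and> \<bar>y\<bar> \<le> r \<longrightarrow> double_series cX (of_real x) (of_real y) = of_real (X x y \<delta>))"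
    by (rule higher_order_term_expansion[OF hoX \<delta>]) (rule that)
  obtain cY rY where cY: "rY > 0" "\<forall>i j. i + j < 2 \<longrightarrow> cY i j = 0" "\<forall>i j. cY i j = taylor_coeff Y i j \<delta>"
    "\<forall>r x y. 0 < r \<and> r \<le> rY \<longrightarrow> summable (double_majorant cY r) \<and>
       (\<bar>x\<bar> \<le> r \<and> \<bar>y\<bar> \<le> r \<longrightarrow> double_series cY (of_real x) (of_real y) = of_real (Y x y \<delta>))"
    by (rule higher_order_term_expansion[OF hoY \<delta>]) (rule that)
  have "nilpotent_germ (\<lambda>x y. X x y \<delta>) (\<lambda>x y. Y x y \<delta>) (\<lambda>x. F x \<delta>) cX cY r"
    if "0 < r" "r \<le> min rX rY" for r
    by unfold_locales (use that cX(2,4) cY(2,4) F \<delta> in \<open>auto simp: implicit_solution_def\<close>)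
  then show ?thesis using cX(1,3) cY(1,3) by (intro exI[of _ cX] exI[of _ cY] exI[of _ "min rX rY"]) auto
qed

lemma center_focus_limits:
  fixes D :: "(real^'m) set"
  assumes cf: "center_focus_condition D n X Y F" and n: "n \<ge> 2" and \<delta>: "\<delta> \<in> D"
    and germ: "nilpotent_germ (\<lambda>x y. X x y \<delta>) (\<lambda>x y. Y x y \<delta>) (\<lambda>x. F x \<delta>) cX cY r"
  shows "\<exists>a b. a > 0 \<and> b\<^sup>2 < 4 * real n * a \<and>
      (\<forall>c. ((\<lambda>t. nilpotent_germ.g (\<lambda>x y. Y x y \<delta>) (\<lambda>x. F x \<delta>) (t * c) / t ^ (2 * n - 1))
              \<longlongrightarrow> a * c ^ (2 * n - 1)) (at_right 0)) \<and>
      (\<forall>c. ((\<lambda>t. nilpotent_germ.f (\<lambda>x y. X x y \<delta>) (\<lambda>x y. Y x y \<delta>) (\<lambda>x. F x \<delta>) (t * c) / t ^ (n - 1))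
              \<longlongrightarrow> b * c ^ (n - 1)) (at_right 0))"
proof -
  interpret H: nilpotent_germ "\<lambda>x y. X x y \<delta>" "\<lambda>x y. Y x y \<delta>" "\<lambda>x. F x \<delta>" cX cY r by (rule germ)
  obtain a b where "\<forall>\<delta>\<in>D. (\<exists>R. R \<in> O[nhds 0](\<lambda>x. x) \<and>
             (\<forall>\<^sub>F x in nhds 0. g_fun Y F x \<delta> = x ^ (2 * n - 1) * (a \<delta> + R x))) \<and> a \<delta> > 0 \<and>
        (\<lambda>x. f_fun X Y F x \<delta>) has_fps_expansion Abs_fps (\<lambda>j. if j \<ge> n - 1 then b j \<delta> else 0) \<and>
        (b (n - 1) \<delta>)\<^sup>2 - 4 * real n * a \<delta> < 0"
    using cf unfolding center_focus_condition_def by blast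
  from bspec[OF this \<delta>] obtain R where ab: "R \<in> O[nhds 0](\<lambda>x. x)"
    "\<forall>\<^sub>F x in nhds 0. g_fun Y F x \<delta> = x ^ (2 * n - 1) * (a \<delta> + R x)" "a \<delta> > 0"
    "(\<lambda>x. f_fun X Y F x \<delta>) has_fps_expansion Abs_fps (\<lambda>j. if j \<ge> n - 1 then b j \<delta> else 0)"
    "(b (n - 1) \<delta>)\<^sup>2 - 4 * real n * a \<delta> < 0"
    by blast
  have "g_fun Y F x \<delta> = H.g x" "f_fun X Y F x \<delta> = H.f x" for x
    by (simp_all add: g_fun_def f_fun_def H.g_def H.f_def)
  note ab' = ab(2,4)[unfolded this]
  have "((\<lambda>t. H.f (t * c) / t ^ (n - 1)) \<longlongrightarrow> b (n - 1) \<delta> * c ^ (n - 1)) (at_right 0)" for c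
    using scaled_limit_of_fps[OF ab'(2), of "n - 1" c] n by simp
  moreover have "((\<lambda>t. H.g (t * c) / t ^ (2 * n - 1)) \<longlongrightarrow> a \<delta> * c ^ (2 * n - 1)) (at_right 0)" for c
    by (rule scaled_limit_of_order[OF ab(1) ab'(1)])
  ultimately show ?thesis using ab(3,5) by (intro exI[of _ "a \<delta>"] exI[of _ "b (n - 1) \<delta>"]) auto
qed

lemma small_return_map:
  fixes \<delta> :: "real^'m"
  assumes germ: "nilpotent_germ (\<lambda>x y. X x y \<delta>) (\<lambda>x y. Y x y \<delta>) (\<lambda>x. F x \<delta>) cX cY r"
    and branch: "nilpotent_germ.branch (\<lambda>x. F x \<delta>) cX r \<epsilon> Fc"
    and rot: "quasihomogeneous_rotation n (nilpotent_germ.U (\<lambda>x y. X x y \<delta>) (\<lambda>x. F x \<delta>))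
        (nilpotent_germ.V (\<lambda>x y. X x y \<delta>) (\<lambda>x y. Y x y \<delta>) (\<lambda>x. F x \<delta>)) R \<kappa> L"
    and R: "R \<le> \<epsilon> / 8"
  shows "\<exists>\<eta>>0. \<forall>x0 x1. 0 < x0 \<longrightarrow> x0 < \<eta> \<longrightarrow> return_map X Y F \<delta> x0 x1 \<longrightarrow>
      first_return n (nilpotent_germ.U (\<lambda>x y. X x y \<delta>) (\<lambda>x. F x \<delta>))
        (nilpotent_germ.V (\<lambda>x y. X x y \<delta>) (\<lambda>x y. Y x y \<delta>) (\<lambda>x. F x \<delta>)) R x0 x1"
proof (rule small_return_is_first_return[OF germ branch rot R])
  fix \<eta> :: real
  assume \<eta>: "\<eta> > 0" and first: "\<And>x y \<tau> x0. 0 < x0 \<Longrightarrow> x0 < \<eta> \<Longrightarrow> \<tau> > 0 \<Longrightarrow>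
    \<forall>t\<in>{0..\<tau>}. (x has_real_derivative y t + X (x t) (y t) \<delta>) (at t within {0..\<tau>}) \<and>
      (y has_real_derivative Y (x t) (y t) \<delta>) (at t within {0..\<tau>}) \<Longrightarrow>
    x 0 = x0 \<Longrightarrow> y 0 = F x0 \<delta> \<Longrightarrow> y \<tau> = F (x \<tau>) \<delta> \<Longrightarrow> x0 * x \<tau> > 0 \<Longrightarrow>
    \<forall>s\<in>{0<..<\<tau>}. \<not> (y s = F (x s) \<delta> \<and> x0 * x s > 0) \<Longrightarrow>
    first_return n (nilpotent_germ.U (\<lambda>x y. X x y \<delta>) (\<lambda>x. F x \<delta>))
        (nilpotent_germ.V (\<lambda>x y. X x y \<delta>) (\<lambda>x y. Y x y \<delta>) (\<lambda>x. F x \<delta>)) R x0 (x \<tau>)"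
  show ?thesis
  proof (intro exI[of _ \<eta>] conjI allI impI \<eta>)
    fix x0 x1 assume x0: "0 < x0" "x0 < \<eta>" and "return_map X Y F \<delta> x0 x1"
    then obtain x y \<tau> where "\<tau> > 0" "solution_on X Y \<delta> \<tau> x y" "x 0 = x0" "y 0 = F x0 \<delta>"
      "y \<tau> = F (x \<tau>) \<delta>" "x0 * x \<tau> > 0" "\<forall>s\<in>{0<..<\<tau>}. \<not> (y s = F (x s) \<delta> \<and> x0 * x s > 0)"
      and x1: "x1 = x \<tau>"
      unfolding return_map_def by auto
    then show "first_return n (nilpotent_germ.U (\<lambda>x y. X x y \<delta>) (\<lambda>x. F x \<delta>))
        (nilpotent_germ.V (\<lambda>x y. X x y \<delta>) (\<lambda>x y. Y x y \<delta>) (\<lambda>x. F x \<delta>)) R x0 x1"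
      unfolding x1 solution_on_def by (intro first x0)
  qed
qed

theorem corollary1p1:
  fixes D :: "(real^'m) set"
    and X Y X' Y' :: "real \<Rightarrow> real \<Rightarrow> real^'m \<Rightarrow> real"
    and F F' :: "real \<Rightarrow> real^'m \<Rightarrow> real"
    and v v' :: "nat \<Rightarrow> real^'m \<Rightarrow> real"
    and n k :: nat
  assumes "compact D" and "n \<ge> 2" and "k \<ge> 1"
    and "nilpotent_system D n X Y F"
    and "nilpotent_system D n X' Y' F'"
    and "return_coefficients D X Y F v"
    and "return_coefficients D X' Y' F' v'"
    and "same_taylor_terms D ((k + 2) * n - 2) X X'"
    and "same_taylor_terms D ((k + 2) * n - 2) Y Y'"
  shows "\<forall>\<delta>\<in>D. \<forall>j\<in>{1..k * n}. v j \<delta> = v' j \<delta>"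
proof (intro ballI)
  fix \<delta> j assume \<delta>: "\<delta> \<in> D" and j: "j \<in> {1..k * n}"
  define N where "N = (k + 2) * n - 2"
  have N: "N + 1 = k * n + (2 * n - 1)" using \<open>n \<ge> 2\<close> by (simp add: N_def algebra_simps)
  have n1: "n \<ge> 1" using \<open>n \<ge> 2\<close> by simp
  have cf: "center_focus_condition D n X Y F" and cf': "center_focus_condition D n X' Y' F'"
    using assms(4,5) unfolding nilpotent_system_def by blast+
  obtain cX cY r1 where c: "r1 > 0"
    "\<And>i j. cX i j = taylor_coeff X i j \<delta>" "\<And>i j. cY i j = taylor_coeff Y i j \<delta>"
    "\<And>r. 0 < r \<Longrightarrow> r \<le> r1 \<Longrightarrow>
       nilpotent_germ (\<lambda>x y. X x y \<delta>) (\<lambda>x y. Y x y \<delta>) (\<lambda>x. F x \<delta>) cX cY r"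
    using nilpotent_system_germ[OF assms(4) \<delta>] by blast
  obtain cX' cY' r2 where c': "r2 > 0"
    "\<And>i j. cX' i j = taylor_coeff X' i j \<delta>" "\<And>i j. cY' i j = taylor_coeff Y' i j \<delta>"
    "\<And>r. 0 < r \<Longrightarrow> r \<le> r2 \<Longrightarrow>
       nilpotent_germ (\<lambda>x y. X' x y \<delta>) (\<lambda>x y. Y' x y \<delta>) (\<lambda>x. F' x \<delta>) cX' cY' r"
    using nilpotent_system_germ[OF assms(5) \<delta>] by blast
  define r where "r = min r1 r2"
  have r: "0 < r" "r \<le> r1" "r \<le> r2" using c(1) c'(1) by (auto simp: r_def)
  define X\<delta> Y\<delta> F\<delta> where "X\<delta> = (\<lambda>x y. X x y \<delta>)" and "Y\<delta> = (\<lambda>x y. Y x y \<delta>)" and "F\<delta> = (\<lambda>x. F x \<delta>)"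
  define X\<delta>' Y\<delta>' F\<delta>' where "X\<delta>' = (\<lambda>x y. X' x y \<delta>)" and "Y\<delta>' = (\<lambda>x y. Y' x y \<delta>)" and "F\<delta>' = (\<lambda>x. F' x \<delta>)"
  note fns = X\<delta>_def Y\<delta>_def F\<delta>_def X\<delta>'_def Y\<delta>'_def F\<delta>'_def
  have germ: "nilpotent_germ X\<delta> Y\<delta> F\<delta> cX cY r" unfolding fns by (rule c(4)[OF r(1,2)])
  have germ': "nilpotent_germ X\<delta>' Y\<delta>' F\<delta>' cX' cY' r" unfolding fns by (rule c'(4)[OF r(1,3)])
  interpret G: nilpotent_germ X\<delta> Y\<delta> F\<delta> cX cY r by (rule germ)
  interpret G': nilpotent_germ X\<delta>' Y\<delta>' F\<delta>' cX' cY' r by (rule germ')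
  obtain \<epsilon>1 Fc where branch1: "G.branch \<epsilon>1 Fc" using G.branch_exists by blast
  obtain \<epsilon>2 Fc' where branch2: "G'.branch \<epsilon>2 Fc'" using G'.branch_exists by blast
  define \<epsilon> where "\<epsilon> = min \<epsilon>1 \<epsilon>2"
  have \<epsilon>: "0 < \<epsilon>" using G.\<epsilon>(1)[OF branch1] G'.\<epsilon>(1)[OF branch2] by (simp add: \<epsilon>_def)
  have branch: "G.branch \<epsilon> Fc" by (rule G.branch_smaller[OF branch1 \<epsilon>]) (simp add: \<epsilon>_def)
  have branch': "G'.branch \<epsilon> Fc'" by (rule G'.branch_smaller[OF branch2 \<epsilon>]) (simp add: \<epsilon>_def)
  obtain a b where ab: "a > 0" "b\<^sup>2 < 4 * real n * a"
    "\<And>c. ((\<lambda>t. G.g (t * c) / t ^ (2 * n - 1)) \<longlongrightarrow> a * c ^ (2 * n - 1)) (at_right 0)"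
    "\<And>c. ((\<lambda>t. G.f (t * c) / t ^ (n - 1)) \<longlongrightarrow> b * c ^ (n - 1)) (at_right 0)"
    using center_focus_limits[OF cf assms(2) \<delta> germ[unfolded fns], folded fns] by blast
  obtain a' b' where ab': "a' > 0" "b'\<^sup>2 < 4 * real n * a'"
    "\<And>c. ((\<lambda>t. G'.g (t * c) / t ^ (2 * n - 1)) \<longlongrightarrow> a' * c ^ (2 * n - 1)) (at_right 0)"
    "\<And>c. ((\<lambda>t. G'.f (t * c) / t ^ (n - 1)) \<longlongrightarrow> b' * c ^ (n - 1)) (at_right 0)"
    using center_focus_limits[OF cf' assms(2) \<delta> germ'[unfolded fns], folded fns] by blast
  obtain R1 \<kappa>1 L1 where rot1: "R1 \<le> \<epsilon> / 8" "quasihomogeneous_rotation n G.U G.V R1 \<kappa>1 L1"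
    using G.rotation_exists[OF branch n1 ab] by blast
  obtain R2 \<kappa>2 L2 where rot2: "R2 \<le> \<epsilon> / 8" "quasihomogeneous_rotation n G'.U G'.V R2 \<kappa>2 L2"
    using G'.rotation_exists[OF branch' n1 ab'] by blast
  define R \<kappa> L where "R = min R1 R2" and "\<kappa> = min \<kappa>1 \<kappa>2" and "L = max L1 L2"
  have pos: "R1 > 0" "R2 > 0" "\<kappa>1 > 0" "\<kappa>2 > 0"
    using quasihomogeneous_rotation.R(1)[OF rot1(2)] quasihomogeneous_rotation.R(1)[OF rot2(2)]
      quasihomogeneous_rotation.\<kappa>[OF rot1(2)] quasihomogeneous_rotation.\<kappa>[OF rot2(2)] by auto
  have rot: "quasihomogeneous_rotation n G.U G.V R \<kappa> L" "quasihomogeneous_rotation n G'.U G'.V R \<kappa> L"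
    by (rule quasihomogeneous_rotation_weaken[OF rot1(2)] quasihomogeneous_rotation_weaken[OF rot2(2)];
        use pos in \<open>simp add: R_def \<kappa>_def L_def\<close>)+
  have R: "0 < R" "R \<le> \<epsilon> / 8" "R \<le> 1"
    using pos rot1(1) quasihomogeneous_rotation.R(2)[OF rot(1)] by (auto simp: R_def)
  obtain C where C: "C \<ge> 0"
    "\<And>t x w. 0 < t \<Longrightarrow> t < \<epsilon> / 2 \<Longrightarrow> \<bar>x\<bar> \<le> t \<Longrightarrow> \<bar>w\<bar> \<le> t \<Longrightarrow> \<bar>G.U x w - G'.U x w\<bar> \<le> C * t ^ (N + 1)"
    "\<And>t x w. 0 < t \<Longrightarrow> t < \<epsilon> / 2 \<Longrightarrow> \<bar>x\<bar> \<le> t \<Longrightarrow> \<bar>w\<bar> \<le> t \<Longrightarrow> \<bar>G.V x w - G'.V x w\<bar> \<le> C * t ^ (N + 1)"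
  proof (rule field_difference[OF germ germ' branch branch', of N])
    show "cX i j = cX' i j" "cY i j = cY' i j" if "i + j \<le> N" for i j
      using that \<delta> \<open>same_taylor_terms D ((k + 2) * n - 2) X X'\<close> \<open>same_taylor_terms D ((k + 2) * n - 2) Y Y'\<close>
      by (auto simp: c(2,3) c'(2,3) same_taylor_terms_def N_def)
  qed (rule that)
  \<comment> \<open>\<open>V\<close> is divided by \<open>t ^ (2 * n - 1)\<close>, which uses up \<open>N + 1 = k * n + (2 * n - 1)\<close> exactly; for \<open>U\<close>
    there is room to spare.\<close>
  have diff: "\<bar>G.U (t * c) (t ^ n * s) / t ^ n - G'.U (t * c) (t ^ n * s) / t ^ n\<bar> \<le> C * t ^ (k * n)"
    "\<bar>G.V (t * c) (t ^ n * s) / t ^ (2 * n - 1) - G'.V (t * c) (t ^ n * s) / t ^ (2 * n - 1)\<bar> \<le> C * t ^ (k * n)"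
    if t: "0 < t" "t < R" and cs: "c ^ (2 * n) + s\<^sup>2 = 1" for t c s :: real
  proof -
    note cs1 = unit_curve_bounds[OF cs n1]
    have t1: "t \<le> 1" "t < \<epsilon> / 2" using t R \<epsilon> by auto
    have "\<bar>t * c\<bar> \<le> t" using t cs1 by (simp add: abs_mult mult_left_le)
    moreover have "\<bar>t ^ n * s\<bar> \<le> t"
    proof -
      have "\<bar>t ^ n * s\<bar> \<le> t ^ n" using t cs1 by (simp add: abs_mult mult_left_le)
      also have "\<dots> \<le> t" using power_decreasing[of 1 n t] t t1 n1 by simp
      finally show ?thesis .
    qed
    ultimately have d: "\<bar>G.U (t * c) (t ^ n * s) - G'.U (t * c) (t ^ n * s)\<bar> \<le> C * t ^ (N + 1)"
      "\<bar>G.V (t * c) (t ^ n * s) - G'.V (t * c) (t ^ n * s)\<bar> \<le> C * t ^ (N + 1)"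
      using C(2,3)[OF t(1) t1(2)] by blast+
    have N': "t ^ (N + 1) = t ^ (k * n) * t ^ (2 * n - 1)" unfolding N power_add ..
    have "t ^ (2 * n - 1) \<le> t ^ n" using t t1 n1 by (intro power_decreasing) auto
    then have "C * t ^ (N + 1) \<le> C * t ^ (k * n) * t ^ n"
      unfolding N' mult.assoc using C(1) t by (intro mult_left_mono) auto
    with d(1) have "\<bar>G.U (t * c) (t ^ n * s) - G'.U (t * c) (t ^ n * s)\<bar> \<le> C * t ^ (k * n) * t ^ n" by linarith
    then show "\<bar>G.U (t * c) (t ^ n * s) / t ^ n - G'.U (t * c) (t ^ n * s) / t ^ n\<bar> \<le> C * t ^ (k * n)"
      using t by (simp add: diff_divide_distrib[symmetric] abs_divide divide_le_eq)
    show "\<bar>G.V (t * c) (t ^ n * s) / t ^ (2 * n - 1) - G'.V (t * c) (t ^ n * s) / t ^ (2 * n - 1)\<bar> \<le> C * t ^ (k * n)"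
      using d(2) t unfolding N' by (simp add: diff_divide_distrib[symmetric] abs_divide divide_le_eq mult.assoc)
  qed
  obtain K where K: "\<And>x0 x1 x2. first_return n G.U G.V R x0 x1 \<Longrightarrow> first_return n G'.U G'.V R x0 x2 \<Longrightarrow>
      \<bar>x1 - x2\<bar> \<le> K * x0 ^ (k * n + 1)"
    using first_returns_close[OF rot C(1) diff] by blast
  obtain \<eta>1 where \<eta>1: "\<eta>1 > 0" "\<And>x0 x1. 0 < x0 \<Longrightarrow> x0 < \<eta>1 \<Longrightarrow> return_map X Y F \<delta> x0 x1 \<Longrightarrow>
      first_return n G.U G.V R x0 x1"
    using small_return_map[where X = X and Y = Y and F = F and \<delta> = \<delta>, folded fns, OF germ branch rot(1) R(2)] by blast
  obtain \<eta>2 where \<eta>2: "\<eta>2 > 0" "\<And>x0 x1. 0 < x0 \<Longrightarrow> x0 < \<eta>2 \<Longrightarrow> return_map X' Y' F' \<delta> x0 x1 \<Longrightarrow>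
      first_return n G'.U G'.V R x0 x1"
    using small_return_map[where X = X' and Y = Y' and F = F' and \<delta> = \<delta>, folded fns, OF germ' branch' rot(2) R(2)] by blast
  obtain P where P: "\<forall>\<^sub>F x0 in at_right 0. return_map X Y F \<delta> x0 (P x0 \<delta>)"
    "(\<lambda>x0. P x0 \<delta> - x0) has_fps_expansion Abs_fps (\<lambda>j. if j \<ge> 1 then v j \<delta> else 0)"
    using \<open>return_coefficients D X Y F v\<close> \<delta> unfolding return_coefficients_def by blast
  obtain P' where P': "\<forall>\<^sub>F x0 in at_right 0. return_map X' Y' F' \<delta> x0 (P' x0 \<delta>)"
    "(\<lambda>x0. P' x0 \<delta> - x0) has_fps_expansion Abs_fps (\<lambda>j. if j \<ge> 1 then v' j \<delta> else 0)"
    using \<open>return_coefficients D X' Y' F' v'\<close> \<delta> unfolding return_coefficients_def by blast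
  have "fps_nth (Abs_fps (\<lambda>j. if j \<ge> 1 then v j \<delta> else 0) - Abs_fps (\<lambda>j. if j \<ge> 1 then v' j \<delta> else 0)) j = 0"
  proof (rule fps_coefficients_vanish_of_bound[OF has_fps_expansion_diff[OF P(2) P'(2)]])
    show "\<forall>\<^sub>F x0 in at_right 0. \<bar>P x0 \<delta> - x0 - (P' x0 \<delta> - x0)\<bar> \<le> K * x0 ^ (k * n + 1)"
      using P(1) P'(1) eventually_at_right_real[OF \<eta>1(1)] eventually_at_right_real[OF \<eta>2(1)]
    proof eventually_elim
      case (elim x0)
      then show ?case using K[OF \<eta>1(2) \<eta>2(2), of x0] by simp
    qed
  qed (use j in auto)
  then show "v j \<delta> = v' j \<delta>" using j by simp
qed

end
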